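(* Let $\Omega\subset\mathbb{R}^3$ be a smooth bounded domain. Let $I$ be either a compact interval or an interval of the form $[\tau,+\infty)$ with $\tau>0$. Let $\mathcal K\subset\mathbb{R}$ be a set of indices and let $\{f_\rho\}_{\rho\in\mathcal K}\subset L^\infty(I;V)\cap C(I;H)$. Let $g\in C(I;L^q(\Omega))$ with $q\ge1$, let $\delta\in(0,\frac12)$, and for $t\in I$ set $$E(t):=\{x\in\Omega:\ g(t,x)\le1-2\delta\}.$$ Assume that, for any $\rho\in\mathcal K$ and any $t\in I$, $f_\rho(t)\equiv0$ on $E(t)$. Moreover assume that, for a fixed $\varepsilon>0$ sufficiently small, for any $t\in I$ the set $\{x\in\Omega:\ g(t,x)\le1-2\delta-\varepsilon\}\subset E(t)$ has strictly positive Lebesgue measure. In the case $I=[\tau,+\infty)$, assume additionally that for any sequence $\{t_l\}_l\subset I$ with $t_l\to\infty$ as $l\to\infty$, there exist a (non-relabeled) subsequence $\{t_l\}_l$, a function $g^\star\in L^r(\Omega)$, $r\ge1$, and $\widetilde\varepsilon>0$ such that $g(t_l)\to g^\star$ strongly in $L^r(\Omega)$ as $l\to\infty$ and the set $\{x\in\Omega:\ g^\star(x)\le1-2\delta-\widetilde\varepsilon\}$ has strictly positive Lebesgue measure. Then there exists a constant $C_P>0$, uniform in $\rho$ and $t$, such that $$\|f_\rho(t)\|\le C_P\|\nabla f_\rho(t)\|\qquad\forall t\in I,\ \forall\rho\in\mathcal K.$$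
   Context: $H=L^2(\Omega)$ with norm $\|\cdot\|$ (also used for $L^2(\Omega)^3$), and $V=H^1(\Omega)$. A domain is connected and open. Since $C(I;H)\cap L^\infty(I;V)\hookrightarrow C_w(I;V)$ (weakly continuous $V$-valued functions), $f_\rho(t)\in V$ is well defined for every $t\in I$. Pointwise statements about $g(t,\cdot)$, $f_\rho(t)$ and $g^\star$ are understood up to Lebesgue-null sets. *)

theory Defs
  imports "HOL-Analysis.Analysis" "HOL-Probability.Essential_Supremum"
begin

text \<open>Elements of Lebesgue and Sobolev spaces are represented by functions; all notions below
  depend only on the values almost everywhere on \<open>\<Omega>\<close>.\<close>

section \<open>Smooth functions and smooth domains\<close>

fun Ck :: "nat \<Rightarrow> ('a::euclidean_space \<Rightarrow> real) \<Rightarrow> bool" where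
  "Ck 0 f \<longleftrightarrow> continuous_on UNIV f"
| "Ck (Suc k) f \<longleftrightarrow> (\<forall>x. f differentiable at x) \<and>
     (\<forall>b\<in>Basis. Ck k (\<lambda>x. frechet_derivative f (at x) b))"

definition smooth :: "('a::euclidean_space \<Rightarrow> real) \<Rightarrow> bool" where
  "smooth f \<longleftrightarrow> (\<forall>k. Ck k f)"

text \<open>Near each boundary point the domain is, after an orthogonal change of coordinates, the
  region strictly above the graph of a smooth function.\<close>

definition smooth_boundary :: "(real^3) set \<Rightarrow> bool" where
  "smooth_boundary \<Omega> \<longleftrightarrow> (\<forall>p\<in>frontier \<Omega>.
     \<exists>r>0. \<exists>T :: real^3 \<Rightarrow> real^3. \<exists>\<gamma> :: real^2 \<Rightarrow> real.
       orthogonal_transformation T \<and> smooth \<gamma> \<and>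
       \<Omega> \<inter> ball p r = {x \<in> ball p r. T x $ 3 > \<gamma> (vector [T x $ 1, T x $ 2])})"

definition smooth_bounded_domain :: "(real^3) set \<Rightarrow> bool" where
  "smooth_bounded_domain \<Omega> \<longleftrightarrow> open \<Omega> \<and> connected \<Omega> \<and> bounded \<Omega> \<and> smooth_boundary \<Omega>"

section \<open>Lebesgue spaces\<close>

text \<open>The exponent ranges over the extended half-line; it is used only for \<open>1 \<le> p \<le> \<infinity>\<close>.\<close>

definition Lp :: "ennreal \<Rightarrow> 'a::euclidean_space set \<Rightarrow> ('a \<Rightarrow> 'b::euclidean_space) set" where
  "Lp p \<Omega> = {u \<in> borel_measurable (lebesgue_on \<Omega>).
     if p = \<infinity> then esssup (lebesgue_on \<Omega>) (\<lambda>x. ereal (norm (u x))) < \<infinity>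
     else integrable (lebesgue_on \<Omega>) (\<lambda>x. norm (u x) powr enn2real p)}"

text \<open>Only meaningful on \<^const>\<open>Lp\<close>: the integral of a non-integrable function is 0.\<close>

definition Lp_norm :: "ennreal \<Rightarrow> 'a::euclidean_space set \<Rightarrow> ('a \<Rightarrow> 'b::euclidean_space) \<Rightarrow> real" where
  "Lp_norm p \<Omega> u =
     (if p = \<infinity> then real_of_ereal (esssup (lebesgue_on \<Omega>) (\<lambda>x. ereal (norm (u x))))
      else (\<integral>x. norm (u x) powr enn2real p \<partial>lebesgue_on \<Omega>) powr (1 / enn2real p))"

definition tendsto_Lp ::
    "ennreal \<Rightarrow> 'a::euclidean_space set \<Rightarrow> (nat \<Rightarrow> 'a \<Rightarrow> real) \<Rightarrow> ('a \<Rightarrow> real) \<Rightarrow> bool" where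
  "tendsto_Lp p \<Omega> u v \<longleftrightarrow> (\<forall>n. u n \<in> Lp p \<Omega>) \<and> v \<in> Lp p \<Omega> \<and>
     (\<lambda>n. Lp_norm p \<Omega> (\<lambda>x. u n x - v x)) \<longlonglongrightarrow> 0"

section \<open>The Sobolev space of order one\<close>

definition test_function :: "'a::euclidean_space set \<Rightarrow> ('a \<Rightarrow> real) \<Rightarrow> bool" where
  "test_function \<Omega> \<phi> \<longleftrightarrow> smooth \<phi> \<and>
     compact (closure {x. \<phi> x \<noteq> 0}) \<and> closure {x. \<phi> x \<noteq> 0} \<subseteq> \<Omega>"

definition is_weak_gradient ::
    "'a::euclidean_space set \<Rightarrow> ('a \<Rightarrow> real) \<Rightarrow> ('a \<Rightarrow> 'a) \<Rightarrow> bool" where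
  "is_weak_gradient \<Omega> u G \<longleftrightarrow> (\<forall>\<phi> b. test_function \<Omega> \<phi> \<and> b \<in> Basis \<longrightarrow>
     (\<integral>x. u x * frechet_derivative \<phi> (at x) b \<partial>lebesgue_on \<Omega>) =
     - (\<integral>x. (G x \<bullet> b) * \<phi> x \<partial>lebesgue_on \<Omega>))"

definition H1 :: "'a::euclidean_space set \<Rightarrow> ('a \<Rightarrow> real) set" where
  "H1 \<Omega> = {u \<in> Lp 2 \<Omega>. \<exists>G \<in> Lp 2 \<Omega>. is_weak_gradient \<Omega> u G}"

text \<open>Unique up to null sets for \<open>u\<close> in \<^const>\<open>H1\<close>.\<close>

definition weak_grad :: "'a::euclidean_space set \<Rightarrow> ('a \<Rightarrow> real) \<Rightarrow> 'a \<Rightarrow> 'a" where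
  "weak_grad \<Omega> u = (SOME G. G \<in> Lp 2 \<Omega> \<and> is_weak_gradient \<Omega> u G)"

definition H1_norm :: "'a::euclidean_space set \<Rightarrow> ('a \<Rightarrow> real) \<Rightarrow> real" where
  "H1_norm \<Omega> u = sqrt ((Lp_norm 2 \<Omega> u)\<^sup>2 + (Lp_norm 2 \<Omega> (weak_grad \<Omega> u))\<^sup>2)"

section \<open>Spaces of time-dependent functions\<close>

text \<open>Here \<open>X\<close> is a function space on \<open>\<Omega>\<close> and \<open>N\<close> its (semi-)norm.\<close>

definition continuous_in_time ::
    "real set \<Rightarrow> ('a \<Rightarrow> real) set \<Rightarrow> (('a \<Rightarrow> real) \<Rightarrow> real) \<Rightarrow> (real \<Rightarrow> 'a \<Rightarrow> real) \<Rightarrow> bool" where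
  "continuous_in_time I X N f \<longleftrightarrow> (\<forall>t\<in>I. f t \<in> X) \<and>
     (\<forall>t\<in>I. ((\<lambda>s. N (\<lambda>x. f s x - f t x)) \<longlongrightarrow> 0) (at t within I))"

text \<open>Bochner (strong) measurability: almost everywhere limit of simple \<open>X\<close>-valued functions.\<close>

definition strongly_measurable_in_time ::
    "real set \<Rightarrow> ('a \<Rightarrow> real) set \<Rightarrow> (('a \<Rightarrow> real) \<Rightarrow> real) \<Rightarrow> (real \<Rightarrow> 'a \<Rightarrow> real) \<Rightarrow> bool" where
  "strongly_measurable_in_time I X N f \<longleftrightarrow> (\<exists>s :: nat \<Rightarrow> real \<Rightarrow> 'a \<Rightarrow> real.
     (\<forall>n. finite (s n ` I) \<and> s n ` I \<subseteq> X \<and> (\<forall>v. {t\<in>I. s n t = v} \<in> sets lebesgue)) \<and>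
     (AE t in lebesgue_on I. (\<lambda>n. N (\<lambda>x. s n t x - f t x)) \<longlonglongrightarrow> 0))"

definition Linfty_in_time ::
    "real set \<Rightarrow> ('a \<Rightarrow> real) set \<Rightarrow> (('a \<Rightarrow> real) \<Rightarrow> real) \<Rightarrow> (real \<Rightarrow> 'a \<Rightarrow> real) \<Rightarrow> bool" where
  "Linfty_in_time I X N f \<longleftrightarrow> (AE t in lebesgue_on I. f t \<in> X) \<and>
     strongly_measurable_in_time I X N f \<and>
     (\<exists>C. AE t in lebesgue_on I. N (f t) \<le> C)"

end

theory Submission
  imports Defs
begin

text \<open>A weak gradient \<open>G\<close> of \<open>u\<close> controls translations: if the segments from \<open>x\<close> to
  \<open>x + v\<close>, \<open>x \<in> S\<close>, stay in \<open>\<Omega>\<close>, then \<open>\<integral>\<^sub>S \<bar>u (x + v) - u x\<bar>\<^sup>2 \<le> \<bar>v\<bar>\<^sup>2 \<integral> \<bar>G\<bar>\<^sup>2\<close>. This follows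
  for Steklov averages of \<open>u\<close> by testing the weak gradient against smooth approximations of
  indicators of boxes, and for \<open>u\<close> by Lebesgue differentiation and Fatou's lemma. Averaging over
  \<open>v\<close> gives a Poincare inequality (up to a constant) on small balls; chains of overlapping balls
  extend it to compact subsets of the connected set \<open>\<Omega>\<close>, and since \<open>\<Omega>\<close> lies locally above a
  graph, a finite number of inward shifts moves a boundary layer into such a compact set. If \<open>u\<close>
  vanishes on a set of measure at least \<open>m\<close>, then the constant is controlled by \<open>m\<close> as well.

  By continuity of \<open>g\<close> in \<open>L\<^sup>q\<close> and Chebyshev's inequality, the measure of \<open>E(t)\<close> is locally
  bounded below, hence uniformly on compact intervals; near infinity this follows in the same way
  from the assumption on sequences. Finally, \<open>f\<^sub>\<rho>(t) \<in> H\<^sup>1\<close> for every \<open>t\<close>: among the gradients of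
  functions that are \<open>L\<^sup>2\<close>-close to \<open>f\<^sub>\<rho>(t)\<close>, nearly minimal ones form a Cauchy sequence by the
  parallelogram law.\<close>

section \<open>Smooth bump functions\<close>

text \<open>Uniformity in \<rho> and t shapes the argument: the constant may depend on \<Omega> and
  on a lower bound m for the measure of the vanishing set, but neither on the function nor on the
  set itself. Every inequality is therefore proved with its constant quantified before the function,
  and no compactness argument by contradiction is applied to the functions. The translation estimate
  comes by duality, straight from the definition of the weak gradient, so neither density of smooth
  functions up to the boundary nor an extension operator enters. Most integrals live in
  \<open>ennreal\<close>, where Tonelli, Fatou and monotone convergence ask for no integrability of
  the squares. A second obstacle is that membership in L^\<infinity>(I;V) speaks about almost every
  t while the claim is for every t; hence H^1 has to be shown closed under L^2 limits with bounded
  gradients. The measure hypotheses on g serve to find one m for all t in I; the gap \<epsilon>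
  between the two levels is what lets a sublevel set survive a small perturbation of g.\<close>

lemma Ck_Suc_imp_Ck: "Ck (Suc k) f \<Longrightarrow> Ck k f"
proof (induction k arbitrary: f)
  case 0
  then show ?case
    by (auto simp: continuous_on_eq_continuous_at differentiable_imp_continuous_within)
next
  case (Suc k)
  then show ?case by (metis Ck.simps(2))
qed

lemma Ck_const: "Ck k (\<lambda>x. c)"
  by (induction k arbitrary: c) (auto simp: frechet_derivative_const)

lemma Ck_add: "Ck k f \<Longrightarrow> Ck k g \<Longrightarrow> Ck k (\<lambda>x. f x + g x)"
proof (induction k arbitrary: f g)
  case 0
  then show ?case by (auto intro: continuous_intros)
next
  case (Suc k)
  have "frechet_derivative (\<lambda>x. f x + g x) (at x) b =
      frechet_derivative f (at x) b + frechet_derivative g (at x) b" for x b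
    using Suc.prems
    by (subst frechet_derivative_at[OF has_derivative_add[OF
          frechet_derivative_works[THEN iffD1] frechet_derivative_works[THEN iffD1]], symmetric]) auto
  with Suc show ?case by auto
qed

lemma Ck_mult: "Ck k f \<Longrightarrow> Ck k g \<Longrightarrow> Ck k (\<lambda>x. f x * g x)"
proof (induction k arbitrary: f g)
  case 0
  then show ?case by (auto intro: continuous_intros)
next
  case (Suc k)
  have "frechet_derivative (\<lambda>x. f x * g x) (at x) b =
      f x * frechet_derivative g (at x) b + frechet_derivative f (at x) b * g x" for x b
    using Suc.prems
    by (subst frechet_derivative_at[OF has_derivative_mult[OF
          frechet_derivative_works[THEN iffD1] frechet_derivative_works[THEN iffD1]], symmetric]) auto
  moreover have "Ck k f" "Ck k g" using Suc.prems by (auto intro: Ck_Suc_imp_Ck)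
  ultimately show ?case using Suc by (auto intro!: Ck_add)
qed

lemma Ck_prod: "finite A \<Longrightarrow> (\<And>i. i \<in> A \<Longrightarrow> Ck k (f i)) \<Longrightarrow> Ck k (\<lambda>x. \<Prod>i\<in>A. f i x)"
  by (induction A rule: finite_induct) (auto intro: Ck_const Ck_mult)

lemma has_derivative_translate:
  fixes f :: "'a::euclidean_space \<Rightarrow> real"
  assumes "f differentiable at (x - c)"
  shows "((\<lambda>x. f (x - c)) has_derivative frechet_derivative f (at (x - c))) (at x)"
proof -
  have "((\<lambda>x. x - c) has_derivative (\<lambda>h. h)) (at x)"
    by (auto intro!: derivative_eq_intros)
  moreover have "(f has_derivative frechet_derivative f (at (x - c))) (at (x - c))"
    using assms frechet_derivative_works by blast
  ultimately show ?thesis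
    using diff_chain_at[of "\<lambda>x. x - c" "\<lambda>h. h" x f] by (simp add: o_def)
qed

lemma Ck_translate: "Ck k f \<Longrightarrow> Ck k (\<lambda>x. f (x - c))"
proof (induction k arbitrary: f)
  case 0
  then show ?case by (auto intro!: continuous_intros intro: continuous_on_compose2)
next
  case (Suc k)
  have d: "((\<lambda>x. f (x - c)) has_derivative frechet_derivative f (at (x - c))) (at x)" for x
    by (rule has_derivative_translate) (use Suc.prems in auto)
  show ?case using Suc.prems Suc.IH[of "\<lambda>x. frechet_derivative f (at x) _"]
    by (auto simp: frechet_derivative_at[OF d, symmetric] intro: d[THEN differentiableI])
qed

text \<open>Derivatives of exp(-1/t) only produce polynomial factors in 1/t. Carrying the polynomial
  \<open>p\<close> along closes the family under differentiation, so smoothness becomes an induction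
  with \<open>p\<close> arbitrary.\<close>

definition flat_exp :: "real poly \<Rightarrow> real \<Rightarrow> real" where
  "flat_exp p t = (if t > 0 then poly p (1 / t) * exp (- (1 / t)) else 0)"

lemma tendsto_flat_exp_0: "((flat_exp p) \<longlongrightarrow> 0) (at 0)"
proof -
  have "((\<lambda>x::real. \<Sum>i\<le>degree p. coeff p i * (x ^ i / exp x)) \<longlongrightarrow> (\<Sum>i\<le>degree p. coeff p i * 0)) at_top"
    by (intro tendsto_intros tendsto_power_div_exp_0)
  then have "((\<lambda>x. poly p x * exp (- x)) \<longlongrightarrow> 0) at_top"
    by (simp add: poly_altdef exp_minus field_simps sum_distrib_left sum_distrib_right)
  then have "((\<lambda>t. poly p (inverse t) * exp (- inverse t)) \<longlongrightarrow> 0) (at_right 0)"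
    by (rule filterlim_compose[OF _ filterlim_inverse_at_top_right])
  then have r: "(flat_exp p \<longlongrightarrow> 0) (at_right 0)"
    by (rule Lim_transform_eventually)
       (auto simp: flat_exp_def eventually_at_filter inverse_eq_divide)
  have l: "(flat_exp p \<longlongrightarrow> 0) (at_left 0)"
    by (rule Lim_transform_eventually[OF tendsto_const])
       (auto simp: flat_exp_def eventually_at_filter)
  show ?thesis using l r by (simp add: filterlim_split_at)
qed

text \<open>With s = 1/t and s' = -s^2, the derivative of p(s) exp(-s) is s^2 (p(s) - p'(s))
  exp(-s); the factor s^2 is the polynomial \<open>[:0,0,1:]\<close>.\<close>

lemma DERIV_flat_exp:
  "(flat_exp p has_real_derivative flat_exp ([:0,0,1:] * (p - pderiv p)) t) (at t)"
proof -
  consider "t < 0" | "t = 0" | "t > 0" by linarith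
  then show ?thesis
  proof cases
    case 1
    have "((\<lambda>t. 0) has_real_derivative 0) (at t)" by simp
    then have "(flat_exp p has_real_derivative 0) (at t)"
      by (rule has_field_derivative_transform_within_open[where S="{..<0}"])
         (use 1 in \<open>auto simp: flat_exp_def\<close>)
    with 1 show ?thesis by (simp add: flat_exp_def)
  next
    case 2
    \<comment> \<open>Division by h multiplies the polynomial by its variable, so the difference
      quotient at 0 is again a member of the family, namely \<open>flat_exp (pCons 0 p)\<close>, and
      tends to 0.\<close>
    have "(\<lambda>h. (flat_exp p (0 + h) - flat_exp p 0) / h) \<midarrow>0\<rightarrow> 0"
      by (rule Lim_transform_eventually[OF tendsto_flat_exp_0[of "pCons 0 p"]])
         (auto simp: flat_exp_def eventually_at_filter field_simps)
    with 2 show ?thesis by (simp add: DERIV_def flat_exp_def)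
  next
    case 3
    have "((\<lambda>t. poly p (1 / t) * exp (- (1 / t))) has_real_derivative
        flat_exp ([:0,0,1:] * (p - pderiv p)) t) (at t)"
      using 3 by (auto intro!: derivative_eq_intros simp: flat_exp_def field_simps power2_eq_square)
    then show ?thesis
      by (rule has_field_derivative_transform_within_open[where S="{0<..}"])
         (use 3 in \<open>auto simp: flat_exp_def\<close>)
  qed
qed

lemma Ck_flat_exp: "Ck k (\<lambda>x. flat_exp p (x \<bullet> c + d))"
proof (induction k arbitrary: p)
  case 0
  have "continuous_on UNIV (flat_exp p)"
    using DERIV_flat_exp DERIV_isCont by (metis continuous_at_imp_continuous_on)
  then show ?case by (auto intro!: continuous_intros intro: continuous_on_compose2)
next
  case (Suc k)
  define q where "q = [:0,0,1:] * (p - pderiv p)"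
  have "((\<lambda>x. x \<bullet> c + d) has_derivative (\<lambda>h. h \<bullet> c)) (at x)" for x
    by (auto intro!: derivative_eq_intros)
  moreover have "(flat_exp p has_derivative (*) (flat_exp q t)) (at t)" for t
    using DERIV_flat_exp[of p t] by (simp add: q_def has_field_derivative_def)
  ultimately have d: "((\<lambda>x. flat_exp p (x \<bullet> c + d)) has_derivative
      (\<lambda>h. flat_exp q (x \<bullet> c + d) * (h \<bullet> c))) (at x)" for x
    using diff_chain_at[of "\<lambda>x. x \<bullet> c + d" "\<lambda>h. h \<bullet> c" x "flat_exp p"
        "(*) (flat_exp q (x \<bullet> c + d))"] by (simp add: o_def)
  show ?case
    by (auto simp: frechet_derivative_at[OF d, symmetric] intro: d[THEN differentiableI]
        intro!: Ck_mult Ck_const Suc)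
qed

text \<open>Each factor is exp(-1/((n+1) s)) with s the signed distance to one face of the box. The
  scaling by n+1 leaves the zero set unchanged and drives every factor to 1 inside.\<close>

definition box_bump :: "'a::euclidean_space \<Rightarrow> 'a \<Rightarrow> nat \<Rightarrow> 'a \<Rightarrow> real" where
  "box_bump a b n x = (\<Prod>i\<in>Basis. flat_exp 1 (real (Suc n) * ((x - a) \<bullet> i)) *
     flat_exp 1 (real (Suc n) * ((b - x) \<bullet> i)))"

lemma smooth_box_bump: "smooth (box_bump a b n)"
proof -
  have 1: "real (Suc n) * ((x - a) \<bullet> i) = x \<bullet> (real (Suc n) *\<^sub>R i) + - real (Suc n) * (a \<bullet> i)"
    and 2: "real (Suc n) * ((b - x) \<bullet> i) = x \<bullet> (- real (Suc n) *\<^sub>R i) + real (Suc n) * (b \<bullet> i)" for x i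
    by (simp_all add: algebra_simps)
  show ?thesis
    unfolding smooth_def box_bump_def[abs_def] 1 2
    by (intro allI Ck_prod Ck_mult Ck_flat_exp) auto
qed

lemma flat_exp_1_bounds: "0 \<le> flat_exp 1 t" "flat_exp 1 t \<le> 1" "flat_exp 1 t > 0 \<longleftrightarrow> t > 0"
  by (auto simp: flat_exp_def)

lemma box_bump_eq_0: "x \<notin> box a b \<Longrightarrow> box_bump a b n x = 0"
  by (auto simp: box_bump_def mem_box flat_exp_def inner_diff_left zero_less_mult_iff)

lemma box_bump_bounds: "0 \<le> box_bump a b n x" "box_bump a b n x \<le> indicator (box a b) x"
proof -
  show "0 \<le> box_bump a b n x"
    unfolding box_bump_def by (intro prod_nonneg ballI mult_nonneg_nonneg flat_exp_1_bounds)
  have "box_bump a b n x \<le> 1"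
    unfolding box_bump_def
    by (intro prod_le_1 conjI mult_nonneg_nonneg mult_le_one flat_exp_1_bounds)
  then show "box_bump a b n x \<le> indicator (box a b) x"
    by (auto simp: indicator_def box_bump_eq_0)
qed

lemma box_bump_tendsto: "(\<lambda>n. box_bump a b n x) \<longlonglongrightarrow> indicator (box a b) x"
proof (cases "x \<in> box a b")
  case True
  have *: "(\<lambda>n. flat_exp 1 (real (Suc n) * t)) \<longlonglongrightarrow> 1" if "t > 0" for t
  proof -
    have "(\<lambda>n. exp (- ((1 / t) * inverse (real (Suc n))))) \<longlonglongrightarrow> exp (- ((1 / t) * 0))"
      by (intro tendsto_intros LIMSEQ_inverse_real_of_nat)
    then show ?thesis using that by (simp add: flat_exp_def inverse_eq_divide mult.commute)
  qed
  have "(\<lambda>n. box_bump a b n x) \<longlonglongrightarrow> (\<Prod>i\<in>(Basis::'a set). 1 * 1)"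
    unfolding box_bump_def
    by (intro tendsto_prod tendsto_mult *) (use True in \<open>auto simp: mem_box inner_diff_left\<close>)
  with True show ?thesis by simp
qed (simp add: box_bump_eq_0)

lemma smooth_frechet_derivative:
  fixes \<phi> :: "'a::euclidean_space \<Rightarrow> real"
  assumes "smooth \<phi>"
  shows "(\<phi> has_derivative frechet_derivative \<phi> (at x)) (at x)"
    and "frechet_derivative \<phi> (at x) v = (\<Sum>b\<in>Basis. (v \<bullet> b) * frechet_derivative \<phi> (at x) b)"
    and "continuous_on UNIV (\<lambda>x. frechet_derivative \<phi> (at x) v)"
proof -
  have C1: "Ck 1 \<phi>" using assms unfolding smooth_def by blast
  then show d: "(\<phi> has_derivative frechet_derivative \<phi> (at x)) (at x)" for x
    using frechet_derivative_works by auto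
  have lin: "linear (frechet_derivative \<phi> (at x))" for x
    using d has_derivative_linear by blast
  show *: "frechet_derivative \<phi> (at x) v = (\<Sum>b\<in>Basis. (v \<bullet> b) * frechet_derivative \<phi> (at x) b)" for x
  proof -
    have "frechet_derivative \<phi> (at x) v = frechet_derivative \<phi> (at x) (\<Sum>b\<in>Basis. (v \<bullet> b) *\<^sub>R b)"
      by (simp add: euclidean_representation)
    also have "\<dots> = (\<Sum>b\<in>Basis. (v \<bullet> b) * frechet_derivative \<phi> (at x) b)"
      using lin by (simp add: linear_sum linear_scale)
    finally show ?thesis .
  qed
  show "continuous_on UNIV (\<lambda>x. frechet_derivative \<phi> (at x) v)"
    unfolding * using C1 by (auto intro!: continuous_intros)
qed

lemma smooth_imp_continuous: "smooth \<phi> \<Longrightarrow> continuous_on UNIV \<phi>"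
  unfolding smooth_def by (metis Ck.simps(1))

section \<open>Weak gradients and translations\<close>

text \<open>Functions are taken Borel measurable and integrable on the whole space, so that Fubini and
  translation invariance are available for \<^const>\<open>lborel\<close>; in the application both vanish outside
  \<open>\<Omega>\<close> almost everywhere.\<close>

definition borel_weak_gradient ::
    "'a::euclidean_space set \<Rightarrow> ('a \<Rightarrow> real) \<Rightarrow> ('a \<Rightarrow> 'a) \<Rightarrow> bool" where
  "borel_weak_gradient \<Omega> u G \<longleftrightarrow> integrable lborel u \<and> integrable lborel G \<and>
     (\<forall>\<phi> b. test_function \<Omega> \<phi> \<and> b \<in> Basis \<longrightarrow>
        (\<integral>x. u x * frechet_derivative \<phi> (at x) b \<partial>lborel) = - (\<integral>x. (G x \<bullet> b) * \<phi> x \<partial>lborel))"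

section \<open>Testing the weak gradient against translates of a test function\<close>

lemma continuous_compact_support_bounded:
  fixes f :: "'a::euclidean_space \<Rightarrow> real"
  assumes "continuous_on UNIV f" "compact K" "\<And>x. x \<notin> K \<Longrightarrow> f x = 0"
  obtains C where "C \<ge> 0" "\<And>x. \<bar>f x\<bar> \<le> C"
proof -
  have "compact (f ` K)"
    using assms by (meson compact_continuous_image continuous_on_subset subset_UNIV)
  then obtain C where C: "\<forall>y\<in>f ` K. norm y \<le> C"
    using compact_imp_bounded bounded_iff by blast
  show ?thesis
  proof (rule that[of "max C 0"])
    fix x show "\<bar>f x\<bar> \<le> max C 0"
      using C assms(3)[of x] by (cases "x \<in> K") force+
  qed simp
qed

lemma frechet_derivative_outside_support:
  fixes \<phi> :: "'a::euclidean_space \<Rightarrow> real"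
  assumes "x \<notin> closure {x. \<phi> x \<noteq> 0}"
  shows "frechet_derivative \<phi> (at x) v = 0"
proof -
  have "((\<lambda>x. 0) has_derivative (\<lambda>h. 0)) (at x)" by simp
  then have "(\<phi> has_derivative (\<lambda>h. 0)) (at x)"
  proof (rule has_derivative_transform_within_open)
    show "open (- closure {x. \<phi> x \<noteq> 0})" by auto
    show "\<And>y. y \<in> - closure {x. \<phi> x \<noteq> 0} \<Longrightarrow> 0 = \<phi> y"
      using closure_subset[of "{x. \<phi> x \<noteq> 0}"] by auto
  qed (use assms in auto)
  then show ?thesis by (simp add: frechet_derivative_at[symmetric])
qed

lemma test_function_bounds:
  assumes "test_function \<Omega> \<phi>"
  obtains C where "C \<ge> 0" "\<And>x. \<bar>\<phi> x\<bar> \<le> C" "\<And>x. \<bar>frechet_derivative \<phi> (at x) v\<bar> \<le> C"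
proof -
  have s: "smooth \<phi>" and c: "compact (closure {x. \<phi> x \<noteq> 0})"
    using assms by (auto simp: test_function_def)
  obtain A where A: "A \<ge> 0" "\<And>x. \<bar>\<phi> x\<bar> \<le> A"
    using closure_subset[of "{x. \<phi> x \<noteq> 0}"]
    by (rule_tac continuous_compact_support_bounded[OF smooth_imp_continuous[OF s] c]) auto
  obtain B where B: "B \<ge> 0" "\<And>x. \<bar>frechet_derivative \<phi> (at x) v\<bar> \<le> B"
    using frechet_derivative_outside_support
    by (rule_tac continuous_compact_support_bounded[OF smooth_frechet_derivative(3)[OF s, of v] c]) auto
  show ?thesis
    using A B by (intro that[of "max A B"]) (auto intro: le_max_iff_disj[THEN iffD2])
qed

lemma integrable_mult_bounded:
  fixes u w :: "'a \<Rightarrow> real"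
  assumes "integrable M u" "w \<in> borel_measurable M" "\<And>x. \<bar>w x\<bar> \<le> C"
  shows "integrable M (\<lambda>x. u x * w x)"
proof (rule Bochner_Integration.integrable_bound)
  show "integrable M (\<lambda>x. C * u x)" using assms by simp
  have "norm (u x * w x) \<le> norm (C * u x)" for x
    using mult_left_mono[OF assms(3)[of x], of "\<bar>u x\<bar>"] assms(3)[of x] abs_ge_zero[of "w x"]
    by (simp add: abs_mult mult.commute[of C])
  then show "AE x in M. norm (u x * w x) \<le> norm (C * u x)" by blast
qed (use assms in measurable)

text \<open>The definition tests coordinate directions only. Both sides are linear in the direction,
  which gives arbitrary v as required for shifts along v.\<close>

lemma borel_weak_gradient_directional:
  assumes W: "borel_weak_gradient \<Omega> u G" and T: "test_function \<Omega> \<phi>"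
  shows "(\<integral>x. u x * frechet_derivative \<phi> (at x) v \<partial>lborel) = - (\<integral>x. (G x \<bullet> v) * \<phi> x \<partial>lborel)"
proof -
  have s: "smooth \<phi>" using T by (auto simp: test_function_def)
  have [measurable]: "(\<lambda>x. frechet_derivative \<phi> (at x) b) \<in> borel_measurable borel" "\<phi> \<in> borel_measurable borel" for b
    using s smooth_frechet_derivative(3) smooth_imp_continuous
    by (auto intro: borel_measurable_continuous_onI)
  have iu: "integrable lborel u" and iG: "integrable lborel G"
    using W by (auto simp: borel_weak_gradient_def)
  have i1: "integrable lborel (\<lambda>x. u x * frechet_derivative \<phi> (at x) b)" for b
  proof -
    obtain C where "\<And>x. \<bar>frechet_derivative \<phi> (at x) b\<bar> \<le> C"
      using test_function_bounds[OF T] by metis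
    then show ?thesis using iu by (intro integrable_mult_bounded[where C=C]) auto
  qed
  have i2: "integrable lborel (\<lambda>x. (G x \<bullet> b) * \<phi> x)" for b
  proof -
    obtain C where "\<And>x. \<bar>\<phi> x\<bar> \<le> C"
      using test_function_bounds[OF T] by metis
    then show ?thesis using iG by (intro integrable_mult_bounded[where C=C]) auto
  qed
  have "(\<integral>x. u x * frechet_derivative \<phi> (at x) v \<partial>lborel) =
      (\<integral>x. (\<Sum>b\<in>Basis. (v \<bullet> b) * (u x * frechet_derivative \<phi> (at x) b)) \<partial>lborel)"
    by (subst smooth_frechet_derivative(2)[OF s]) (simp add: sum_distrib_left ac_simps)
  also have "\<dots> = (\<Sum>b\<in>Basis. (v \<bullet> b) * (\<integral>x. u x * frechet_derivative \<phi> (at x) b \<partial>lborel))"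
    using i1 by (subst Bochner_Integration.integral_sum) auto
  also have "\<dots> = (\<Sum>b\<in>Basis. (v \<bullet> b) * - (\<integral>x. (G x \<bullet> b) * \<phi> x \<partial>lborel))"
    using W T by (intro sum.cong) (auto simp: borel_weak_gradient_def)
  also have "\<dots> = - (\<integral>x. (\<Sum>b\<in>Basis. (v \<bullet> b) * ((G x \<bullet> b) * \<phi> x)) \<partial>lborel)"
    using i2 by (subst Bochner_Integration.integral_sum) (auto simp: sum_negf)
  also have "(\<lambda>x. \<Sum>b\<in>Basis. (v \<bullet> b) * ((G x \<bullet> b) * \<phi> x)) = (\<lambda>x. (G x \<bullet> v) * \<phi> x)"
  proof
    fix x
    have "(G x \<bullet> v) * \<phi> x = (\<Sum>b\<in>Basis. (G x \<bullet> b) * (v \<bullet> b)) * \<phi> x"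
      by (simp add: euclidean_inner[of "G x" v])
    then show "(\<Sum>b\<in>Basis. (v \<bullet> b) * ((G x \<bullet> b) * \<phi> x)) = (G x \<bullet> v) * \<phi> x"
      by (simp add: sum_distrib_right sum_distrib_left ac_simps)
  qed
  finally show ?thesis .
qed

text \<open>The shift is moved from u to the test function: \<phi>(y - v) - \<phi>(y) is the
  integral over t in [0,1] of minus the v-derivative of \<phi> at y - tv. After exchanging the
  integrals, the weak gradient identity applies for each fixed t, since every translate on the way
  is a test function in \<Omega>.\<close>

lemma weak_shift_identity:
  fixes u :: "'a::euclidean_space \<Rightarrow> real"
  assumes W: "borel_weak_gradient \<Omega> u G"
    and T: "\<And>t. t \<in> {0..1} \<Longrightarrow> test_function \<Omega> (\<lambda>y. \<phi> (y - t *\<^sub>R v))"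
  shows "(\<integral>y. u y * (\<phi> (y - v) - \<phi> y) \<partial>lborel) =
    (\<integral>t. indicator {0..1} t * (\<integral>y. (G y \<bullet> v) * \<phi> (y - t *\<^sub>R v) \<partial>lborel) \<partial>lborel)"
proof -
  have T0: "test_function \<Omega> \<phi>" using T[of 0] by simp
  then have s: "smooth \<phi>" by (simp add: test_function_def)
  define D where "D x = frechet_derivative \<phi> (at x) v" for x
  have cD: "continuous_on UNIV D"
    unfolding D_def by (rule smooth_frechet_derivative(3)[OF s])
  have [measurable]: "D \<in> borel_measurable borel" "u \<in> borel_measurable borel"
    using W cD by (auto intro: borel_measurable_continuous_onI simp: borel_weak_gradient_def)
  have iu: "integrable lborel u"
    using W by (auto simp: borel_weak_gradient_def)
  obtain C where C: "C \<ge> 0" "\<And>x. \<bar>D x\<bar> \<le> C"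
    unfolding D_def using test_function_bounds[OF T0, of v] by metis
  have d1: "(\<phi> has_derivative frechet_derivative \<phi> (at x)) (at x)" for x
    by (rule smooth_frechet_derivative(1)[OF s])
  have FTC: "(\<integral>t. indicator {0..1} t * - D (y - t *\<^sub>R v) \<partial>lborel) = \<phi> (y - v) - \<phi> y" for y
  proof -
    have "((\<lambda>t. \<phi> (y - t *\<^sub>R v)) has_real_derivative - D (y - t *\<^sub>R v)) (at t)" for t
    proof -
      have "((\<lambda>t. y - t *\<^sub>R v) has_derivative (\<lambda>h. - (h *\<^sub>R v))) (at t)"
        by (auto intro!: derivative_eq_intros)
      from diff_chain_at[OF this d1] have
        "((\<lambda>t. \<phi> (y - t *\<^sub>R v)) has_derivative (\<lambda>h. frechet_derivative \<phi> (at (y - t *\<^sub>R v)) (- (h *\<^sub>R v)))) (at t)"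
        by (simp add: o_def)
      moreover have "frechet_derivative \<phi> (at (y - t *\<^sub>R v)) (- (h *\<^sub>R v)) = - D (y - t *\<^sub>R v) * h" for h
        using d1[of "y - t *\<^sub>R v", THEN has_derivative_linear]
        by (simp add: D_def linear_neg linear_scale)
      ultimately show ?thesis
        unfolding has_field_derivative_def by (simp only:)
    qed
    moreover have "continuous_on UNIV (\<lambda>t. - D (y - t *\<^sub>R v))"
      by (intro continuous_intros continuous_on_compose2[OF cD]) auto
    then have "isCont (\<lambda>t. - D (y - t *\<^sub>R v)) t" for t
      by (simp add: continuous_on_eq_continuous_at)
    ultimately have "(\<integral>t. - D (y - t *\<^sub>R v) * indicator {0..1} t \<partial>lborel) =
        \<phi> (y - 1 *\<^sub>R v) - \<phi> (y - 0 *\<^sub>R v)"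
      by (intro integral_FTC_Icc_real) auto
    then show ?thesis by (simp add: mult.commute)
  qed
  have shift: "(\<integral>y. u y * - D (y - t *\<^sub>R v) \<partial>lborel) = (\<integral>y. (G y \<bullet> v) * \<phi> (y - t *\<^sub>R v) \<partial>lborel)"
    if "t \<in> {0..1}" for t
  proof -
    have "frechet_derivative (\<lambda>y. \<phi> (y - t *\<^sub>R v)) (at y) = frechet_derivative \<phi> (at (y - t *\<^sub>R v))" for y
      by (rule frechet_derivative_at[symmetric], rule has_derivative_translate)
         (use d1 in \<open>auto simp: differentiable_def\<close>)
    then show ?thesis
      using borel_weak_gradient_directional[OF W T[OF that], of v] by (simp add: D_def)
  qed
  \<comment> \<open>Fubini is justified by the product majorant C |u(y)| on the slab t in [0,1],
    with C a bound for the directional derivative.\<close>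
  have int: "integrable (lborel \<Otimes>\<^sub>M lborel) (\<lambda>(y, t). u y * (indicator {0..1} t * - D (y - t *\<^sub>R v)))"
  proof (rule Bochner_Integration.integrable_bound)
    show "integrable (lborel \<Otimes>\<^sub>M lborel) (\<lambda>(y, t). u y * (C * indicator {0..1::real} t))"
      by (rule lborel_pair.Fubini_integrable) (use iu C in \<open>auto simp: abs_mult\<close>)
    have "\<bar>u y * (indicator {0..1} t * - D (y - t *\<^sub>R v))\<bar> \<le> \<bar>u y * (C * indicator {0..1} t)\<bar>" for y t
      using C by (cases "t \<in> {0..1}") (auto simp: abs_mult intro!: mult_left_mono)
    then show "AE z in lborel \<Otimes>\<^sub>M lborel. norm (case z of (y, t) \<Rightarrow> u y * (indicator {0..1} t * - D (y - t *\<^sub>R v)))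
        \<le> norm (case z of (y, t) \<Rightarrow> u y * (C * indicator {0..1} t))"
      by (simp add: split_beta)
  qed measurable
  have "(\<integral>y. u y * (\<phi> (y - v) - \<phi> y) \<partial>lborel) =
      (\<integral>y. (\<integral>t. u y * (indicator {0..1} t * - D (y - t *\<^sub>R v)) \<partial>lborel) \<partial>lborel)"
    by (simp add: FTC[symmetric])
  also have "\<dots> = (\<integral>t. (\<integral>y. u y * (indicator {0..1} t * - D (y - t *\<^sub>R v)) \<partial>lborel) \<partial>lborel)"
    by (rule lborel_pair.Fubini_integral[symmetric, OF int])
  also have "\<dots> = (\<integral>t. indicator {0..1} t * (\<integral>y. (G y \<bullet> v) * \<phi> (y - t *\<^sub>R v) \<partial>lborel) \<partial>lborel)"
    using shift by (intro Bochner_Integration.integral_cong) (auto split: split_indicator)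
  finally show ?thesis .
qed

lemma abs_integral_le_nn_integral:
  fixes f :: "'a \<Rightarrow> real"
  shows "ennreal \<bar>\<integral>x. f x \<partial>M\<bar> \<le> (\<integral>\<^sup>+x. ennreal \<bar>f x\<bar> \<partial>M)"
proof (cases "integrable M f")
  case True
  from integral_norm_bound_ennreal[OF this] show ?thesis by simp
qed (simp add: not_integrable_integral_eq)

text \<open>The identity for \<open>box_bump\<close> passes to the indicator of the box. The
  right-hand side dominates uniformly in n, because each bump lies below the indicator, so only the
  left-hand side needs a limit. Closed boxes are required to lie in \<Omega> because the closed
  supports of the bumps must.\<close>

lemma weak_shift_box:
  fixes u :: "'a::euclidean_space \<Rightarrow> real"
  assumes W: "borel_weak_gradient \<Omega> u G"
    and sub: "\<And>t. t \<in> {0..1} \<Longrightarrow> cbox (x + t *\<^sub>R v) (x + t *\<^sub>R v + c) \<subseteq> \<Omega>"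
  shows "ennreal \<bar>(\<integral>y. u y * indicator (box 0 c) (y - (x + v)) \<partial>lborel) -
      (\<integral>y. u y * indicator (box 0 c) (y - x) \<partial>lborel)\<bar> \<le>
    (\<integral>\<^sup>+t. (\<integral>\<^sup>+y. indicator {0..1} t * ennreal (norm (G y) * norm v) *
       indicator (box 0 c) (y - (x + t *\<^sub>R v)) \<partial>lborel) \<partial>lborel)" (is "ennreal \<bar>?L\<bar> \<le> ?R")
proof -
  define \<phi> where "\<phi> n y = box_bump 0 c n (y - x)" for n y
  have T: "test_function \<Omega> (\<lambda>y. \<phi> n (y - t *\<^sub>R v))" if t: "t \<in> {0..1}" for t n
  proof -
    have eq: "(\<lambda>y. \<phi> n (y - t *\<^sub>R v)) = (\<lambda>y. box_bump 0 c n (y - (x + t *\<^sub>R v)))"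
      by (simp add: \<phi>_def algebra_simps)
    have "smooth (\<lambda>y. box_bump 0 c n (y - (x + t *\<^sub>R v)))"
      using smooth_box_bump unfolding smooth_def by (blast intro: Ck_translate)
    moreover have "{y. box_bump 0 c n (y - (x + t *\<^sub>R v)) \<noteq> 0} \<subseteq> cbox (x + t *\<^sub>R v) (x + t *\<^sub>R v + c)"
    proof
      fix y assume "y \<in> {y. box_bump 0 c n (y - (x + t *\<^sub>R v)) \<noteq> 0}"
      then have "y - (x + t *\<^sub>R v) \<in> box 0 c" using box_bump_eq_0 by blast
      then show "y \<in> cbox (x + t *\<^sub>R v) (x + t *\<^sub>R v + c)"
        by (force simp: mem_box inner_diff_left inner_add_left)
    qed
    then have "closure {y. box_bump 0 c n (y - (x + t *\<^sub>R v)) \<noteq> 0} \<subseteq> cbox (x + t *\<^sub>R v) (x + t *\<^sub>R v + c)"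
      by (rule closure_minimal) (rule closed_cbox)
    moreover have "compact (closure {y. box_bump 0 c n (y - (x + t *\<^sub>R v)) \<noteq> 0})"
      using calculation(2) by (meson bounded_cbox bounded_subset closed_closure compact_eq_bounded_closed)
    ultimately show ?thesis
      unfolding test_function_def eq using sub[OF t] by (intro conjI) (assumption | erule order_trans)+
  qed
  have [measurable]: "u \<in> borel_measurable borel" "G \<in> borel_measurable borel"
    and iu: "integrable lborel u"
    using W by (auto simp: borel_weak_gradient_def)
  have [measurable]: "box_bump 0 c n \<in> borel_measurable borel" for n
    by (rule borel_measurable_continuous_onI[OF smooth_imp_continuous[OF smooth_box_bump]])
  have bd: "\<bar>\<phi> n (y - w)\<bar> \<le> indicator (box 0 c) (y - (x + w))" for n y w
    using box_bump_bounds[of 0 c n "y - (x + w)"] by (simp add: \<phi>_def algebra_simps)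
  have le: "ennreal \<bar>\<integral>y. u y * (\<phi> n (y - v) - \<phi> n y) \<partial>lborel\<bar> \<le> ?R" for n
  proof -
    have "ennreal \<bar>\<integral>y. u y * (\<phi> n (y - v) - \<phi> n y) \<partial>lborel\<bar> \<le>
        (\<integral>\<^sup>+t. ennreal \<bar>indicator {0..1} t * (\<integral>y. (G y \<bullet> v) * \<phi> n (y - t *\<^sub>R v) \<partial>lborel)\<bar> \<partial>lborel)"
      by (subst weak_shift_identity[OF W, of "\<phi> n" v]) (use T in \<open>auto intro: abs_integral_le_nn_integral\<close>)
    also have "\<dots> \<le> ?R"
    proof (intro nn_integral_mono)
      fix t :: real
      have "ennreal \<bar>indicator {0..1} t * (\<integral>y. (G y \<bullet> v) * \<phi> n (y - t *\<^sub>R v) \<partial>lborel)\<bar> =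
          ennreal \<bar>\<integral>y. indicator {0..1} t * ((G y \<bullet> v) * \<phi> n (y - t *\<^sub>R v)) \<partial>lborel\<bar>"
        by simp
      also have "\<dots> \<le> (\<integral>\<^sup>+y. ennreal \<bar>indicator {0..1} t * ((G y \<bullet> v) * \<phi> n (y - t *\<^sub>R v))\<bar> \<partial>lborel)"
        by (rule abs_integral_le_nn_integral)
      also have "\<dots> \<le> (\<integral>\<^sup>+y. indicator {0..1} t * ennreal (norm (G y) * norm v) *
          indicator (box 0 c) (y - (x + t *\<^sub>R v)) \<partial>lborel)"
      proof (intro nn_integral_mono)
        fix y
        have "\<bar>(G y \<bullet> v) * \<phi> n (y - t *\<^sub>R v)\<bar> \<le> (norm (G y) * norm v) * indicator (box 0 c) (y - (x + t *\<^sub>R v))"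
          unfolding abs_mult by (intro mult_mono bd Cauchy_Schwarz_ineq2) auto
        then show "ennreal \<bar>indicator {0..1} t * ((G y \<bullet> v) * \<phi> n (y - t *\<^sub>R v))\<bar> \<le>
            indicator {0..1} t * ennreal (norm (G y) * norm v) * indicator (box 0 c) (y - (x + t *\<^sub>R v))"
          by (cases "t \<in> {0..1}"; cases "y - (x + t *\<^sub>R v) \<in> box 0 c") (auto simp: ennreal_leI)
      qed
      finally show "ennreal \<bar>indicator {0..1} t * (\<integral>y. (G y \<bullet> v) * \<phi> n (y - t *\<^sub>R v) \<partial>lborel)\<bar> \<le>
          (\<integral>\<^sup>+y. indicator {0..1} t * ennreal (norm (G y) * norm v) *
          indicator (box 0 c) (y - (x + t *\<^sub>R v)) \<partial>lborel)" .
    qed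
    finally show ?thesis .
  qed
  have lim: "(\<lambda>n. \<integral>y. u y * (\<phi> n (y - v) - \<phi> n y) \<partial>lborel) \<longlonglongrightarrow>
      (\<integral>y. u y * (indicator (box 0 c) (y - (x + v)) - indicator (box 0 c) (y - x)) \<partial>lborel)"
  \<comment> \<open>The factor 2 bounds the difference of two bumps, each with values in
    [0,1].\<close>
  proof (rule integral_dominated_convergence[where w="\<lambda>y. 2 * \<bar>u y\<bar>"])
    show "AE y in lborel. (\<lambda>n. u y * (\<phi> n (y - v) - \<phi> n y)) \<longlonglongrightarrow>
        u y * (indicator (box 0 c) (y - (x + v)) - indicator (box 0 c) (y - x))"
    proof (intro AE_I2 tendsto_intros)
      fix y
      show "(\<lambda>n. \<phi> n y) \<longlonglongrightarrow> indicator (box 0 c) (y - x)"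
        unfolding \<phi>_def by (rule box_bump_tendsto)
      have "(\<lambda>n. box_bump 0 c n (y - (x + v))) \<longlonglongrightarrow> indicator (box 0 c) (y - (x + v))"
        by (rule box_bump_tendsto)
      then show "(\<lambda>n. \<phi> n (y - v)) \<longlonglongrightarrow> indicator (box 0 c) (y - (x + v))"
        by (simp add: \<phi>_def algebra_simps)
    qed
    have "\<bar>\<phi> n (y - w)\<bar> \<le> 1" for n y w
      using bd[of n y w] by (rule order_trans) (simp add: indicator_def)
    then have "\<bar>\<phi> n (y - v)\<bar> \<le> 1" "\<bar>\<phi> n (y - 0)\<bar> \<le> 1" for n y by blast+
    then have "\<bar>\<phi> n (y - v)\<bar> \<le> 1" "\<bar>\<phi> n y\<bar> \<le> 1" for n y by simp_all
    then have "\<bar>\<phi> n (y - v) - \<phi> n y\<bar> \<le> 1 + 1" for n y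
      by (intro order_trans[OF abs_triangle_ineq4] add_mono)
    then have "\<bar>\<phi> n (y - v) - \<phi> n y\<bar> \<le> 2" for n y by simp
    then have "\<bar>u y\<bar> * \<bar>\<phi> n (y - v) - \<phi> n y\<bar> \<le> \<bar>u y\<bar> * 2" for n y
      by (rule mult_left_mono) simp
    then show "AE y in lborel. norm (u y * (\<phi> n (y - v) - \<phi> n y)) \<le> 2 * \<bar>u y\<bar>" for n
      by (auto simp: abs_mult mult.commute)
  qed (use iu in \<open>auto simp: \<phi>_def\<close>)
  have "(\<integral>y. u y * (indicator (box 0 c) (y - (x + v)) - indicator (box 0 c) (y - x)) \<partial>lborel) = ?L"
    by (simp only: right_diff_distrib, intro Bochner_Integration.integral_diff
        integrable_mult_bounded[OF iu, where C=1]) (auto simp: indicator_def)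
  with lim have "(\<lambda>n. ennreal \<bar>\<integral>y. u y * (\<phi> n (y - v) - \<phi> n y) \<partial>lborel\<bar>) \<longlonglongrightarrow> ennreal \<bar>?L\<bar>"
    by (intro tendsto_ennrealI tendsto_rabs) simp
  then show ?thesis
    by (rule LIMSEQ_le_const2) (use le in blast)
qed

section \<open>Steklov averages and the L^2 translation estimate\<close>

lemma nn_integral_lborel_translate:
  fixes f :: "'a::euclidean_space \<Rightarrow> ennreal"
  assumes [measurable]: "f \<in> borel_measurable borel"
  shows "(\<integral>\<^sup>+y. f (c + y) \<partial>lborel) = (\<integral>\<^sup>+y. f y \<partial>lborel)"
proof -
  have "(\<integral>\<^sup>+y. f y \<partial>lborel) = (\<integral>\<^sup>+y. f y \<partial>distr lborel borel ((+) c))"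
    by (subst lborel_distr_plus) simp
  also have "\<dots> = (\<integral>\<^sup>+y. f (c + y) \<partial>lborel)"
    by (subst nn_integral_distr) auto
  finally show ?thesis by simp
qed

lemma AE_lborel_translate:
  assumes "AE x in lborel. P x"
  shows "AE x in lborel. P (x + v :: 'a::euclidean_space)"
proof -
  have "AE x in distr lborel borel ((+) v). P x"
    using assms by (subst lborel_distr_plus)
  then have "AE x in lborel. P (v + x)"
    by (rule AE_distrD[rotated]) simp
  then show ?thesis by (simp add: add.commute)
qed

text \<open>The cube has x as its lower corner and not as its centre; this is the form of averaging
  in the differentiation theorem behind \<open>steklov_tendsto_AE\<close>.\<close>

definition steklov :: "real \<Rightarrow> ('a::euclidean_space \<Rightarrow> real) \<Rightarrow> 'a \<Rightarrow> real" where
  "steklov h u x = (\<integral>y. u y * indicator (box 0 (h *\<^sub>R One)) (y - x) \<partial>lborel) / h ^ DIM('a)"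

text \<open>Cauchy-Schwarz on the product of [0,1] with the cube, which has measure h^d in dimension
  d: dividing the square of the box estimate by h^(2d) leaves |v|^2 / h^d. The substitution y = x +
  tv + z makes the cube independent of x and t, which prepares the integration in x.\<close>

lemma steklov_shift_pointwise:
  fixes u :: "'a::euclidean_space \<Rightarrow> real"
  assumes W: "borel_weak_gradient \<Omega> u G" and h: "h > 0"
    and sub: "\<And>t. t \<in> {0..1} \<Longrightarrow> cbox (x + t *\<^sub>R v) (x + t *\<^sub>R v + h *\<^sub>R One) \<subseteq> \<Omega>"
  shows "ennreal ((steklov h u (x + v) - steklov h u x)\<^sup>2) \<le> ennreal ((norm v)\<^sup>2 / h ^ DIM('a)) *
    (\<integral>\<^sup>+t. (\<integral>\<^sup>+z. indicator {0..1::real} t * indicator (box 0 (h *\<^sub>R One)) z *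
       ennreal ((norm (G (x + t *\<^sub>R v + z)))\<^sup>2) \<partial>lborel) \<partial>lborel)"
proof -
  have [measurable]: "G \<in> borel_measurable borel"
    using W by (auto simp: borel_weak_gradient_def)
  define B where "B = box 0 (h *\<^sub>R One :: 'a)"
  have [measurable]: "B \<in> sets borel" by (simp add: B_def)
  define H where "H = h ^ DIM('a)"
  have H: "H > 0" using h by (simp add: H_def)
  define L where "L = (\<integral>y. u y * indicator B (y - (x + v)) \<partial>lborel) -
      (\<integral>y. u y * indicator B (y - x) \<partial>lborel)"
  define N :: "real \<Rightarrow> 'a \<Rightarrow> ennreal" where "N t z = ennreal (norm (G (x + t *\<^sub>R v + z)))" for t z
  have [measurable]: "(\<lambda>p. N (fst p) (snd p)) \<in> borel_measurable (lborel \<Otimes>\<^sub>M lborel)"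
    unfolding N_def by measurable
  \<comment> \<open>\<open>Q\<close> is the indicator of [0,1] times the cube. Being idempotent, it
    can be split off as a second factor, so that Cauchy-Schwarz is applied to the product of
    \<open>Q N\<close> and \<open>Q\<close>.\<close>
  define Q :: "real \<Rightarrow> 'a \<Rightarrow> ennreal" where "Q t z = indicator {0..1::real} t * indicator B z" for t z
  have [measurable]: "(\<lambda>p. Q (fst p) (snd p)) \<in> borel_measurable (lborel \<Otimes>\<^sub>M lborel)"
    unfolding Q_def by measurable
  have QQ: "Q t z * Q t z = Q t z" for t z
    by (auto simp: Q_def split: split_indicator)
  then have QNQ: "Q t z * N t z * Q t z = Q t z * N t z" for t z
    by (metis mult.assoc mult.commute)
  have QN2: "(Q t z * N t z)\<^sup>2 = Q t z * (N t z)\<^sup>2" for t z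
    by (simp add: power_mult_distrib power2_eq_square[of "Q t z"] QQ)
  have "ennreal \<bar>L\<bar> \<le> (\<integral>\<^sup>+t. (\<integral>\<^sup>+y. indicator {0..1} t * ennreal (norm (G y) * norm v) *
       indicator B (y - (x + t *\<^sub>R v)) \<partial>lborel) \<partial>lborel)"
    unfolding L_def B_def by (rule weak_shift_box[OF W sub])
  also have "\<dots> = (\<integral>\<^sup>+t. (\<integral>\<^sup>+z. ennreal (norm v) * (Q t z * N t z) \<partial>lborel) \<partial>lborel)"
  proof (rule nn_integral_cong)
    fix t :: real
    have "(\<integral>\<^sup>+y. indicator {0..1} t * ennreal (norm (G y) * norm v) *
          indicator B (y - (x + t *\<^sub>R v)) \<partial>lborel) =
        (\<integral>\<^sup>+z. indicator {0..1} t * ennreal (norm (G (x + t *\<^sub>R v + z)) * norm v) *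
          indicator B (x + t *\<^sub>R v + z - (x + t *\<^sub>R v)) \<partial>lborel)"
      by (rule nn_integral_lborel_translate[symmetric]) measurable
    then show "(\<integral>\<^sup>+y. indicator {0..1} t * ennreal (norm (G y) * norm v) *
          indicator B (y - (x + t *\<^sub>R v)) \<partial>lborel) =
        (\<integral>\<^sup>+z. ennreal (norm v) * (Q t z * N t z) \<partial>lborel)"
      by (simp add: Q_def N_def ennreal_mult' ac_simps)
  qed
  also have "\<dots> = ennreal (norm v) * (\<integral>\<^sup>+t. (\<integral>\<^sup>+z. Q t z * N t z \<partial>lborel) \<partial>lborel)"
    by (simp add: nn_integral_cmult Q_def N_def)
  also have "(\<integral>\<^sup>+t. (\<integral>\<^sup>+z. Q t z * N t z \<partial>lborel) \<partial>lborel) =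
      (\<integral>\<^sup>+p. (Q (fst p) (snd p) * N (fst p) (snd p)) * Q (fst p) (snd p) \<partial>(lborel \<Otimes>\<^sub>M lborel))" (is "_ = ?A")
    by (subst lborel.nn_integral_fst[symmetric]) (simp_all add: QNQ)
  finally have L: "ennreal \<bar>L\<bar> \<le> ennreal (norm v) * ?A" .
  have "?A\<^sup>2 \<le> (\<integral>\<^sup>+p. (Q (fst p) (snd p) * N (fst p) (snd p))\<^sup>2 \<partial>(lborel \<Otimes>\<^sub>M lborel)) *
      (\<integral>\<^sup>+p. (Q (fst p) (snd p))\<^sup>2 \<partial>(lborel \<Otimes>\<^sub>M lborel))"
    by (rule Cauchy_Schwarz_nn_integral) measurable
  also have "(\<integral>\<^sup>+p. (Q (fst p) (snd p))\<^sup>2 \<partial>(lborel \<Otimes>\<^sub>M lborel)) = ennreal H"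
  proof -
    have "(\<integral>\<^sup>+p. (Q (fst p) (snd p))\<^sup>2 \<partial>(lborel \<Otimes>\<^sub>M lborel)) = (\<integral>\<^sup>+t. (\<integral>\<^sup>+z. Q t z \<partial>lborel) \<partial>lborel)"
      by (subst lborel.nn_integral_fst[symmetric]) (simp_all add: QQ power2_eq_square)
    also have "\<dots> = (\<integral>\<^sup>+t. indicator {0..1::real} t * emeasure lborel B \<partial>lborel)"
      by (simp add: Q_def nn_integral_cmult)
    also have "\<dots> = emeasure lborel B"
      by (simp add: nn_integral_multc)
    also have "\<dots> = ennreal H"
      using h by (simp add: B_def H_def emeasure_lborel_box)
    finally show ?thesis .
  qed
  also have "(\<integral>\<^sup>+p. (Q (fst p) (snd p) * N (fst p) (snd p))\<^sup>2 \<partial>(lborel \<Otimes>\<^sub>M lborel)) =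
      (\<integral>\<^sup>+t. (\<integral>\<^sup>+z. Q t z * (N t z)\<^sup>2 \<partial>lborel) \<partial>lborel)"
    by (subst lborel.nn_integral_fst[symmetric]) (simp_all add: QN2)
  also have "\<dots> = (\<integral>\<^sup>+t. (\<integral>\<^sup>+z. indicator {0..1::real} t * indicator B z *
       ennreal ((norm (G (x + t *\<^sub>R v + z)))\<^sup>2) \<partial>lborel) \<partial>lborel)" (is "_ = ?I")
    by (simp add: Q_def N_def ennreal_power)
  finally have A: "?A\<^sup>2 \<le> ?I * ennreal H" .
  have "steklov h u (x + v) - steklov h u x = L / H"
    by (simp add: steklov_def L_def H_def B_def diff_divide_distrib)
  then have "ennreal ((steklov h u (x + v) - steklov h u x)\<^sup>2) = ennreal (1 / H\<^sup>2) * (ennreal \<bar>L\<bar>)\<^sup>2"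
    by (simp add: power_divide ennreal_power flip: ennreal_mult')
  also have "\<dots> \<le> ennreal (1 / H\<^sup>2) * (ennreal (norm v) * ?A)\<^sup>2"
    by (intro mult_left_mono power_mono L) auto
  also have "\<dots> = ennreal (1 / H\<^sup>2) * ennreal ((norm v)\<^sup>2) * ?A\<^sup>2"
    by (simp add: power_mult_distrib ennreal_power mult.assoc)
  also have "\<dots> \<le> ennreal (1 / H\<^sup>2) * ennreal ((norm v)\<^sup>2) * (?I * ennreal H)"
    by (intro mult_left_mono A) auto
  also have "\<dots> = (ennreal (1 / H\<^sup>2) * ennreal ((norm v)\<^sup>2) * ennreal H) * ?I"
    by (simp add: ac_simps)
  also have "ennreal (1 / H\<^sup>2) * ennreal ((norm v)\<^sup>2) * ennreal H = ennreal ((norm v)\<^sup>2 / H)"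
    using H by (simp add: power2_eq_square flip: ennreal_mult')
  finally show ?thesis by (simp add: H_def B_def)
qed

lemma steklov_measurable:
  assumes "u \<in> borel_measurable borel"
  shows "steklov h u \<in> borel_measurable borel"
proof -
  note assms[measurable]
  show ?thesis unfolding steklov_def[abs_def] by measurable
qed

text \<open>Tonelli brings the x-integral inside. For fixed t and z it is the integral of a
  translate of |G|^2, hence independent of t and z, and the volume of the cube cancels the factor
  1/h^d. The bound is thus uniform in h and in K.\<close>

lemma steklov_shift_L2:
  fixes u :: "'a::euclidean_space \<Rightarrow> real"
  assumes W: "borel_weak_gradient \<Omega> u G" and h: "h > 0" and [measurable]: "K \<in> sets borel"
    and sub: "\<And>x t. x \<in> K \<Longrightarrow> t \<in> {0..1} \<Longrightarrow> cbox (x + t *\<^sub>R v) (x + t *\<^sub>R v + h *\<^sub>R One) \<subseteq> \<Omega>"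
  shows "(\<integral>\<^sup>+x\<in>K. ennreal ((steklov h u (x + v) - steklov h u x)\<^sup>2) \<partial>lborel) \<le>
    ennreal ((norm v)\<^sup>2) * (\<integral>\<^sup>+x. ennreal ((norm (G x))\<^sup>2) \<partial>lborel)"
proof -
  have [measurable]: "G \<in> borel_measurable borel" "u \<in> borel_measurable borel"
    using W by (auto simp: borel_weak_gradient_def)
  define B where "B = box 0 (h *\<^sub>R One :: 'a)"
  have [measurable]: "B \<in> sets borel" by (simp add: B_def)
  define H where "H = h ^ DIM('a)"
  have H: "H > 0" using h by (simp add: H_def)
  define F :: "'a \<Rightarrow> real \<Rightarrow> 'a \<Rightarrow> ennreal" where
    "F x t z = indicator {0..1::real} t * indicator B z * ennreal ((norm (G (x + t *\<^sub>R v + z)))\<^sup>2)" for x t z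
  have "(\<integral>\<^sup>+x\<in>K. ennreal ((steklov h u (x + v) - steklov h u x)\<^sup>2) \<partial>lborel) \<le>
      (\<integral>\<^sup>+x. ennreal ((norm v)\<^sup>2 / H) * (\<integral>\<^sup>+t. (\<integral>\<^sup>+z. F x t z \<partial>lborel) \<partial>lborel) \<partial>lborel)"
  proof (intro nn_integral_mono)
    fix x
    show "ennreal ((steklov h u (x + v) - steklov h u x)\<^sup>2) * indicator K x \<le>
        ennreal ((norm v)\<^sup>2 / H) * (\<integral>\<^sup>+t. (\<integral>\<^sup>+z. F x t z \<partial>lborel) \<partial>lborel)"
      using steklov_shift_pointwise[OF W h sub, of x]
      by (cases "x \<in> K") (simp_all add: F_def H_def B_def)
  qed
  also have "\<dots> = ennreal ((norm v)\<^sup>2 / H) * (\<integral>\<^sup>+x. (\<integral>\<^sup>+t. (\<integral>\<^sup>+z. F x t z \<partial>lborel) \<partial>lborel) \<partial>lborel)"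
    unfolding F_def by (intro nn_integral_cmult) measurable
  also have "(\<integral>\<^sup>+x. (\<integral>\<^sup>+t. (\<integral>\<^sup>+z. F x t z \<partial>lborel) \<partial>lborel) \<partial>lborel) =
      (\<integral>\<^sup>+t. (\<integral>\<^sup>+x. (\<integral>\<^sup>+z. F x t z \<partial>lborel) \<partial>lborel) \<partial>lborel)"
    unfolding F_def by (rule lborel_pair.Fubini') measurable
  also have "\<dots> = (\<integral>\<^sup>+t. (\<integral>\<^sup>+z. (\<integral>\<^sup>+x. F x t z \<partial>lborel) \<partial>lborel) \<partial>lborel)"
    unfolding F_def by (intro nn_integral_cong lborel_pair.Fubini') measurable
  also have "\<dots> = (\<integral>\<^sup>+t. (\<integral>\<^sup>+z. indicator {0..1::real} t * (indicator B z *
      (\<integral>\<^sup>+x. ennreal ((norm (G x))\<^sup>2) \<partial>lborel)) \<partial>lborel) \<partial>lborel)"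
  proof (intro nn_integral_cong)
    fix t :: real and z :: 'a
    have "(\<integral>\<^sup>+x. F x t z \<partial>lborel) =
        indicator {0..1} t * indicator B z * (\<integral>\<^sup>+x. ennreal ((norm (G ((t *\<^sub>R v + z) + x)))\<^sup>2) \<partial>lborel)"
      unfolding F_def by (subst nn_integral_cmult) (auto simp: ac_simps)
    also have "(\<integral>\<^sup>+x. ennreal ((norm (G ((t *\<^sub>R v + z) + x)))\<^sup>2) \<partial>lborel) =
        (\<integral>\<^sup>+x. ennreal ((norm (G x))\<^sup>2) \<partial>lborel)"
      by (rule nn_integral_lborel_translate) measurable
    finally show "(\<integral>\<^sup>+x. F x t z \<partial>lborel) = indicator {0..1} t * (indicator B z *
      (\<integral>\<^sup>+x. ennreal ((norm (G x))\<^sup>2) \<partial>lborel))" by (simp add: mult.assoc)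
  qed
  also have "\<dots> = emeasure lborel B * (\<integral>\<^sup>+x. ennreal ((norm (G x))\<^sup>2) \<partial>lborel)"
    by (simp add: nn_integral_cmult nn_integral_multc)
  also have "emeasure lborel B = ennreal H"
    using h by (simp add: B_def H_def emeasure_lborel_box)
  also have "ennreal ((norm v)\<^sup>2 / H) * (ennreal H * (\<integral>\<^sup>+x. ennreal ((norm (G x))\<^sup>2) \<partial>lborel)) =
      ennreal ((norm v)\<^sup>2) * (\<integral>\<^sup>+x. ennreal ((norm (G x))\<^sup>2) \<partial>lborel)"
    using H by (simp add: mult.assoc[symmetric] flip: ennreal_mult')
  finally show ?thesis .
qed

lemma steklov_tendsto_AE:
  fixes u :: "'a::euclidean_space \<Rightarrow> real"
  assumes iu: "integrable lborel u"
  shows "AE x in lborel. (\<lambda>n. steklov (1 / real (Suc n)) u x) \<longlonglongrightarrow> u x"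
proof -
  have "u integrable_on cbox a b" for a b
    using integrable_on_lborel[OF iu] integrable_on_subcbox by blast
  then obtain N where N: "negligible N" and lim: "\<And>x e. \<lbrakk>x \<notin> N; 0 < e\<rbrakk> \<Longrightarrow>
      \<exists>d>0. \<forall>h. 0 < h \<and> h < d \<longrightarrow> norm (integral (cbox x (x + h *\<^sub>R One)) u /\<^sub>R h ^ DIM('a) - u x) < e"
    using integrable_ccontinuous_explicit by blast
  have eq: "steklov h u x = integral (cbox x (x + h *\<^sub>R One)) u /\<^sub>R h ^ DIM('a)" for h x
  proof -
    have "(\<integral>y. u y * indicator (box 0 (h *\<^sub>R One)) (y - x) \<partial>lborel) =
        (LINT y:box x (x + h *\<^sub>R One)|lborel. u y)"
      unfolding set_lebesgue_integral_def
      by (intro Bochner_Integration.integral_cong)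
         (auto simp: indicator_def mem_box algebra_simps)
    also have "\<dots> = integral (box x (x + h *\<^sub>R One)) u"
      by (intro set_borel_integral_eq_integral, unfold set_integrable_def,
          intro integrable_mult_indicator iu) auto
    also have "\<dots> = integral (cbox x (x + h *\<^sub>R One)) u"
      by (simp add: integral_open_interval)
    finally show ?thesis by (simp add: steklov_def divide_inverse_commute)
  qed
  have "(\<lambda>n. steklov (1 / real (Suc n)) u x) \<longlonglongrightarrow> u x" if xN: "x \<notin> N" for x
  proof (rule LIMSEQ_I)
    fix e :: real assume "e > 0"
    then obtain d where d: "d > 0" "\<And>h. 0 < h \<Longrightarrow> h < d \<Longrightarrow> norm (steklov h u x - u x) < e"
      unfolding eq using lim[OF xN] by blast
    obtain n0 where "1 / real (Suc n0) < d"
      using d(1) reals_Archimedean by (auto simp: inverse_eq_divide)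
    then have "1 / real (Suc n) < d" if "n \<ge> n0" for n
      using that by (smt (verit, best) Suc_le_mono frac_le of_nat_0_less_iff of_nat_mono zero_less_Suc)
    then show "\<exists>no. \<forall>n\<ge>no. norm (steklov (1 / real (Suc n)) u x - u x) < e"
      using d(2) by (intro exI[of _ n0]) auto
  qed
  moreover have "AE x in lebesgue. x \<notin> N"
    using N by (intro AE_not_in) (simp add: negligible_iff_null_sets)
  ultimately have "AE x in lebesgue. (\<lambda>n. steklov (1 / real (Suc n)) u x) \<longlonglongrightarrow> u x" by auto
  then show ?thesis by (simp add: AE_completion_iff)
qed

text \<open>The segments starting in K sweep out a compact subset of \<Omega>, so for small h the
  cubes attached to all their points stay inside \<Omega> and the Steklov estimate applies. Fatou
  then lets h tend to 0 on the left, the right-hand side being independent of h.\<close>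

lemma translation_L2_compact:
  fixes u :: "'a::euclidean_space \<Rightarrow> real"
  assumes W: "borel_weak_gradient \<Omega> u G" and \<Omega>: "open \<Omega>" and K: "compact K"
    and sub: "\<And>x t. x \<in> K \<Longrightarrow> t \<in> {0..1} \<Longrightarrow> x + t *\<^sub>R v \<in> \<Omega>"
  shows "(\<integral>\<^sup>+x\<in>K. ennreal ((u (x + v) - u x)\<^sup>2) \<partial>lborel) \<le>
    ennreal ((norm v)\<^sup>2) * (\<integral>\<^sup>+x. ennreal ((norm (G x))\<^sup>2) \<partial>lborel)" (is "_ \<le> ?R")
proof -
  have [measurable]: "u \<in> borel_measurable borel" and iu: "integrable lborel u"
    using W by (auto simp: borel_weak_gradient_def)
  have [measurable]: "K \<in> sets borel" using K by (simp add: borel_compact)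
  note [measurable] = steklov_measurable
  define K' where "K' = (\<lambda>(x, t). x + t *\<^sub>R v) ` (K \<times> {0..1})"
  have "compact K'"
    unfolding K'_def using K
    by (intro compact_continuous_image compact_Times) (auto intro!: continuous_intros simp: split_beta)
  moreover have "K' \<subseteq> \<Omega>" using sub by (auto simp: K'_def)
  ultimately obtain e where e: "e > 0" "(\<Union>x\<in>K'. cball x e) \<subseteq> \<Omega>"
    using compact_subset_open_imp_cball_epsilon_subset[OF _ \<Omega>] by metis
  define H where "H n = 1 / real (Suc n)" for n
  have "eventually (\<lambda>n. H n * norm (One::'a) < e) sequentially"
  proof -
    have "(\<lambda>n. inverse (real (Suc n)) * norm (One::'a)) \<longlonglongrightarrow> 0 * norm (One::'a)"
      by (intro tendsto_intros LIMSEQ_inverse_real_of_nat)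
    with e(1) show ?thesis by (auto simp: H_def inverse_eq_divide dest!: order_tendstoD(2))
  qed
  then have ev: "eventually (\<lambda>n. (\<integral>\<^sup>+x\<in>K. ennreal ((steklov (H n) u (x + v) - steklov (H n) u x)\<^sup>2) \<partial>lborel) \<le> ?R) sequentially"
  proof eventually_elim
    case (elim n)
    show ?case
    proof (rule steklov_shift_L2[OF W])
      fix x t assume xt: "x \<in> K" "t \<in> {0..1::real}"
      then have "x + t *\<^sub>R v \<in> K'" by (auto simp: K'_def)
      moreover have "cbox (x + t *\<^sub>R v) (x + t *\<^sub>R v + H n *\<^sub>R One) \<subseteq> cball (x + t *\<^sub>R v) e"
      proof
        fix y assume y: "y \<in> cbox (x + t *\<^sub>R v) (x + t *\<^sub>R v + H n *\<^sub>R One)"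
        have "norm (y - (x + t *\<^sub>R v)) \<le> norm (H n *\<^sub>R One :: 'a)"
        proof (rule norm_le_componentwise)
          fix b :: 'a assume "b \<in> Basis"
          with y show "\<bar>(y - (x + t *\<^sub>R v)) \<bullet> b\<bar> \<le> \<bar>(H n *\<^sub>R One) \<bullet> b\<bar>"
            by (auto simp: mem_box inner_diff_left inner_add_left)
        qed
        also have "\<dots> \<le> e" using elim by (simp add: H_def)
        finally show "y \<in> cball (x + t *\<^sub>R v) e" by (simp add: dist_norm norm_minus_commute)
      qed
      ultimately show "cbox (x + t *\<^sub>R v) (x + t *\<^sub>R v + H n *\<^sub>R One) \<subseteq> \<Omega>" using e(2) by blast
    qed (auto simp: H_def)
  qed
  have lim: "AE x in lborel. (\<lambda>n. ennreal ((steklov (H n) u (x + v) - steklov (H n) u x)\<^sup>2) * indicator K x)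
      \<longlonglongrightarrow> ennreal ((u (x + v) - u x)\<^sup>2) * indicator K x"
    using steklov_tendsto_AE[OF iu] AE_lborel_translate[OF steklov_tendsto_AE[OF iu], of v]
  proof eventually_elim
    case (elim x)
    then show ?case unfolding H_def
      by (cases "x \<in> K") (auto intro!: tendsto_ennrealI tendsto_intros)
  qed
  have "(\<integral>\<^sup>+x\<in>K. ennreal ((u (x + v) - u x)\<^sup>2) \<partial>lborel) =
      (\<integral>\<^sup>+x. liminf (\<lambda>n. ennreal ((steklov (H n) u (x + v) - steklov (H n) u x)\<^sup>2) * indicator K x) \<partial>lborel)"
    using lim by (intro nn_integral_cong_AE) (auto elim!: eventually_mono dest: lim_imp_Liminf[rotated])
  also have "\<dots> \<le> liminf (\<lambda>n. \<integral>\<^sup>+x\<in>K. ennreal ((steklov (H n) u (x + v) - steklov (H n) u x)\<^sup>2) \<partial>lborel)"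
    by (rule nn_integral_liminf) measurable
  also have "\<dots> \<le> ?R"
  proof -
    have "liminf (\<lambda>n. \<integral>\<^sup>+x\<in>K. ennreal ((steklov (H n) u (x + v) - steklov (H n) u x)\<^sup>2) \<partial>lborel)
        \<le> liminf (\<lambda>n::nat. ?R)"
      by (rule Liminf_mono[OF ev])
    then show ?thesis by (simp add: Liminf_const)
  qed
  finally show ?thesis .
qed

text \<open>Exhaustion of S by compact sets and monotone convergence, since the bound does not see
  the compact set. In this form S may reach the boundary of \<Omega>, as the boundary layers
  do.\<close>

lemma translation_L2:
  fixes u :: "'a::euclidean_space \<Rightarrow> real"
  assumes W: "borel_weak_gradient \<Omega> u G" and \<Omega>: "open \<Omega>" and S: "open S"
    and sub: "\<And>x t. x \<in> S \<Longrightarrow> t \<in> {0..1} \<Longrightarrow> x + t *\<^sub>R v \<in> \<Omega>"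
  shows "(\<integral>\<^sup>+x\<in>S. ennreal ((u (x + v) - u x)\<^sup>2) \<partial>lborel) \<le>
    ennreal ((norm v)\<^sup>2) * (\<integral>\<^sup>+x. ennreal ((norm (G x))\<^sup>2) \<partial>lborel)" (is "_ \<le> ?R")
proof -
  have [measurable]: "u \<in> borel_measurable borel"
    using W by (auto simp: borel_weak_gradient_def)
  obtain C where C: "\<And>n. compact (C n)" "\<And>n. C n \<subseteq> S" "\<And>n. C n \<subseteq> interior (C (Suc n))" "\<Union>(range C) = S"
    using open_Union_compact_subsets[OF S] by metis
  have [measurable]: "C n \<in> sets borel" for n using C(1) by (simp add: borel_compact)
  have inc: "incseq C" using C(3) interior_subset by (intro incseq_SucI) blast
  have SUP: "(SUP n. ennreal ((u (x + v) - u x)\<^sup>2) * indicator (C n) x) = ennreal ((u (x + v) - u x)\<^sup>2) * indicator S x" for x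
  proof (rule antisym)
    show "(SUP n. ennreal ((u (x + v) - u x)\<^sup>2) * indicator (C n) x) \<le> ennreal ((u (x + v) - u x)\<^sup>2) * indicator S x"
      using C(2) by (intro SUP_least) (auto split: split_indicator)
    show "ennreal ((u (x + v) - u x)\<^sup>2) * indicator S x \<le> (SUP n. ennreal ((u (x + v) - u x)\<^sup>2) * indicator (C n) x)"
    proof (cases "x \<in> S")
      case True
      then obtain n where "x \<in> C n" using C(4) by blast
      then show ?thesis by (intro SUP_upper2[of n]) (simp_all add: True)
    qed simp
  qed
  have "(\<integral>\<^sup>+x\<in>S. ennreal ((u (x + v) - u x)\<^sup>2) \<partial>lborel) =
      (SUP n. \<integral>\<^sup>+x\<in>C n. ennreal ((u (x + v) - u x)\<^sup>2) \<partial>lborel)"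
    unfolding SUP[symmetric]
  proof (rule nn_integral_monotone_convergence_SUP)
    show "incseq (\<lambda>n x. ennreal ((u (x + v) - u x)\<^sup>2) * indicator (C n) x)"
      using inc by (auto simp: incseq_def le_fun_def split: split_indicator)
  qed measurable
  also have "\<dots> \<le> ?R"
    using C(2) sub by (intro SUP_least translation_L2_compact[OF W \<Omega> C(1)]) blast
  finally show ?thesis .
qed

section \<open>The Poincare inequality on a domain\<close>

text \<open>The constant c is not prescribed to be a mean value, so one c can be carried from one
  set to a larger one. The gradient term is the global integral for every A, so the constants C of
  different sets simply combine.\<close>

definition poincare_on :: "'a::euclidean_space set \<Rightarrow> 'a set \<Rightarrow> bool" where
  "poincare_on \<Omega> A \<longleftrightarrow> (\<exists>C\<ge>0. \<forall>u G. borel_weak_gradient \<Omega> u G \<longrightarrow>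
     (\<exists>c. (\<integral>\<^sup>+x\<in>A. ennreal ((u x - c)\<^sup>2) \<partial>lborel) \<le>
       ennreal C * (\<integral>\<^sup>+x. ennreal ((norm (G x))\<^sup>2) \<partial>lborel)))"

section \<open>Balls, overlapping unions and compact subsets\<close>

lemma ennreal_square_diff_triangle:
  "ennreal ((x - z)\<^sup>2) \<le> 2 * ennreal ((x - y)\<^sup>2) + 2 * ennreal ((y - z)\<^sup>2)" for x y z :: real
proof -
  have "(x - z)\<^sup>2 \<le> 2 * (x - y)\<^sup>2 + 2 * (y - z)\<^sup>2"
    using zero_le_power2[of "(x - y) - (y - z)"] by (simp add: power2_eq_square algebra_simps)
  then have "ennreal ((x - z)\<^sup>2) \<le> ennreal (2 * (x - y)\<^sup>2 + 2 * (y - z)\<^sup>2)"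
    by (rule ennreal_leI)
  then show ?thesis by (simp add: ennreal_mult')
qed

lemma nn_integral_square_diff_triangle:
  fixes u w :: "'a \<Rightarrow> real"
  assumes [measurable]: "u \<in> borel_measurable M" "w \<in> borel_measurable M" "S \<in> sets M"
  shows "(\<integral>\<^sup>+x\<in>S. ennreal ((u x - c)\<^sup>2) \<partial>M) \<le>
    2 * (\<integral>\<^sup>+x\<in>S. ennreal ((u x - w x)\<^sup>2) \<partial>M) + 2 * (\<integral>\<^sup>+x\<in>S. ennreal ((w x - c)\<^sup>2) \<partial>M)"
proof -
  have "(\<integral>\<^sup>+x\<in>S. ennreal ((u x - c)\<^sup>2) \<partial>M) \<le>
      (\<integral>\<^sup>+x. 2 * (ennreal ((u x - w x)\<^sup>2) * indicator S x) + 2 * (ennreal ((w x - c)\<^sup>2) * indicator S x) \<partial>M)"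
    using ennreal_square_diff_triangle by (intro nn_integral_mono) (auto split: split_indicator)
  also have "\<dots> = 2 * (\<integral>\<^sup>+x\<in>S. ennreal ((u x - w x)\<^sup>2) \<partial>M) + 2 * (\<integral>\<^sup>+x\<in>S. ennreal ((w x - c)\<^sup>2) \<partial>M)"
    by (subst nn_integral_add) (auto simp: nn_integral_cmult)
  finally show ?thesis .
qed

text \<open>A function whose average over B is at most k takes a value at most k: otherwise the
  positive function \<Phi> - k would have integral 0 over B. It selects the point of a ball at which
  the value of u serves as the constant c.\<close>

lemma nn_integral_le_imp_exists_le:
  assumes [measurable]: "B \<in> sets M" "\<Phi> \<in> borel_measurable M"
    and B: "emeasure M B > 0" "emeasure M B < \<infinity>" and le: "(\<integral>\<^sup>+x\<in>B. \<Phi> x \<partial>M) \<le> k * emeasure M B"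
  shows "\<exists>x\<in>B. \<Phi> x \<le> k"
proof (rule ccontr)
  assume "\<not> ?thesis"
  then have gt: "k < \<Phi> x" if "x \<in> B" for x using that by (auto simp: not_le)
  obtain x0 where "x0 \<in> B" using B(1) by (metis emeasure_empty ex_in_conv less_irrefl)
  then have k: "k < \<infinity>" using gt[of x0] by (auto simp: less_top[symmetric])
  \<comment> \<open>k is finite because it lies below a value of \<Phi>. Finiteness of the
    subtrahend is what allows the truncated subtraction of \<open>ennreal\<close> to pass through
    the integral.\<close>
  have kB: "k * emeasure M B < top"
    using k B(2) by (simp add: ennreal_mult_less_top)
  have "(\<integral>\<^sup>+x. \<Phi> x * indicator B x - k * indicator B x \<partial>M) =
      (\<integral>\<^sup>+x\<in>B. \<Phi> x \<partial>M) - (\<integral>\<^sup>+x\<in>B. k \<partial>M)"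
    using kB gt
    by (intro nn_integral_diff) (auto simp: nn_integral_cmult less_imp_le split: split_indicator)
  also have "\<dots> = 0"
    using le le_less_trans[OF le kB] by (simp add: nn_integral_cmult diff_eq_0_ennreal)
  finally have "AE x in M. \<Phi> x * indicator B x - k * indicator B x = 0"
    by (subst (asm) nn_integral_0_iff_AE) auto
  then have "AE x in M. x \<notin> B"
  proof eventually_elim
    case (elim x)
    then show ?case using gt[of x] k
      by (auto simp: indicator_def diff_eq_0_iff_ennreal split: if_splits)
  qed
  then have "emeasure M B = 0"
    using AE_iff_null_sets[OF assms(1)] by (simp add: null_sets_def)
  with B show False by simp
qed

lemma emeasure_lborel_bounded_finite:
  fixes U :: "'a::euclidean_space set"
  assumes "bounded U" shows "emeasure lborel U < \<infinity>"
  using emeasure_bounded_finite[OF assms] by simp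

lemma poincare_on_subset: "poincare_on \<Omega> B \<Longrightarrow> A \<subseteq> B \<Longrightarrow> poincare_on \<Omega> A"
proof -
  assume "poincare_on \<Omega> B" and AB: "A \<subseteq> B"
  then obtain C where C: "C \<ge> 0" "\<And>u G. borel_weak_gradient \<Omega> u G \<Longrightarrow>
     (\<exists>c. (\<integral>\<^sup>+x\<in>B. ennreal ((u x - c)\<^sup>2) \<partial>lborel) \<le>
       ennreal C * (\<integral>\<^sup>+x. ennreal ((norm (G x))\<^sup>2) \<partial>lborel))"
    unfolding poincare_on_def by blast
  have "(\<integral>\<^sup>+x\<in>A. ennreal ((u x - c)\<^sup>2) \<partial>lborel) \<le> (\<integral>\<^sup>+x\<in>B. ennreal ((u x - c)\<^sup>2) \<partial>lborel)" for u :: "'a \<Rightarrow> real" and c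
    using AB by (intro nn_integral_mono) (auto split: split_indicator)
  then show ?thesis
    unfolding poincare_on_def using C by (meson order_trans)
qed

text \<open>Pairs (x, y) in the ball are written as y = x + v with |v| < 2r; all segments then stay
  in the ball of radius 3r. Integrating the translation estimate over v bounds the double integral
  of |u(y) - u(x)|^2, and a point x with at most average inner integral gives c = u(x).\<close>

lemma poincare_on_ball:
  fixes p :: "'a::euclidean_space"
  assumes \<Omega>: "open \<Omega>" and r: "r > 0" and sub: "ball p (3 * r) \<subseteq> \<Omega>"
  shows "poincare_on \<Omega> (ball p r)"
proof -
  define B where "B = ball p r"
  define V :: "'a set" where "V = ball 0 (2 * r)"
  have [measurable]: "B \<in> sets borel" "V \<in> sets borel" by (auto simp: B_def V_def)
  define mB where "mB = measure lborel B"
  define mV where "mV = measure lborel V"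
  have eB: "emeasure lborel B = ennreal mB" and eV: "emeasure lborel V = ennreal mV"
    unfolding mB_def mV_def B_def V_def
    using emeasure_lborel_bounded_finite[OF bounded_ball]
    by (metis emeasure_eq_ennreal_measure infinity_ennreal_def less_irrefl)+
  have mB: "mB > 0" unfolding mB_def B_def using r by (rule content_ball_pos)
  have mV: "mV \<ge> 0" unfolding mV_def by simp
  \<comment> \<open>The volume of the set of shifts times the largest |v|^2, divided by the volume
    of the ball over which x is averaged.\<close>
  define C where "C = mV * (2 * r)\<^sup>2 / mB"
  show ?thesis unfolding poincare_on_def
  proof (rule exI[of _ C], intro conjI allI impI)
    show "0 \<le> C" using mB mV by (simp add: C_def)
    fix u :: "'a \<Rightarrow> real" and G assume W: "borel_weak_gradient \<Omega> u G"
    have [measurable]: "u \<in> borel_measurable borel"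
      using W by (auto simp: borel_weak_gradient_def)
    let ?I = "\<integral>\<^sup>+x. ennreal ((norm (G x))\<^sup>2) \<partial>lborel"
    define \<Phi> where "\<Phi> x = (\<integral>\<^sup>+y\<in>B. ennreal ((u y - u x)\<^sup>2) \<partial>lborel)" for x
    have [measurable]: "\<Phi> \<in> borel_measurable borel" unfolding \<Phi>_def by measurable
    have "(\<integral>\<^sup>+x\<in>B. \<Phi> x \<partial>lborel) \<le>
        (\<integral>\<^sup>+x. (\<integral>\<^sup>+v. ennreal ((u (x + v) - u x)\<^sup>2) * indicator V v * indicator B x \<partial>lborel) \<partial>lborel)"
    proof (rule nn_integral_mono)
      fix x
      have "\<Phi> x * indicator B x \<le>
          (\<integral>\<^sup>+y. ennreal ((u y - u x)\<^sup>2) * indicator V (y - x) * indicator B x \<partial>lborel)"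
      proof (cases "x \<in> B")
        case True
        have "y - x \<in> V" if "y \<in> B" for y
          using True that dist_triangle2[of x y p] by (simp add: B_def V_def dist_norm norm_minus_commute)
        with True show ?thesis unfolding \<Phi>_def
          by (auto intro!: nn_integral_mono split: split_indicator)
      qed simp
      also have "\<dots> = (\<integral>\<^sup>+v. ennreal ((u (x + v) - u x)\<^sup>2) * indicator V (x + v - x) * indicator B x \<partial>lborel)"
        by (rule nn_integral_lborel_translate[symmetric]) measurable
      finally show "\<Phi> x * indicator B x \<le> (\<integral>\<^sup>+v. ennreal ((u (x + v) - u x)\<^sup>2) * indicator V v * indicator B x \<partial>lborel)"
        by simp
    qed
    also have "\<dots> = (\<integral>\<^sup>+v. (\<integral>\<^sup>+x. ennreal ((u (x + v) - u x)\<^sup>2) * indicator V v * indicator B x \<partial>lborel) \<partial>lborel)"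
      by (rule lborel_pair.Fubini') measurable
    also have "\<dots> \<le> (\<integral>\<^sup>+v. (ennreal ((2 * r)\<^sup>2) * ?I) * indicator V v \<partial>lborel)"
    proof (rule nn_integral_mono)
      fix v
      show "(\<integral>\<^sup>+x. ennreal ((u (x + v) - u x)\<^sup>2) * indicator V v * indicator B x \<partial>lborel) \<le>
          (ennreal ((2 * r)\<^sup>2) * ?I) * indicator V v"
      proof (cases "v \<in> V")
        case True
        then have v: "norm v < 2 * r" by (simp add: V_def)
        have "(\<integral>\<^sup>+x\<in>B. ennreal ((u (x + v) - u x)\<^sup>2) \<partial>lborel) \<le> ennreal ((norm v)\<^sup>2) * ?I"
        proof (rule translation_L2[OF W \<Omega>])
          show "open B" by (simp add: B_def)
          fix x and t :: real assume x: "x \<in> B" and t: "t \<in> {0..1}"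
          have "dist p (x + t *\<^sub>R v) \<le> dist p x + norm (t *\<^sub>R v)"
            by (metis add_diff_cancel_left' dist_commute dist_norm dist_triangle)
          also have "norm (t *\<^sub>R v) \<le> 1 * norm v"
            unfolding norm_scaleR using t by (intro mult_right_mono) auto
          finally have "dist p (x + t *\<^sub>R v) < 3 * r" using v x by (simp add: B_def)
          then show "x + t *\<^sub>R v \<in> \<Omega>" using sub by auto
        qed
        also have "\<dots> \<le> ennreal ((2 * r)\<^sup>2) * ?I"
          using v by (intro mult_right_mono ennreal_leI power_mono) auto
        finally show ?thesis using True by simp
      qed simp
    qed
    also have "\<dots> = (ennreal ((2 * r)\<^sup>2) * ?I) * ennreal mV"
      by (simp add: nn_integral_cmult eV)
    also have "\<dots> = (ennreal C * ?I) * emeasure lborel B"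
    proof -
      have "ennreal ((2 * r)\<^sup>2) * ennreal mV = ennreal C * ennreal mB"
        using mB mV by (simp add: C_def flip: ennreal_mult' ennreal_mult'')
      moreover have "(ennreal ((2 * r)\<^sup>2) * ?I) * ennreal mV = (ennreal ((2 * r)\<^sup>2) * ennreal mV) * ?I"
        by (simp only: ac_simps)
      moreover have "(ennreal C * ?I) * ennreal mB = (ennreal C * ennreal mB) * ?I"
        by (simp only: ac_simps)
      ultimately show ?thesis unfolding eB by (simp only:)
    qed
    finally have "\<exists>x\<in>B. \<Phi> x \<le> ennreal C * ?I"
      using mB by (intro nn_integral_le_imp_exists_le[where M=lborel]) (auto simp: eB)
    then show "\<exists>c. (\<integral>\<^sup>+x\<in>ball p r. ennreal ((u x - c)\<^sup>2) \<partial>lborel) \<le> ennreal C * ?I"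
      unfolding \<Phi>_def B_def by blast
  qed
qed

text \<open>Two constants that both approximate u on a set of positive measure are close: (a - b)^2
  is at most 2 (a - u)^2 + 2 (u - b)^2, and integrating over D produces the factor m on the
  left.\<close>

lemma poincare_constant_le:
  fixes u :: "'a::euclidean_space \<Rightarrow> real"
  assumes [measurable]: "u \<in> borel_measurable borel" "D \<in> sets borel"
    and D: "emeasure lborel D = ennreal m" "m > 0"
    and a: "(\<integral>\<^sup>+x\<in>D. ennreal ((u x - a)\<^sup>2) \<partial>lborel) \<le> ennreal Ca * I"
    and b: "(\<integral>\<^sup>+x\<in>D. ennreal ((u x - b)\<^sup>2) \<partial>lborel) \<le> ennreal Cb * I"
    and nn: "Ca \<ge> 0" "Cb \<ge> 0"
  shows "ennreal ((a - b)\<^sup>2) \<le> ennreal (2 * (Ca + Cb) / m) * I"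
proof -
  have "ennreal ((a - b)\<^sup>2) * ennreal m = (\<integral>\<^sup>+x\<in>D. ennreal ((a - b)\<^sup>2) \<partial>lborel)"
    by (simp add: nn_integral_cmult D)
  also have "\<dots> \<le> 2 * (\<integral>\<^sup>+x\<in>D. ennreal ((a - u x)\<^sup>2) \<partial>lborel) + 2 * (\<integral>\<^sup>+x\<in>D. ennreal ((u x - b)\<^sup>2) \<partial>lborel)"
    by (rule nn_integral_square_diff_triangle[where u="\<lambda>x. a"]) auto
  also have "\<dots> \<le> 2 * (ennreal Ca * I) + 2 * (ennreal Cb * I)"
    using a b by (intro add_mono mult_left_mono) (auto simp: power2_commute[of a])
  also have "\<dots> = ennreal (2 * (Ca + Cb)) * I"
    using nn by (simp add: ennreal_mult' distrib_right distrib_left mult.assoc)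
  finally have "ennreal (1 / m) * (ennreal ((a - b)\<^sup>2) * ennreal m) \<le> ennreal (1 / m) * (ennreal (2 * (Ca + Cb)) * I)"
    by (rule mult_left_mono) simp
  also have "ennreal (1 / m) * (ennreal ((a - b)\<^sup>2) * ennreal m) = ennreal ((a - b)\<^sup>2)"
    using D(2) by (simp flip: ennreal_mult' ennreal_mult'')
  also have "ennreal (1 / m) * (ennreal (2 * (Ca + Cb)) * I) = ennreal (2 * (Ca + Cb) / m) * I"
  proof -
    have "ennreal (1 / m) * ennreal (2 * (Ca + Cb)) = ennreal (2 * (Ca + Cb) / m)"
      using D(2) nn by (subst ennreal_mult'[symmetric]) auto
    then show ?thesis by (simp only: mult.assoc[symmetric])
  qed
  finally show ?thesis .
qed

text \<open>The constant a of A is kept on the whole union. On B it replaces b at the cost of (b -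
  a)^2 times the measure of B, and the overlap bounds (b - a)^2. This is why the overlap must have
  positive measure and B finite measure.\<close>

lemma poincare_on_Un:
  fixes \<Omega> :: "'a::euclidean_space set"
  assumes "poincare_on \<Omega> A" "poincare_on \<Omega> B"
    and [measurable]: "A \<in> sets borel" "B \<in> sets borel"
    and AB: "emeasure lborel (A \<inter> B) > 0" and fin: "emeasure lborel B < \<infinity>"
  shows "poincare_on \<Omega> (A \<union> B)"
proof -
  obtain Ca where Ca: "Ca \<ge> 0" "\<And>u G. borel_weak_gradient \<Omega> u G \<Longrightarrow>
     (\<exists>c. (\<integral>\<^sup>+x\<in>A. ennreal ((u x - c)\<^sup>2) \<partial>lborel) \<le>
       ennreal Ca * (\<integral>\<^sup>+x. ennreal ((norm (G x))\<^sup>2) \<partial>lborel))"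
    using assms(1) unfolding poincare_on_def by blast
  obtain Cb where Cb: "Cb \<ge> 0" "\<And>u G. borel_weak_gradient \<Omega> u G \<Longrightarrow>
     (\<exists>c. (\<integral>\<^sup>+x\<in>B. ennreal ((u x - c)\<^sup>2) \<partial>lborel) \<le>
       ennreal Cb * (\<integral>\<^sup>+x. ennreal ((norm (G x))\<^sup>2) \<partial>lborel))"
    using assms(2) unfolding poincare_on_def by blast
  define m where "m = measure lborel (A \<inter> B)"
  define mB where "mB = measure lborel B"
  have eB: "emeasure lborel B = ennreal mB"
    unfolding mB_def using fin by (intro emeasure_eq_ennreal_measure) auto
  have "emeasure lborel (A \<inter> B) \<le> emeasure lborel B" by (intro emeasure_mono) auto
  with fin have "emeasure lborel (A \<inter> B) < \<infinity>" by (rule le_less_trans[rotated])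
  then have em: "emeasure lborel (A \<inter> B) = ennreal m"
    unfolding m_def by (intro emeasure_eq_ennreal_measure) auto
  with AB have m: "m > 0" by (simp add: m_def)
  define q where "q = 2 * (Cb + Ca) / m"
  have q: "q \<ge> 0" using m Ca(1) Cb(1) by (simp add: q_def)
  define C where "C = Ca + (2 * Cb + 2 * (q * mB))"
  show ?thesis unfolding poincare_on_def
  proof (rule exI[of _ C], intro conjI allI impI)
    have mB: "mB \<ge> 0" by (simp add: mB_def)
    show "0 \<le> C" using q Ca(1) Cb(1) mB by (simp add: C_def)
    fix u :: "'a \<Rightarrow> real" and G assume W: "borel_weak_gradient \<Omega> u G"
    have [measurable]: "u \<in> borel_measurable borel"
      using W by (auto simp: borel_weak_gradient_def)
    let ?I = "\<integral>\<^sup>+x. ennreal ((norm (G x))\<^sup>2) \<partial>lborel"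
    obtain a where a: "(\<integral>\<^sup>+x\<in>A. ennreal ((u x - a)\<^sup>2) \<partial>lborel) \<le> ennreal Ca * ?I"
      using Ca(2)[OF W] by blast
    obtain b where b: "(\<integral>\<^sup>+x\<in>B. ennreal ((u x - b)\<^sup>2) \<partial>lborel) \<le> ennreal Cb * ?I"
      using Cb(2)[OF W] by blast
    have "(\<integral>\<^sup>+x\<in>A\<inter>B. ennreal ((u x - a)\<^sup>2) \<partial>lborel) \<le> (\<integral>\<^sup>+x\<in>A. ennreal ((u x - a)\<^sup>2) \<partial>lborel)"
      by (intro nn_integral_mono) (auto split: split_indicator)
    with a have a': "(\<integral>\<^sup>+x\<in>A\<inter>B. ennreal ((u x - a)\<^sup>2) \<partial>lborel) \<le> ennreal Ca * ?I" by simp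
    have "(\<integral>\<^sup>+x\<in>A\<inter>B. ennreal ((u x - b)\<^sup>2) \<partial>lborel) \<le> (\<integral>\<^sup>+x\<in>B. ennreal ((u x - b)\<^sup>2) \<partial>lborel)"
      by (intro nn_integral_mono) (auto split: split_indicator)
    with b have b': "(\<integral>\<^sup>+x\<in>A\<inter>B. ennreal ((u x - b)\<^sup>2) \<partial>lborel) \<le> ennreal Cb * ?I" by simp
    have ba: "ennreal ((b - a)\<^sup>2) \<le> ennreal q * ?I"
      unfolding q_def by (rule poincare_constant_le[OF _ _ em m b' a']) (use Ca Cb in auto)
    have "(\<integral>\<^sup>+x\<in>A\<union>B. ennreal ((u x - a)\<^sup>2) \<partial>lborel) \<le>
        (\<integral>\<^sup>+x. ennreal ((u x - a)\<^sup>2) * indicator A x + ennreal ((u x - a)\<^sup>2) * indicator B x \<partial>lborel)"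
      by (intro nn_integral_mono) (auto split: split_indicator)
    also have "\<dots> = (\<integral>\<^sup>+x\<in>A. ennreal ((u x - a)\<^sup>2) \<partial>lborel) + (\<integral>\<^sup>+x\<in>B. ennreal ((u x - a)\<^sup>2) \<partial>lborel)"
      by (rule nn_integral_add) auto
    also have "\<dots> \<le> ennreal Ca * ?I + (2 * (ennreal Cb * ?I) + 2 * (ennreal q * ?I * ennreal mB))"
    proof (intro add_mono a)
      have "(\<integral>\<^sup>+x\<in>B. ennreal ((u x - a)\<^sup>2) \<partial>lborel) \<le>
          2 * (\<integral>\<^sup>+x\<in>B. ennreal ((u x - b)\<^sup>2) \<partial>lborel) + 2 * (\<integral>\<^sup>+x\<in>B. ennreal ((b - a)\<^sup>2) \<partial>lborel)"
        by (rule nn_integral_square_diff_triangle[where w="\<lambda>x. b"]) auto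
      also have "(\<integral>\<^sup>+x\<in>B. ennreal ((b - a)\<^sup>2) \<partial>lborel) = ennreal ((b - a)\<^sup>2) * ennreal mB"
        by (simp add: nn_integral_cmult eB)
      also have "2 * (\<integral>\<^sup>+x\<in>B. ennreal ((u x - b)\<^sup>2) \<partial>lborel) + 2 * (ennreal ((b - a)\<^sup>2) * ennreal mB) \<le>
          2 * (ennreal Cb * ?I) + 2 * (ennreal q * ?I * ennreal mB)"
        by (intro add_mono mult_left_mono mult_right_mono b ba) auto
      finally show "(\<integral>\<^sup>+x\<in>B. ennreal ((u x - a)\<^sup>2) \<partial>lborel) \<le>
          2 * (ennreal Cb * ?I) + 2 * (ennreal q * ?I * ennreal mB)" .
    qed
    also have "\<dots> = ennreal C * ?I"
    proof -
      have "ennreal C = ennreal Ca + (2 * ennreal Cb + 2 * (ennreal q * ennreal mB))"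
        using q Ca(1) Cb(1) mB unfolding C_def by (simp add: ennreal_mult' ennreal_mult'')
      then show ?thesis by (simp only: distrib_right distrib_left ac_simps)
    qed
    finally show "\<exists>c. (\<integral>\<^sup>+x\<in>A\<union>B. ennreal ((u x - c)\<^sup>2) \<partial>lborel) \<le> ennreal C * ?I" by blast
  qed
qed

lemma emeasure_lborel_open_pos:
  fixes U :: "'a::euclidean_space set"
  assumes "open U" "x \<in> U"
  shows "emeasure lborel U > 0"
proof -
  obtain e where e: "e > 0" "ball x e \<subseteq> U" using assms open_contains_ball by blast
  have "0 < emeasure lborel (ball x e)"
    using content_ball_pos[OF e(1), of x] by (intro gr_zeroI) (simp add: measure_def)
  also have "\<dots> \<le> emeasure lborel U" using e(2) assms(1) by (intro emeasure_mono) auto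
  finally show ?thesis .
qed

text \<open>Lying in a common open set with a Poincare inequality is an equivalence relation on
  \<Omega>: two such sets with a common point overlap in a nonempty open set, so they can be glued.
  Small balls make its classes open, and connectedness leaves one class. The sets of a finite
  subcover of K all contain the base point \<open>x0\<close>, hence can be glued one after the
  other.\<close>

lemma poincare_on_compact:
  fixes \<Omega> :: "'a::euclidean_space set"
  assumes \<Omega>: "open \<Omega>" "connected \<Omega>" "bounded \<Omega>" and K: "compact K" "K \<subseteq> \<Omega>"
  shows "poincare_on \<Omega> K"
proof (cases "K = {}")
  case True
  then show ?thesis by (auto simp: poincare_on_def intro: exI[of _ 0])
next
  case False
  then obtain x0 where x0: "x0 \<in> \<Omega>" using K by blast
  define R where "R a b \<longleftrightarrow> (\<exists>A. open A \<and> A \<subseteq> \<Omega> \<and> a \<in> A \<and> b \<in> A \<and> poincare_on \<Omega> A)" for a b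
  have glue: "poincare_on \<Omega> (A \<union> B)" if "open A" "A \<subseteq> \<Omega>" "poincare_on \<Omega> A"
    "open B" "B \<subseteq> \<Omega>" "poincare_on \<Omega> B" "x \<in> A" "x \<in> B" for A B x
  proof (rule poincare_on_Un)
    show "0 < emeasure lborel (A \<inter> B)"
      using that by (intro emeasure_lborel_open_pos[of _ x]) auto
    show "emeasure lborel B < \<infinity>"
      using that \<Omega> bounded_subset by (blast intro: emeasure_lborel_bounded_finite)
  qed (use that in auto)
  have R: "R x0 x" if "x \<in> \<Omega>" for x
  proof (rule connected_equivalence_relation[OF \<Omega>(2), of x0 x R])
    show "R b a" if "R a b" for a b using that unfolding R_def by blast
    show "R a c" if "R a b" "R b c" for a b c
    proof -
      obtain A where A: "open A" "A \<subseteq> \<Omega>" "a \<in> A" "b \<in> A" "poincare_on \<Omega> A"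
        using \<open>R a b\<close> unfolding R_def by blast
      obtain B where B: "open B" "B \<subseteq> \<Omega>" "b \<in> B" "c \<in> B" "poincare_on \<Omega> B"
        using \<open>R b c\<close> unfolding R_def by blast
      have "poincare_on \<Omega> (A \<union> B)" using glue A B by blast
      then show ?thesis unfolding R_def using A B by (intro exI[of _ "A \<union> B"]) auto
    qed
    show "\<exists>T. openin (top_of_set \<Omega>) T \<and> a \<in> T \<and> (\<forall>x\<in>T. R a x)" if "a \<in> \<Omega>" for a
    proof -
      obtain e where e: "e > 0" "ball a e \<subseteq> \<Omega>" using \<Omega>(1) \<open>a \<in> \<Omega>\<close> open_contains_ball by blast
      have "poincare_on \<Omega> (ball a (e / 3))"
        using e by (intro poincare_on_ball \<Omega>(1)) auto
      moreover have "ball a (e / 3) \<subseteq> \<Omega>" using e subset_ball[of "e / 3" e a] by auto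
      ultimately show ?thesis
        using e by (intro exI[of _ "ball a (e / 3)"])
          (auto simp: R_def openin_open_eq[OF \<Omega>(1)] intro!: exI[of _ "ball a (e / 3)"])
    qed
  qed (use x0 that in auto)
  then have "\<exists>A. open A \<and> A \<subseteq> \<Omega> \<and> x0 \<in> A \<and> x \<in> A \<and> poincare_on \<Omega> A" if "x \<in> K" for x
    using that K(2) unfolding R_def by blast
  then obtain A where A: "\<And>x. x \<in> K \<Longrightarrow> open (A x) \<and> A x \<subseteq> \<Omega> \<and> x0 \<in> A x \<and> x \<in> A x \<and> poincare_on \<Omega> (A x)"
    by metis
  obtain F where F: "F \<subseteq> K" "finite F" "K \<subseteq> (\<Union>x\<in>F. A x)"
  proof (rule compactE_image[OF K(1), of K A])
    show "K \<subseteq> \<Union> (A ` K)" using A by auto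
  qed (use A in auto)
  with False have "F \<noteq> {}" by auto
  from F(2) this F(1) have "poincare_on \<Omega> (\<Union>x\<in>F. A x)"
  proof (induction F rule: finite_ne_induct)
    case (singleton x)
    then show ?case using A by auto
  next
    case (insert x F)
    then obtain y where "y \<in> F" by blast
    have "poincare_on \<Omega> (A x \<union> (\<Union>x\<in>F. A x))"
    proof (rule glue[where x=x0])
      show "poincare_on \<Omega> (\<Union>x\<in>F. A x)" using insert by auto
      show "x0 \<in> (\<Union>x\<in>F. A x)" using A insert.prems \<open>y \<in> F\<close> by blast
    qed (use A insert.prems in blast)+
    then show ?case by simp
  qed
  from poincare_on_subset[OF this F(3)] show ?thesis .
qed

text \<open>The same constant \<open>c\<close> serves on \<open>A\<close> and on \<open>A \<union> S\<close>, so no overlap is needed here.\<close>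

lemma poincare_on_shift:
  fixes \<Omega> :: "'a::euclidean_space set"
  assumes "poincare_on \<Omega> A" and \<Omega>: "open \<Omega>" and [measurable]: "A \<in> sets borel" and S: "open S"
    and sub: "\<And>x t. x \<in> S \<Longrightarrow> t \<in> {0..1} \<Longrightarrow> x + t *\<^sub>R v \<in> \<Omega>"
    and SA: "\<And>x. x \<in> S \<Longrightarrow> x + v \<in> A"
  shows "poincare_on \<Omega> (A \<union> S)"
proof -
  obtain C where C: "C \<ge> 0" "\<And>u G. borel_weak_gradient \<Omega> u G \<Longrightarrow>
     (\<exists>c. (\<integral>\<^sup>+x\<in>A. ennreal ((u x - c)\<^sup>2) \<partial>lborel) \<le>
       ennreal C * (\<integral>\<^sup>+x. ennreal ((norm (G x))\<^sup>2) \<partial>lborel))"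
    using assms(1) unfolding poincare_on_def by blast
  have [measurable]: "S \<in> sets borel" using S by simp
  \<comment> \<open>The term C belongs to A. On S, u(x) - c is split at u(x + v): the translation
    estimate gives |v|^2 and the inequality on A at the shifted point gives C, each with the factor
    2 from squaring a sum.\<close>
  define D where "D = C + (2 * (norm v)\<^sup>2 + 2 * C)"
  show ?thesis unfolding poincare_on_def
  proof (rule exI[of _ D], intro conjI allI impI)
    show "0 \<le> D" using C(1) by (simp add: D_def)
    fix u :: "'a \<Rightarrow> real" and G assume W: "borel_weak_gradient \<Omega> u G"
    have [measurable]: "u \<in> borel_measurable borel"
      using W by (auto simp: borel_weak_gradient_def)
    let ?I = "\<integral>\<^sup>+x. ennreal ((norm (G x))\<^sup>2) \<partial>lborel"
    obtain c where c: "(\<integral>\<^sup>+x\<in>A. ennreal ((u x - c)\<^sup>2) \<partial>lborel) \<le> ennreal C * ?I"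
      using C(2)[OF W] by blast
    have "(\<integral>\<^sup>+x\<in>A\<union>S. ennreal ((u x - c)\<^sup>2) \<partial>lborel) \<le>
        (\<integral>\<^sup>+x. ennreal ((u x - c)\<^sup>2) * indicator A x + ennreal ((u x - c)\<^sup>2) * indicator S x \<partial>lborel)"
      by (intro nn_integral_mono) (auto split: split_indicator)
    also have "\<dots> = (\<integral>\<^sup>+x\<in>A. ennreal ((u x - c)\<^sup>2) \<partial>lborel) + (\<integral>\<^sup>+x\<in>S. ennreal ((u x - c)\<^sup>2) \<partial>lborel)"
      by (rule nn_integral_add) auto
    also have "\<dots> \<le> ennreal C * ?I + (2 * (ennreal ((norm v)\<^sup>2) * ?I) + 2 * (ennreal C * ?I))"
    proof (intro add_mono c)
      have "(\<integral>\<^sup>+x\<in>S. ennreal ((u x - c)\<^sup>2) \<partial>lborel) \<le>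
          2 * (\<integral>\<^sup>+x\<in>S. ennreal ((u x - u (x + v))\<^sup>2) \<partial>lborel) + 2 * (\<integral>\<^sup>+x\<in>S. ennreal ((u (x + v) - c)\<^sup>2) \<partial>lborel)"
        by (rule nn_integral_square_diff_triangle) measurable
      also have "(\<integral>\<^sup>+x\<in>S. ennreal ((u x - u (x + v))\<^sup>2) \<partial>lborel) \<le> ennreal ((norm v)\<^sup>2) * ?I"
        using translation_L2[OF W \<Omega> S sub] by (simp add: power2_commute)
      also have "(\<integral>\<^sup>+x\<in>S. ennreal ((u (x + v) - c)\<^sup>2) \<partial>lborel) \<le>
          (\<integral>\<^sup>+x. ennreal ((u (v + x) - c)\<^sup>2) * indicator A (v + x) \<partial>lborel)"
        using SA by (intro nn_integral_mono) (auto simp: add.commute split: split_indicator)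
      also have "\<dots> = (\<integral>\<^sup>+x\<in>A. ennreal ((u x - c)\<^sup>2) \<partial>lborel)"
        by (rule nn_integral_lborel_translate) measurable
      also have "\<dots> \<le> ennreal C * ?I" by (rule c)
      finally show "(\<integral>\<^sup>+x\<in>S. ennreal ((u x - c)\<^sup>2) \<partial>lborel) \<le>
          2 * (ennreal ((norm v)\<^sup>2) * ?I) + 2 * (ennreal C * ?I)"
        by (simp add: mult_left_mono add_mono)
    qed
    also have "\<dots> = ennreal D * ?I"
    proof -
      have "ennreal D = ennreal C + (2 * ennreal ((norm v)\<^sup>2) + 2 * ennreal C)"
        unfolding D_def using C(1) by (subst ennreal_plus) (simp_all add: ennreal_mult')
      then show ?thesis by (simp only: distrib_right mult.assoc)
    qed
    finally show "\<exists>c. (\<integral>\<^sup>+x\<in>A\<union>S. ennreal ((u x - c)\<^sup>2) \<partial>lborel) \<le> ennreal D * ?I" by blast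
  qed
qed

text \<open>Asking that closures of the layers be shifted into \<Omega> makes the shifted layers
  part of one compact K inside \<Omega>. Every layer then moves into K itself, so the layers are
  added independently and need not be compared with each other.\<close>

lemma poincare_on_domain:
  fixes \<Omega> :: "'a::euclidean_space set"
  assumes \<Omega>: "open \<Omega>" "connected \<Omega>" "bounded \<Omega>"
    and bd: "\<And>p. p \<in> frontier \<Omega> \<Longrightarrow> \<exists>r>0. \<exists>v. (\<forall>x\<in>\<Omega> \<inter> ball p r. \<forall>t\<in>{0..1}. x + t *\<^sub>R v \<in> \<Omega>) \<and>
      (\<forall>x\<in>closure (\<Omega> \<inter> ball p r). x + v \<in> \<Omega>)"
  shows "poincare_on \<Omega> \<Omega>"
proof -
  obtain r v where r: "\<And>p. p \<in> frontier \<Omega> \<Longrightarrow> r p > 0"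
    and v1: "\<And>p x t. p \<in> frontier \<Omega> \<Longrightarrow> x \<in> \<Omega> \<inter> ball p (r p) \<Longrightarrow> t \<in> {0..1} \<Longrightarrow> x + t *\<^sub>R v p \<in> \<Omega>"
    and v2: "\<And>p x. p \<in> frontier \<Omega> \<Longrightarrow> x \<in> closure (\<Omega> \<inter> ball p (r p)) \<Longrightarrow> x + v p \<in> \<Omega>"
    using bd by metis
  define S where "S p = \<Omega> \<inter> ball p (r p)" for p
  have "compact (frontier \<Omega>)" using \<Omega>(3) by (rule compact_frontier_bounded)
  then obtain J where J: "J \<subseteq> frontier \<Omega>" "finite J" "frontier \<Omega> \<subseteq> (\<Union>p\<in>J. ball p (r p))"
    using r by (rule_tac compactE_image[of "frontier \<Omega>" "frontier \<Omega>" "\<lambda>p. ball p (r p)"]) auto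
  \<comment> \<open>The first piece is compact and misses the frontier, which the finitely many
    balls cover. The second collects the targets of all shifts.\<close>
  define K where "K = (closure \<Omega> - (\<Union>p\<in>J. ball p (r p))) \<union> (\<Union>p\<in>J. (\<lambda>x. x + v p) ` closure (S p))"
  have "compact K"
    unfolding K_def S_def
  proof (intro compact_Un compact_UN J compact_diff compact_continuous_image)
    show "compact (closure (\<Omega> \<inter> ball p (r p)))" for p
      using \<Omega>(3) by (auto simp: compact_closure bounded_Int)
  qed (use \<Omega>(3) in \<open>auto simp: compact_closure intro!: continuous_intros\<close>)
  moreover have "K \<subseteq> \<Omega>"
    unfolding K_def S_def
    using J v2 closure_Un_frontier[of \<Omega>] by auto
  ultimately have PK: "poincare_on \<Omega> K" and Kb: "K \<in> sets borel"
    using poincare_on_compact[OF \<Omega>] borel_compact by auto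
  have "poincare_on \<Omega> (K \<union> (\<Union>p\<in>J'. S p))" if "J' \<subseteq> J" for J'
    using finite_subset[OF that J(2)] that
  proof (induction J' rule: finite_induct)
    case empty
    with PK show ?case by simp
  next
    case (insert p F)
    then have p: "p \<in> frontier \<Omega>" using J(1) by auto
    have "poincare_on \<Omega> ((K \<union> (\<Union>p\<in>F. S p)) \<union> S p)"
    proof (rule poincare_on_shift[where v="v p"])
      show "open (S p)" unfolding S_def using \<Omega>(1) by auto
      have "(\<Union>p\<in>F. S p) \<in> sets borel"
        using \<Omega>(1) by (intro borel_open) (auto simp: S_def)
      with Kb show "K \<union> (\<Union>p\<in>F. S p) \<in> sets borel" by auto
      show "x + t *\<^sub>R v p \<in> \<Omega>" if "x \<in> S p" "t \<in> {0..1}" for x t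
        using v1[OF p] that unfolding S_def by blast
      show "x + v p \<in> K \<union> (\<Union>p\<in>F. S p)" if "x \<in> S p" for x
        using that closure_subset[of "S p"] insert.prems unfolding K_def by blast
    qed (use insert \<Omega> in auto)
    moreover have "(K \<union> (\<Union>p\<in>F. S p)) \<union> S p = K \<union> (\<Union>p\<in>insert p F. S p)" by auto
    ultimately show ?case by simp
  qed
  from this[OF order_refl] show ?thesis
    by (rule poincare_on_subset) (use closure_subset[of \<Omega>] in \<open>auto simp: K_def S_def\<close>)
qed

section \<open>Geometry near a smooth boundary point\<close>

lemma continuous_on_vector_2:
  assumes "continuous_on A f" "continuous_on A g"
  shows "continuous_on A (\<lambda>x. vector [f x, g x] :: real^2)"
proof -
  have "(vector [a, b] :: real^2) = a *\<^sub>R axis 1 1 + b *\<^sub>R axis 2 1" for a b :: real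
    by (simp add: vec_eq_iff forall_2 axis_def)
  then show ?thesis using assms by (simp add: continuous_intros)
qed

text \<open>In the rotated coordinates a shift along the third axis raises the height and keeps the
  base point of the graph, so points above the graph stay above it. On the closure the strict
  inequality weakens to \<le> by continuity of \<gamma>, and the positive length of the full shift
  makes it strict again.\<close>

lemma smooth_boundary_inward_shift:
  fixes \<Omega> :: "(real^3) set"
  assumes sb: "smooth_boundary \<Omega>" and p: "p \<in> frontier \<Omega>"
  shows "\<exists>r>0. \<exists>v. (\<forall>x\<in>\<Omega> \<inter> ball p r. \<forall>t\<in>{0..1}. x + t *\<^sub>R v \<in> \<Omega>) \<and>
      (\<forall>x\<in>closure (\<Omega> \<inter> ball p r). x + v \<in> \<Omega>)"
proof -
  obtain r and T :: "real^3 \<Rightarrow> real^3" and \<gamma> :: "real^2 \<Rightarrow> real" where r: "r > 0" and T: "orthogonal_transformation T" and \<gamma>: "smooth \<gamma>"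
    and eq: "\<Omega> \<inter> ball p r = {x \<in> ball p r. T x $ 3 > \<gamma> (vector [T x $ 1, T x $ 2])}"
    using sb p unfolding smooth_boundary_def by meson
  have lin: "linear T" using T by (rule orthogonal_transformation_linear)
  obtain e where e: "T e = axis 3 1"
    using orthogonal_transformation_surj[OF T] by (metis surjD)
  have ne: "norm e = 1"
    using orthogonal_transformation_norm[OF T, of e] e by simp
  \<comment> \<open>The halved radius together with the length r/4 keeps shifted points, also those
    from the closed half ball, inside \<open>ball p r\<close>, where the description as a region
    above a graph is valid.\<close>
  define v where "v = (r / 4) *\<^sub>R e"
  have nv: "norm v = r / 4" using ne r by (simp add: v_def)
  have Tv: "T (x + t *\<^sub>R v) = T x + (t * (r / 4)) *\<^sub>R axis 3 1" for x t
    by (simp add: v_def linear_add[OF lin] linear_scale[OF lin] e)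
  have c1: "T (x + t *\<^sub>R v) $ 1 = T x $ 1" "T (x + t *\<^sub>R v) $ 2 = T x $ 2"
    "T (x + t *\<^sub>R v) $ 3 = T x $ 3 + t * (r / 4)" for x t
    by (simp_all add: Tv axis_def)
  have bl: "x + t *\<^sub>R v \<in> ball p r" if x: "x \<in> cball p (r / 2)" and t: "t \<in> {0..1}" for x and t :: real
  proof -
    have "dist p (x + t *\<^sub>R v) \<le> dist p x + norm (t *\<^sub>R v)"
      by (metis add_diff_cancel_left' dist_commute dist_norm dist_triangle)
    also have "norm (t *\<^sub>R v) \<le> 1 * norm v"
      unfolding norm_scaleR using t by (intro mult_right_mono) auto
    finally show ?thesis using x r by (simp add: nv)
  qed
  have contT: "continuous_on UNIV (\<lambda>x. T x $ i)" for i
    using lin by (intro continuous_intros linear_continuous_on) (simp add: linear_conv_bounded_linear)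
  have cont: "continuous_on UNIV (\<lambda>x. \<gamma> (vector [T x $ 1, T x $ 2]))"
    using smooth_imp_continuous[OF \<gamma>]
    by (rule continuous_on_compose2) (auto intro: continuous_on_vector_2 contT)
  show ?thesis
  proof (intro exI[of _ "r / 2"] conjI exI[of _ v] ballI)
    show "0 < r / 2" using r by simp
    fix x t assume x: "x \<in> \<Omega> \<inter> ball p (r / 2)" and t: "t \<in> {0..1::real}"
    then have "x \<in> \<Omega> \<inter> ball p r" using r by auto
    then have "T x $ 3 > \<gamma> (vector [T x $ 1, T x $ 2])" unfolding eq by simp
    moreover have "t * (r / 4) \<ge> 0" using t r by simp
    moreover have "x + t *\<^sub>R v \<in> ball p r" using bl x t by auto
    ultimately have "x + t *\<^sub>R v \<in> \<Omega> \<inter> ball p r" unfolding eq by (simp add: c1)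
    then show "x + t *\<^sub>R v \<in> \<Omega>" by simp
  next
    fix x assume x: "x \<in> closure (\<Omega> \<inter> ball p (r / 2))"
    have "closure (\<Omega> \<inter> ball p (r / 2)) \<subseteq> {x. \<gamma> (vector [T x $ 1, T x $ 2]) \<le> T x $ 3}"
    proof (rule closure_minimal)
      have "\<Omega> \<inter> ball p (r / 2) \<subseteq> \<Omega> \<inter> ball p r" using r by auto
      then show "\<Omega> \<inter> ball p (r / 2) \<subseteq> {x. \<gamma> (vector [T x $ 1, T x $ 2]) \<le> T x $ 3}"
        unfolding eq by (auto intro: less_imp_le)
      show "closed {x. \<gamma> (vector [T x $ 1, T x $ 2]) \<le> T x $ 3}"
        by (intro closed_Collect_le cont contT)
    qed
    with x have "\<gamma> (vector [T x $ 1, T x $ 2]) \<le> T x $ 3" by auto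
    moreover have "closure (\<Omega> \<inter> ball p (r / 2)) \<subseteq> cball p (r / 2)"
      by (rule closure_minimal) auto
    then have "x + 1 *\<^sub>R v \<in> ball p r" using x by (intro bl) auto
    ultimately have "x + 1 *\<^sub>R v \<in> \<Omega> \<inter> ball p r"
      unfolding eq using c1[of x 1] r by simp
    then show "x + v \<in> \<Omega>" by simp
  qed
qed

text \<open>On Z the integrand |u - c|^2 equals c^2, so c^2 m is bounded by the Poincare integral;
  then c is removed by the triangle inequality. Only m enters C, so Z may vary with u.\<close>

lemma poincare_on_vanishing:
  fixes \<Omega> :: "'a::euclidean_space set"
  assumes P: "poincare_on \<Omega> \<Omega>" and \<Omega>: "open \<Omega>" "bounded \<Omega>" and m: "m > 0"
  obtains C where "C > 0" "\<And>u G Z. borel_weak_gradient \<Omega> u G \<Longrightarrow> Z \<in> sets borel \<Longrightarrow> Z \<subseteq> \<Omega> \<Longrightarrow>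
     ennreal m \<le> emeasure lborel Z \<Longrightarrow> AE x in lborel. x \<in> Z \<longrightarrow> u x = 0 \<Longrightarrow>
     (\<integral>\<^sup>+x\<in>\<Omega>. ennreal ((u x)\<^sup>2) \<partial>lborel) \<le> ennreal C * (\<integral>\<^sup>+x. ennreal ((norm (G x))\<^sup>2) \<partial>lborel)"
proof -
  obtain C where C: "C \<ge> 0" "\<And>u G. borel_weak_gradient \<Omega> u G \<Longrightarrow>
     (\<exists>c. (\<integral>\<^sup>+x\<in>\<Omega>. ennreal ((u x - c)\<^sup>2) \<partial>lborel) \<le>
       ennreal C * (\<integral>\<^sup>+x. ennreal ((norm (G x))\<^sup>2) \<partial>lborel))"
    using P unfolding poincare_on_def by blast
  have [measurable]: "\<Omega> \<in> sets borel" using \<Omega> by simp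
  define M where "M = measure lborel \<Omega>"
  have eM: "emeasure lborel \<Omega> = ennreal M" unfolding M_def
    using emeasure_lborel_bounded_finite[OF \<Omega>(2)] by (intro emeasure_eq_ennreal_measure) auto
  have M: "M \<ge> 0" by (simp add: M_def)
  define q where "q = C / m"
  have q: "q \<ge> 0" using C m by (simp add: q_def)
  \<comment> \<open>The summand 1 makes the constant strictly positive even if \<open>C\<close> is
    0.\<close>
  define D where "D = 1 + (2 * C + 2 * (q * M))"
  show ?thesis
  proof (rule that[of D])
    show "D > 0" using C q M by (auto simp: D_def intro: add_pos_nonneg)
    fix u :: "'a \<Rightarrow> real" and G Z
    assume W: "borel_weak_gradient \<Omega> u G" and [measurable]: "Z \<in> sets borel" and Z: "Z \<subseteq> \<Omega>"
      "ennreal m \<le> emeasure lborel Z" and z: "AE x in lborel. x \<in> Z \<longrightarrow> u x = 0"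
    have [measurable]: "u \<in> borel_measurable borel"
      using W by (auto simp: borel_weak_gradient_def)
    let ?I = "\<integral>\<^sup>+x. ennreal ((norm (G x))\<^sup>2) \<partial>lborel"
    obtain c where c: "(\<integral>\<^sup>+x\<in>\<Omega>. ennreal ((u x - c)\<^sup>2) \<partial>lborel) \<le> ennreal C * ?I"
      using C(2)[OF W] by blast
    have "ennreal (c\<^sup>2) * ennreal m \<le> ennreal (c\<^sup>2) * emeasure lborel Z"
      using Z(2) by (rule mult_left_mono) simp
    also have "\<dots> = (\<integral>\<^sup>+x\<in>Z. ennreal (c\<^sup>2) \<partial>lborel)"
      by (simp add: nn_integral_cmult)
    also have "\<dots> \<le> (\<integral>\<^sup>+x\<in>\<Omega>. ennreal ((u x - c)\<^sup>2) \<partial>lborel)"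
      using z Z(1) by (intro nn_integral_mono_AE) (auto elim!: eventually_mono split: split_indicator)
    also note c
    finally have "ennreal (1 / m) * (ennreal (c\<^sup>2) * ennreal m) \<le> ennreal (1 / m) * (ennreal C * ?I)"
      by (rule mult_left_mono) simp
    also have "ennreal (1 / m) * (ennreal (c\<^sup>2) * ennreal m) = ennreal (c\<^sup>2)"
      using m by (simp flip: ennreal_mult' ennreal_mult'')
    also have "ennreal (1 / m) * (ennreal C * ?I) = ennreal q * ?I"
      using m C by (simp add: q_def mult.assoc[symmetric] flip: ennreal_mult' ennreal_mult'')
    finally have c2: "ennreal (c\<^sup>2) \<le> ennreal q * ?I" .
    have "(\<integral>\<^sup>+x\<in>\<Omega>. ennreal ((u x)\<^sup>2) \<partial>lborel) \<le>
        2 * (\<integral>\<^sup>+x\<in>\<Omega>. ennreal ((u x - c)\<^sup>2) \<partial>lborel) + 2 * (\<integral>\<^sup>+x\<in>\<Omega>. ennreal ((c - 0)\<^sup>2) \<partial>lborel)"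
      using nn_integral_square_diff_triangle[of u lborel "\<lambda>x. c" \<Omega> 0] by simp
    also have "(\<integral>\<^sup>+x\<in>\<Omega>. ennreal ((c - 0)\<^sup>2) \<partial>lborel) = ennreal (c\<^sup>2) * ennreal M"
      by (simp add: nn_integral_cmult eM)
    also have "2 * (\<integral>\<^sup>+x\<in>\<Omega>. ennreal ((u x - c)\<^sup>2) \<partial>lborel) + 2 * (ennreal (c\<^sup>2) * ennreal M) \<le>
        2 * (ennreal C * ?I) + 2 * (ennreal q * ?I * ennreal M)"
      by (intro add_mono mult_left_mono mult_right_mono c c2) auto
    also have "\<dots> = ennreal (2 * C + 2 * (q * M)) * ?I"
    proof -
      have "ennreal (2 * C + 2 * (q * M)) = 2 * ennreal C + 2 * (ennreal q * ennreal M)"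
        using C q M by (simp add: ennreal_mult' ennreal_mult'')
      then show ?thesis by (simp only: distrib_right distrib_left ac_simps)
    qed
    also have "\<dots> \<le> ennreal D * ?I"
      by (intro mult_right_mono ennreal_leI) (auto simp: D_def)
    finally show "(\<integral>\<^sup>+x\<in>\<Omega>. ennreal ((u x)\<^sup>2) \<partial>lborel) \<le> ennreal D * ?I" .
  qed
qed

section \<open>Transfer to Sobolev functions\<close>

lemma Lp_2_iff:
  "u \<in> Lp 2 \<Omega> \<longleftrightarrow> u \<in> borel_measurable (lebesgue_on \<Omega>) \<and> integrable (lebesgue_on \<Omega>) (\<lambda>x. (norm (u x))\<^sup>2)"
proof -
  have "norm (u x) powr 2 = (norm (u x))\<^sup>2" for x
    by (cases "u x = 0") (simp_all add: powr_numeral)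
  then show ?thesis by (simp add: Lp_def)
qed

lemma Lp_norm_2: "Lp_norm 2 \<Omega> u = sqrt (\<integral>x. (norm (u x))\<^sup>2 \<partial>lebesgue_on \<Omega>)"
proof -
  have "norm (u x) powr 2 = (norm (u x))\<^sup>2" for x
    by (cases "u x = 0") (simp_all add: powr_numeral)
  then show ?thesis by (simp add: Lp_norm_def powr_half_sqrt)
qed

lemma Lp_norm_2_nonneg: "0 \<le> Lp_norm 2 \<Omega> u"
  by (simp add: Lp_norm_2)

lemma Lp_norm_2_squared: "(Lp_norm 2 \<Omega> u)\<^sup>2 = (\<integral>x. (norm (u x))\<^sup>2 \<partial>lebesgue_on \<Omega>)"
  by (simp add: Lp_norm_2)

lemma ennreal_Lp_norm_2_squared:
  "u \<in> Lp 2 \<Omega> \<Longrightarrow> ennreal ((Lp_norm 2 \<Omega> u)\<^sup>2) = (\<integral>\<^sup>+x. ennreal ((norm (u x))\<^sup>2) \<partial>lebesgue_on \<Omega>)"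
  unfolding Lp_norm_2_squared Lp_2_iff by (subst nn_integral_eq_integral) auto

text \<open>The scalar fact that a function measurable for the completion agrees almost everywhere
  with a Borel one is applied to each coordinate of the extension by zero, and the finitely many
  exceptional null sets are united.\<close>

lemma borel_representative:
  fixes u :: "'a::euclidean_space \<Rightarrow> 'b::euclidean_space"
  assumes "u \<in> borel_measurable (lebesgue_on \<Omega>)" "\<Omega> \<in> sets lebesgue"
  obtains u' where "u' \<in> borel_measurable borel" "AE x in lborel. u' x = (if x \<in> \<Omega> then u x else 0)"
proof -
  have m: "(\<lambda>x. if x \<in> \<Omega> then u x else 0) \<in> borel_measurable lebesgue"
    using borel_measurable_if[OF assms(2), of u] assms(1) by simp
  have "\<exists>g\<in>borel_measurable lborel. AE x in lborel. (if x \<in> \<Omega> then u x else 0) \<bullet> b = g x" for b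
    by (rule completion_ex_borel_measurable_real) (use m in measurable)
  then have "\<forall>b. \<exists>g. g \<in> borel_measurable lborel \<and> (AE x in lborel. (if x \<in> \<Omega> then u x else 0) \<bullet> b = g x)"
    by (simp only: Bex_def) blast
  from choice[OF this] obtain g where "\<And>b. g b \<in> borel_measurable lborel"
    and g2: "\<And>b. AE x in lborel. (if x \<in> \<Omega> then u x else 0) \<bullet> b = g b x"
    by blast
  then have g1: "\<And>b. g b \<in> borel_measurable borel" by simp
  show ?thesis
  proof (rule that[of "\<lambda>x. \<Sum>b\<in>Basis. g b x *\<^sub>R b"])
    show "(\<lambda>x. \<Sum>b\<in>Basis. g b x *\<^sub>R b) \<in> borel_measurable borel" using g1 by measurable
    have "AE x in lborel. \<forall>b\<in>Basis. (if x \<in> \<Omega> then u x else 0) \<bullet> b = g b x"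
      using g2 by (intro AE_finite_allI) auto
    then show "AE x in lborel. (\<Sum>b\<in>Basis. g b x *\<^sub>R b) = (if x \<in> \<Omega> then u x else 0)"
    proof eventually_elim
      case (elim x)
      then have "(\<Sum>b\<in>Basis. g b x *\<^sub>R b) = (\<Sum>b\<in>Basis. ((if x \<in> \<Omega> then u x else 0) \<bullet> b) *\<^sub>R b)"
        by (intro sum.cong) auto
      then show ?case by (simp only: euclidean_representation)
    qed
  qed
qed

text \<open>F 0 = 0 makes the integrand vanish off \<Omega>, where the representative is zero almost
  everywhere; hence the integrals over \<Omega> and over the whole space agree.\<close>

lemma nn_integral_lebesgue_on_representative:
  assumes "\<Omega> \<in> sets lebesgue" "AE x in lborel. u' x = (if x \<in> \<Omega> then u x else 0)" "F 0 = 0"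
  shows "(\<integral>\<^sup>+x. F (u x) \<partial>lebesgue_on \<Omega>) = (\<integral>\<^sup>+x. F (u' x) \<partial>lborel)"
proof -
  have "(\<integral>\<^sup>+x. F (u x) \<partial>lebesgue_on \<Omega>) = (\<integral>\<^sup>+x. F (u x) * indicator \<Omega> x \<partial>lebesgue)"
    using assms(1) by (subst nn_integral_restrict_space) auto
  also have "\<dots> = (\<integral>\<^sup>+x. F (u' x) \<partial>lebesgue)"
    using AE_completion[OF assms(2)] assms(3)
    by (intro nn_integral_cong_AE) (auto elim!: eventually_mono split: split_indicator)
  finally show ?thesis by (simp add: nn_integral_completion)
qed

lemma integral_lebesgue_on_representative:
  fixes F :: "'a::euclidean_space \<Rightarrow> 'b::euclidean_space \<Rightarrow> real"
  assumes "\<Omega> \<in> sets lebesgue" "AE x in lborel. u' x = (if x \<in> \<Omega> then u x else 0)" "\<And>x. F x 0 = 0"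
    and F: "(\<lambda>x. F x (u' x)) \<in> borel_measurable borel" "(\<lambda>x. F x (u x)) \<in> borel_measurable (lebesgue_on \<Omega>)"
  shows "(\<integral>x. F x (u x) \<partial>lebesgue_on \<Omega>) = (\<integral>x. F x (u' x) \<partial>lborel)"
proof -
  have AE: "AE x in lebesgue. F x (u' x) = indicator \<Omega> x *\<^sub>R F x (u x)"
    using AE_completion[OF assms(2)] assms(3) by (auto elim!: eventually_mono split: split_indicator)
  have m: "(\<lambda>x. F x (u' x)) \<in> borel_measurable lebesgue"
    using F by (auto intro: measurable_completion)
  have "(\<integral>x. F x (u x) \<partial>lebesgue_on \<Omega>) = (\<integral>x. indicator \<Omega> x *\<^sub>R F x (u x) \<partial>lebesgue)"
    using assms(1) by (subst integral_restrict_space) auto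
  also have "\<dots> = (\<integral>x. F x (u' x) \<partial>lebesgue)"
    by (rule integral_cong_AE[symmetric]) (use m AE F(2) assms(1) in \<open>auto simp: borel_measurable_restrict_space_iff\<close>)
  also have "\<dots> = (\<integral>x. F x (u' x) \<partial>lborel)"
    using F by (intro integral_completion) auto
  finally show ?thesis .
qed

lemma integrable_representative:
  fixes u' :: "'a::euclidean_space \<Rightarrow> 'b::euclidean_space"
  assumes \<Omega>: "open \<Omega>" "bounded \<Omega>" and u: "u \<in> Lp 2 \<Omega>" and [measurable]: "u' \<in> borel_measurable borel"
    and AE: "AE x in lborel. u' x = (if x \<in> \<Omega> then u x else 0)"
  shows "integrable lborel u'"
proof -
  have [measurable]: "\<Omega> \<in> sets borel" using \<Omega> by simp
  have "(\<integral>\<^sup>+x. ennreal ((norm (u' x))\<^sup>2) \<partial>lborel) = ennreal ((Lp_norm 2 \<Omega> u)\<^sup>2)"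
    unfolding ennreal_Lp_norm_2_squared[OF u]
    using \<Omega> AE by (intro nn_integral_lebesgue_on_representative[symmetric]) auto
  then have 2: "integrable lborel (\<lambda>x. (norm (u' x))\<^sup>2)"
    by (intro integrableI_nonneg) auto
  have 1: "integrable lborel (indicator \<Omega> :: 'a \<Rightarrow> real)"
    using emeasure_lborel_bounded_finite[OF \<Omega>(2)] by (simp add: integrable_indicator_iff)
  show ?thesis
  proof (rule Bochner_Integration.integrable_bound[OF Bochner_Integration.integrable_add[OF 1 2]])
    show "AE x in lborel. norm (u' x) \<le> norm (indicator \<Omega> x + (norm (u' x))\<^sup>2)"
      using AE
    proof eventually_elim
      case (elim x)
      \<comment> \<open>From s \<le> 1 + s^2: on a bounded set L^2 functions are integrable, and off
        \<Omega> the representative vanishes almost everywhere.\<close>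
      have "norm (u' x) \<le> 1 + (norm (u' x))\<^sup>2"
        using zero_le_power2[of "norm (u' x) - 1"] zero_le_power2[of "norm (u' x)"]
        using norm_ge_zero[of "u' x"] unfolding power2_diff power_one mult_1_right by linarith
      with elim show ?case by (cases "x \<in> \<Omega>") auto
    qed
  qed measurable
qed

lemma H1_borel_representative:
  fixes \<Omega> :: "'a::euclidean_space set"
  assumes \<Omega>: "open \<Omega>" "bounded \<Omega>" and u: "u \<in> Lp 2 \<Omega>" and G: "G \<in> Lp 2 \<Omega>"
    and wg: "is_weak_gradient \<Omega> u G"
  obtains u' G' where "borel_weak_gradient \<Omega> u' G'"
    "AE x in lborel. u' x = (if x \<in> \<Omega> then u x else 0)"
    "AE x in lborel. G' x = (if x \<in> \<Omega> then G x else 0)"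
proof -
  have \<Omega>l: "\<Omega> \<in> sets lebesgue" using \<Omega> by auto
  obtain u' where u': "u' \<in> borel_measurable borel" "AE x in lborel. u' x = (if x \<in> \<Omega> then u x else 0)"
    using u \<Omega>l unfolding Lp_2_iff by (blast elim: borel_representative)
  obtain G' where G': "G' \<in> borel_measurable borel" "AE x in lborel. G' x = (if x \<in> \<Omega> then G x else 0)"
    using G \<Omega>l unfolding Lp_2_iff by (blast elim: borel_representative)
  note [measurable] = u'(1) G'(1)
  have "(\<integral>x. u' x * frechet_derivative \<phi> (at x) b \<partial>lborel) = - (\<integral>x. (G' x \<bullet> b) * \<phi> x \<partial>lborel)"
    if \<phi>: "test_function \<Omega> \<phi>" and b: "b \<in> Basis" for \<phi> b
  proof -
    have s: "smooth \<phi>" using \<phi> by (auto simp: test_function_def)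
    have [measurable]: "(\<lambda>x. frechet_derivative \<phi> (at x) b) \<in> borel_measurable borel" "\<phi> \<in> borel_measurable borel"
      using s smooth_frechet_derivative(3) smooth_imp_continuous
      by (auto intro: borel_measurable_continuous_onI)
    have [measurable]: "u \<in> borel_measurable (lebesgue_on \<Omega>)" "G \<in> borel_measurable (lebesgue_on \<Omega>)"
      using u G by (auto simp: Lp_2_iff)
    have [measurable]: "w \<in> borel_measurable (lebesgue_on \<Omega>)" if "w \<in> borel_measurable borel" for w :: "'a \<Rightarrow> real"
      using that by (intro measurable_restrict_space1 measurable_completion) simp
    have "(\<integral>x. u x * frechet_derivative \<phi> (at x) b \<partial>lebesgue_on \<Omega>) =
        (\<integral>x. u' x * frechet_derivative \<phi> (at x) b \<partial>lborel)"
      using integral_lebesgue_on_representative[OF \<Omega>l u'(2), of "\<lambda>x y. y * frechet_derivative \<phi> (at x) b"] by simp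
    moreover have "(\<integral>x. (G x \<bullet> b) * \<phi> x \<partial>lebesgue_on \<Omega>) = (\<integral>x. (G' x \<bullet> b) * \<phi> x \<partial>lborel)"
      using integral_lebesgue_on_representative[OF \<Omega>l G'(2), of "\<lambda>x y. (y \<bullet> b) * \<phi> x"] by simp
    ultimately show ?thesis
      using wg \<phi> b unfolding is_weak_gradient_def by simp
  qed
  then have "borel_weak_gradient \<Omega> u' G'"
    unfolding borel_weak_gradient_def
    using integrable_representative[OF \<Omega> u u'] integrable_representative[OF \<Omega> G G'] by blast
  then show ?thesis using u'(2) G'(2) by (rule that)
qed

lemma weak_grad_works:
  assumes "u \<in> H1 \<Omega>"
  shows "weak_grad \<Omega> u \<in> Lp 2 \<Omega>" "is_weak_gradient \<Omega> u (weak_grad \<Omega> u)" "u \<in> Lp 2 \<Omega>"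
proof -
  have "\<exists>G. G \<in> Lp 2 \<Omega> \<and> is_weak_gradient \<Omega> u G" and "u \<in> Lp 2 \<Omega>"
    using assms by (auto simp: H1_def)
  from someI_ex[OF this(1)] this(2) show "weak_grad \<Omega> u \<in> Lp 2 \<Omega>" "is_weak_gradient \<Omega> u (weak_grad \<Omega> u)" "u \<in> Lp 2 \<Omega>"
    by (auto simp: weak_grad_def)
qed

text \<open>The constant is fixed by \<Omega> and m before u and Z appear; this order of quantifiers
  is the source of uniformity in \<rho> and t.\<close>

lemma poincare_vanishing_H1:
  assumes \<Omega>: "smooth_bounded_domain \<Omega>" and m: "m > 0"
  obtains C where "C > 0" "\<And>u Z. u \<in> H1 \<Omega> \<Longrightarrow> Z \<in> sets lebesgue \<Longrightarrow> Z \<subseteq> \<Omega> \<Longrightarrow>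
      ennreal m \<le> emeasure lebesgue Z \<Longrightarrow> AE x in lebesgue_on \<Omega>. x \<in> Z \<longrightarrow> u x = 0 \<Longrightarrow>
      Lp_norm 2 \<Omega> u \<le> C * Lp_norm 2 \<Omega> (weak_grad \<Omega> u)"
proof -
  have op: "open \<Omega>" and co: "connected \<Omega>" and bd: "bounded \<Omega>" and sb: "smooth_boundary \<Omega>"
    using \<Omega> by (auto simp: smooth_bounded_domain_def)
  have \<Omega>l: "\<Omega> \<in> sets lebesgue" using op by auto
  have "poincare_on \<Omega> \<Omega>"
    by (rule poincare_on_domain[OF op co bd smooth_boundary_inward_shift[OF sb]])
  then show ?thesis
  proof (rule poincare_on_vanishing[OF _ op bd m])
    fix C assume C: "C > 0" "\<And>u G Z. borel_weak_gradient \<Omega> u G \<Longrightarrow> Z \<in> sets borel \<Longrightarrow> Z \<subseteq> \<Omega> \<Longrightarrow>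
     ennreal m \<le> emeasure lborel Z \<Longrightarrow> AE x in lborel. x \<in> Z \<longrightarrow> u x = 0 \<Longrightarrow>
     (\<integral>\<^sup>+x\<in>\<Omega>. ennreal ((u x)\<^sup>2) \<partial>lborel) \<le> ennreal C * (\<integral>\<^sup>+x. ennreal ((norm (G x))\<^sup>2) \<partial>lborel)"
  show ?thesis
  proof (rule that[of "sqrt C"])
    show "sqrt C > 0" using C(1) by simp
    fix u Z assume u: "u \<in> H1 \<Omega>" and Z: "Z \<in> sets lebesgue" "Z \<subseteq> \<Omega>" "ennreal m \<le> emeasure lebesgue Z"
      and z: "AE x in lebesgue_on \<Omega>. x \<in> Z \<longrightarrow> u x = 0"
    note wg = weak_grad_works[OF u]
    obtain u' G' where W: "borel_weak_gradient \<Omega> u' G'"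
      and u': "AE x in lborel. u' x = (if x \<in> \<Omega> then u x else 0)"
      and G': "AE x in lborel. G' x = (if x \<in> \<Omega> then weak_grad \<Omega> u x else 0)"
      using H1_borel_representative[OF op bd wg(3,1,2)] by blast
    \<comment> \<open>Z is only Lebesgue measurable; its main part is a Borel subset of the same
      measure.\<close>
    define Y where "Y = main_part lborel Z"
    have Zc: "Z \<in> sets (completion lborel)" using Z(1) .
    have YZ: "Y \<subseteq> Z" using main_part_null_part_Un[OF Zc] by (auto simp: Y_def)
    have Y: "Y \<in> sets borel" using main_part_sets[OF Zc] by (simp add: Y_def)
    have "AE x in lebesgue. x \<in> \<Omega> \<longrightarrow> x \<in> Z \<longrightarrow> u x = 0"
      using z \<Omega>l by (subst (asm) AE_restrict_space_iff) auto
    then have "AE x in lborel. x \<in> \<Omega> \<longrightarrow> x \<in> Z \<longrightarrow> u x = 0"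
      by (simp add: AE_completion_iff)
    then have AE0: "AE x in lborel. x \<in> Y \<longrightarrow> u' x = 0"
      using u' by eventually_elim (use YZ Z(2) in auto)
    have "ennreal ((Lp_norm 2 \<Omega> u)\<^sup>2) = (\<integral>\<^sup>+x. ennreal ((norm (u' x))\<^sup>2) \<partial>lborel)"
      unfolding ennreal_Lp_norm_2_squared[OF wg(3)]
      using \<Omega>l u' by (intro nn_integral_lebesgue_on_representative) auto
    also have "\<dots> = (\<integral>\<^sup>+x\<in>\<Omega>. ennreal ((u' x)\<^sup>2) \<partial>lborel)"
      using u' by (intro nn_integral_cong_AE) (auto elim!: eventually_mono split: split_indicator)
    also have "\<dots> \<le> ennreal C * (\<integral>\<^sup>+x. ennreal ((norm (G' x))\<^sup>2) \<partial>lborel)"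
      using Z(2,3) YZ emeasure_completion[OF Zc] by (intro C(2)[OF W Y _ _ AE0]) (auto simp: Y_def)
    also have "(\<integral>\<^sup>+x. ennreal ((norm (G' x))\<^sup>2) \<partial>lborel) = ennreal ((Lp_norm 2 \<Omega> (weak_grad \<Omega> u))\<^sup>2)"
      unfolding ennreal_Lp_norm_2_squared[OF wg(1)]
      using \<Omega>l G' by (intro nn_integral_lebesgue_on_representative[symmetric]) auto
    finally have "(Lp_norm 2 \<Omega> u)\<^sup>2 \<le> C * (Lp_norm 2 \<Omega> (weak_grad \<Omega> u))\<^sup>2"
      using C(1) by (simp flip: ennreal_mult')
    then have "sqrt ((Lp_norm 2 \<Omega> u)\<^sup>2) \<le> sqrt (C * (Lp_norm 2 \<Omega> (weak_grad \<Omega> u))\<^sup>2)"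
      by (rule real_sqrt_le_mono)
    then show "Lp_norm 2 \<Omega> u \<le> sqrt C * Lp_norm 2 \<Omega> (weak_grad \<Omega> u)"
      by (simp add: real_sqrt_mult Lp_norm_2_nonneg)
  qed
qed
qed

section \<open>Closedness of the Sobolev space\<close>

text \<open>Along a fast subsequence the increments are almost everywhere dominated by a geometric
  series, so it converges pointwise. Fatou then bounds the distance of every original
  \<open>G n\<close> to the limit by the same c n.\<close>

lemma L2_Cauchy_limit:
  fixes G :: "nat \<Rightarrow> 'a \<Rightarrow> 'b::euclidean_space"
  assumes [measurable]: "\<And>n. G n \<in> borel_measurable M"
    and c: "\<And>n m. n \<le> m \<Longrightarrow> (\<integral>\<^sup>+x. ennreal ((norm (G n x - G m x))\<^sup>2) \<partial>M) \<le> ennreal (c n)"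
    and c0: "c \<longlonglongrightarrow> 0"
  obtains H where "H \<in> borel_measurable M"
    "\<And>n. (\<integral>\<^sup>+x. ennreal ((norm (G n x - H x))\<^sup>2) \<partial>M) \<le> ennreal (c n)"
proof -
  \<comment> \<open>The rate 1/8 leaves room for the weight 4^j: the weighted increments have
    integrals at most 2^-j, while the weight forces the pointwise decay 2^-j of their norms.\<close>
  have "\<exists>N. \<forall>n\<ge>N. c n \<le> (1/8) ^ j" for j
  proof -
    have "eventually (\<lambda>n. c n < (1/8) ^ j) sequentially"
      by (rule order_tendstoD(2)[OF c0]) simp
    then show ?thesis unfolding eventually_sequentially by (meson less_imp_le)
  qed
  then obtain N where N: "\<And>j n. n \<ge> N j \<Longrightarrow> c n \<le> (1/8) ^ j" by metis
  \<comment> \<open>The partial sum makes k monotone and at least \<open>N j\<close>; the extra j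
    makes it unbounded, as needed when n is fixed and j grows.\<close>
  define k where "k j = (\<Sum>i\<le>j. N i) + j" for j
  have kN: "N j \<le> k j" for j
    using member_le_sum[of j "{..j}" N] by (simp add: k_def trans_le_add1)
  have kS: "k j \<le> k (Suc j)" for j by (simp add: k_def)
  have kj: "j \<le> k j" for j by (simp add: k_def)
  define D where "D j x = G (k (Suc j)) x - G (k j) x" for j x
  have [measurable]: "D j \<in> borel_measurable M" for j unfolding D_def by measurable
  have "(\<integral>\<^sup>+x. (\<Sum>j. ennreal (4 ^ j * (norm (D j x))\<^sup>2)) \<partial>M) =
      (\<Sum>j. \<integral>\<^sup>+x. ennreal (4 ^ j * (norm (D j x))\<^sup>2) \<partial>M)"
    by (rule nn_integral_suminf) measurable
  also have "\<dots> \<le> (\<Sum>j. ennreal ((1/2) ^ j))"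
  proof (intro suminf_le allI summableI)
    fix j
    have "(\<integral>\<^sup>+x. ennreal (4 ^ j * (norm (D j x))\<^sup>2) \<partial>M) = ennreal (4 ^ j) * (\<integral>\<^sup>+x. ennreal ((norm (D j x))\<^sup>2) \<partial>M)"
      by (subst nn_integral_cmult[symmetric]) (auto simp: ennreal_mult')
    also have "(\<integral>\<^sup>+x. ennreal ((norm (D j x))\<^sup>2) \<partial>M) \<le> ennreal (c (k j))"
      using c[OF kS] unfolding D_def by (simp add: norm_minus_commute)
    also have "\<dots> \<le> ennreal ((1/8) ^ j)" using N[OF kN] by (rule ennreal_leI)
    finally have "(\<integral>\<^sup>+x. ennreal (4 ^ j * (norm (D j x))\<^sup>2) \<partial>M) \<le> ennreal (4 ^ j) * ennreal ((1/8) ^ j)"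
      by (simp add: mult_left_mono)
    also have "\<dots> = ennreal (4 ^ j * (1/8) ^ j)"
      by (rule ennreal_mult'[symmetric]) simp
    also have "(4::real) ^ j * (1/8) ^ j = (1/2) ^ j"
      by (simp flip: power_mult_distrib)
    finally show "(\<integral>\<^sup>+x. ennreal (4 ^ j * (norm (D j x))\<^sup>2) \<partial>M) \<le> ennreal ((1/2) ^ j)" .
  qed
  also have "\<dots> = ennreal (\<Sum>j. (1/2) ^ j)"
    by (rule suminf_ennreal2) (auto intro: summable_geometric)
  finally have fin: "(\<integral>\<^sup>+x. (\<Sum>j. ennreal (4 ^ j * (norm (D j x))\<^sup>2)) \<partial>M) \<noteq> \<infinity>"
    by (auto simp: top_unique)
  define S where "S x = (\<Sum>j. ennreal (4 ^ j * (norm (D j x))\<^sup>2))" for x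
  have "AE x in M. S x \<noteq> \<infinity>"
    using fin unfolding S_def by (intro nn_integral_noteq_infinite) measurable
  then have conv: "AE x in M. convergent (\<lambda>j. G (k j) x)"
  proof eventually_elim
    case (elim x)
    define s where "s = enn2real (S x)"
    have s: "s \<ge> 0" "S x = ennreal s" using elim by (simp_all add: s_def less_top)
    have bnd: "norm (D j x) \<le> sqrt s * (1/2) ^ j" for j
    proof -
      have "ennreal (4 ^ j * (norm (D j x))\<^sup>2) \<le> S x"
      proof -
        define a where "a j = ennreal (4 ^ j * (norm (D j x))\<^sup>2)" for j
        have "sum a {j} \<le> suminf a" by (intro sum_le_suminf summableI) auto
        then show ?thesis by (simp add: a_def[abs_def] S_def)
      qed
      then have "4 ^ j * (norm (D j x))\<^sup>2 \<le> s" unfolding s(2) using s(1) by simp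
      moreover have "(4::real) ^ j = (2 ^ j)\<^sup>2"
        by (simp add: power2_eq_square flip: power_mult_distrib)
      ultimately have "(2 ^ j * norm (D j x))\<^sup>2 \<le> s" by (simp add: power_mult_distrib)
      then have "2 ^ j * norm (D j x) \<le> sqrt s" by (rule real_le_rsqrt)
      then show ?thesis by (simp add: power_one_over field_simps)
    qed
    have "summable (\<lambda>j. D j x)"
    proof (rule summable_comparison_test)
      show "\<exists>N. \<forall>n\<ge>N. norm (D n x) \<le> sqrt s * (1/2) ^ n" using bnd by blast
      show "summable (\<lambda>n. sqrt s * (1/2) ^ n)" by (intro summable_mult summable_geometric) simp
    qed
    then have "(\<lambda>n. \<Sum>j<n. D j x) \<longlonglongrightarrow> (\<Sum>j. D j x)" by (rule summable_LIMSEQ)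
    moreover have "(\<Sum>j<n. D j x) = G (k n) x - G (k 0) x" for n
      unfolding D_def by (rule sum_lessThan_telescope)
    ultimately have "(\<lambda>n. G (k n) x - G (k 0) x + G (k 0) x) \<longlonglongrightarrow> (\<Sum>j. D j x) + G (k 0) x"
      by (intro tendsto_add) auto
    then show ?case by (auto simp: convergent_def)
  qed
  \<comment> \<open>On the null set without convergence the value of \<open>lim\<close> is
    arbitrary; measurability holds regardless.\<close>
  define H where "H x = lim (\<lambda>j. G (k j) x)" for x
  have [measurable]: "H \<in> borel_measurable M"
    unfolding H_def by (rule borel_measurable_lim_metric) measurable
  show ?thesis
  proof (rule that[of H])
    fix n
    have "(\<integral>\<^sup>+x. ennreal ((norm (G n x - H x))\<^sup>2) \<partial>M) =
        (\<integral>\<^sup>+x. liminf (\<lambda>j. ennreal ((norm (G n x - G (k j) x))\<^sup>2)) \<partial>M)"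
    proof (rule nn_integral_cong_AE)
      show "AE x in M. ennreal ((norm (G n x - H x))\<^sup>2) = liminf (\<lambda>j. ennreal ((norm (G n x - G (k j) x))\<^sup>2))"
        using conv
      proof eventually_elim
        case (elim x)
        then have "(\<lambda>j. G (k j) x) \<longlonglongrightarrow> H x" unfolding H_def by (simp add: convergent_LIMSEQ_iff)
        then have "(\<lambda>j. ennreal ((norm (G n x - G (k j) x))\<^sup>2)) \<longlonglongrightarrow> ennreal ((norm (G n x - H x))\<^sup>2)"
          by (intro tendsto_ennrealI tendsto_intros)
        from lim_imp_Liminf[OF _ this] show ?case by simp
      qed
    qed
    also have "\<dots> \<le> liminf (\<lambda>j. \<integral>\<^sup>+x. ennreal ((norm (G n x - G (k j) x))\<^sup>2) \<partial>M)"
      by (rule nn_integral_liminf) measurable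
    also have "\<dots> \<le> liminf (\<lambda>j::nat. ennreal (c n))"
      by (rule Liminf_mono) (auto simp: eventually_sequentially intro!: exI[of _ n] c order_trans[OF _ kj])
    finally show "(\<integral>\<^sup>+x. ennreal ((norm (G n x - H x))\<^sup>2) \<partial>M) \<le> ennreal (c n)"
      by (simp add: Liminf_const)
  qed measurable
qed

section \<open>Linear structure, parallelogram law and pairings in L^2\<close>

lemma Lp_2_add:
  assumes "u \<in> Lp 2 \<Omega>" "w \<in> Lp 2 \<Omega>" shows "(\<lambda>x. u x + w x) \<in> Lp 2 \<Omega>"
proof -
  have [measurable]: "u \<in> borel_measurable (lebesgue_on \<Omega>)" "w \<in> borel_measurable (lebesgue_on \<Omega>)"
    and i: "integrable (lebesgue_on \<Omega>) (\<lambda>x. 2 * (norm (u x))\<^sup>2 + 2 * (norm (w x))\<^sup>2)"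
    using assms unfolding Lp_2_iff by auto
  have "integrable (lebesgue_on \<Omega>) (\<lambda>x. (norm (u x + w x))\<^sup>2)"
  proof (rule Bochner_Integration.integrable_bound[OF i])
    have "(norm (u x + w x))\<^sup>2 \<le> 2 * (norm (u x))\<^sup>2 + 2 * (norm (w x))\<^sup>2" for x
    proof -
      have "(norm (u x + w x))\<^sup>2 + (norm (u x - w x))\<^sup>2 = 2 * (norm (u x))\<^sup>2 + 2 * (norm (w x))\<^sup>2"
        by (simp add: power2_norm_eq_inner inner_simps inner_commute)
      then show ?thesis by (smt (verit) zero_le_power2)
    qed
    then show "AE x in lebesgue_on \<Omega>. norm ((norm (u x + w x))\<^sup>2) \<le> norm (2 * (norm (u x))\<^sup>2 + 2 * (norm (w x))\<^sup>2)"
      by auto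
  qed measurable
  then show ?thesis by (simp add: Lp_2_iff)
qed

lemma Lp_2_scaleR: "u \<in> Lp 2 \<Omega> \<Longrightarrow> (\<lambda>x. a *\<^sub>R u x) \<in> Lp 2 \<Omega>"
  unfolding Lp_2_iff by (auto simp only: norm_scaleR power_mult_distrib intro!: integrable_mult_right borel_measurable_scaleR borel_measurable_const)

lemma Lp_2_diff: "u \<in> Lp 2 \<Omega> \<Longrightarrow> w \<in> Lp 2 \<Omega> \<Longrightarrow> (\<lambda>x. u x - w x) \<in> Lp 2 \<Omega>"
  using Lp_2_add[of u \<Omega> "\<lambda>x. (-1) *\<^sub>R w x"] Lp_2_scaleR[of w \<Omega> "-1"] by simp

text \<open>The pointwise identity of the inner product, integrated. It is written with the midpoint
  because midpoints stay in convex sets.\<close>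

lemma Lp_2_parallelogram:
  assumes "u \<in> Lp 2 \<Omega>" "w \<in> Lp 2 \<Omega>"
  shows "(Lp_norm 2 \<Omega> (\<lambda>x. u x - w x))\<^sup>2 + 4 * (Lp_norm 2 \<Omega> (\<lambda>x. (1/2) *\<^sub>R (u x + w x)))\<^sup>2 =
    2 * (Lp_norm 2 \<Omega> u)\<^sup>2 + 2 * (Lp_norm 2 \<Omega> w)\<^sup>2"
proof -
  have i: "integrable (lebesgue_on \<Omega>) (\<lambda>x. (norm (u x))\<^sup>2)" "integrable (lebesgue_on \<Omega>) (\<lambda>x. (norm (w x))\<^sup>2)"
    "integrable (lebesgue_on \<Omega>) (\<lambda>x. (norm (u x - w x))\<^sup>2)"
    "integrable (lebesgue_on \<Omega>) (\<lambda>x. (norm ((1/2) *\<^sub>R (u x + w x)))\<^sup>2)"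
    using assms Lp_2_diff[OF assms] Lp_2_scaleR[OF Lp_2_add[OF assms], of "1/2"] by (simp_all only: Lp_2_iff)
  have "(\<integral>x. (norm (u x - w x))\<^sup>2 \<partial>lebesgue_on \<Omega>) + 4 * (\<integral>x. (norm ((1/2) *\<^sub>R (u x + w x)))\<^sup>2 \<partial>lebesgue_on \<Omega>) =
      (\<integral>x. (norm (u x - w x))\<^sup>2 + 4 * (norm ((1/2) *\<^sub>R (u x + w x)))\<^sup>2 \<partial>lebesgue_on \<Omega>)"
    by (subst Bochner_Integration.integral_add[OF i(3) integrable_mult_right[OF i(4)]])
       (simp only: integral_mult_right_zero)
  also have "(\<lambda>x. (norm (u x - w x))\<^sup>2 + 4 * (norm ((1/2) *\<^sub>R (u x + w x)))\<^sup>2) =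
      (\<lambda>x. 2 * (norm (u x))\<^sup>2 + 2 * (norm (w x))\<^sup>2)"
    by (simp add: fun_eq_iff power2_norm_eq_inner inner_simps inner_commute field_simps)
  also have "(\<integral>x. 2 * (norm (u x))\<^sup>2 + 2 * (norm (w x))\<^sup>2 \<partial>lebesgue_on \<Omega>) =
      2 * (\<integral>x. (norm (u x))\<^sup>2 \<partial>lebesgue_on \<Omega>) + 2 * (\<integral>x. (norm (w x))\<^sup>2 \<partial>lebesgue_on \<Omega>)"
    by (subst Bochner_Integration.integral_add[OF integrable_mult_right[OF i(1)] integrable_mult_right[OF i(2)]])
       (simp only: integral_mult_right_zero)
  finally show ?thesis unfolding Lp_norm_2_squared .
qed

text \<open>Cauchy-Schwarz against the constant function 1, whose squared norm is the finite measure
  of \<Omega>.\<close>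

lemma Lp_2_integrable:
  fixes w :: "'a::euclidean_space \<Rightarrow> 'b::euclidean_space"
  assumes \<Omega>: "open \<Omega>" "bounded \<Omega>" and w: "w \<in> Lp 2 \<Omega>"
  shows "integrable (lebesgue_on \<Omega>) w"
    and "(\<integral>x. norm (w x) \<partial>lebesgue_on \<Omega>) \<le> sqrt (measure lebesgue \<Omega>) * Lp_norm 2 \<Omega> w"
proof -
  have [measurable]: "w \<in> borel_measurable (lebesgue_on \<Omega>)" using w by (simp add: Lp_2_iff)
  have \<Omega>l: "\<Omega> \<in> sets lebesgue" using \<Omega> by auto
  have em: "emeasure lebesgue \<Omega> = ennreal (measure lebesgue \<Omega>)"
    using emeasure_lborel_bounded_finite[OF \<Omega>(2)] \<Omega> by (intro emeasure_eq_ennreal_measure) auto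
  have "(\<integral>\<^sup>+x. ennreal (norm (w x)) * 1 \<partial>lebesgue_on \<Omega>)\<^sup>2 \<le>
      (\<integral>\<^sup>+x. (ennreal (norm (w x)))\<^sup>2 \<partial>lebesgue_on \<Omega>) * (\<integral>\<^sup>+x. 1\<^sup>2 \<partial>lebesgue_on \<Omega>)"
    by (rule Cauchy_Schwarz_nn_integral) measurable
  also have "(\<integral>\<^sup>+x. 1\<^sup>2 \<partial>lebesgue_on \<Omega>) = ennreal (measure lebesgue \<Omega>)"
    using em \<Omega>l by (simp add: emeasure_restrict_space space_restrict_space)
  also have "(\<integral>\<^sup>+x. (ennreal (norm (w x)))\<^sup>2 \<partial>lebesgue_on \<Omega>) = ennreal ((Lp_norm 2 \<Omega> w)\<^sup>2)"
    by (simp add: ennreal_Lp_norm_2_squared[OF w] ennreal_power)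
  also have "ennreal ((Lp_norm 2 \<Omega> w)\<^sup>2) * ennreal (measure lebesgue \<Omega>) =
      ennreal ((sqrt (measure lebesgue \<Omega>) * Lp_norm 2 \<Omega> w)\<^sup>2)"
    by (simp add: power_mult_distrib mult.commute flip: ennreal_mult'')
  finally have sq: "(\<integral>\<^sup>+x. ennreal (norm (w x)) \<partial>lebesgue_on \<Omega>)\<^sup>2 \<le>
      (ennreal (sqrt (measure lebesgue \<Omega>) * Lp_norm 2 \<Omega> w))\<^sup>2"
    by (simp add: ennreal_power Lp_norm_2_nonneg)
  have le: "(\<integral>\<^sup>+x. ennreal (norm (w x)) \<partial>lebesgue_on \<Omega>) \<le> ennreal (sqrt (measure lebesgue \<Omega>) * Lp_norm 2 \<Omega> w)"
    proof (cases "\<integral>\<^sup>+x. ennreal (norm (w x)) \<partial>lebesgue_on \<Omega>" rule: ennreal_cases)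
    case (real r)
    with sq have "ennreal (r\<^sup>2) \<le> ennreal ((sqrt (measure lebesgue \<Omega>) * Lp_norm 2 \<Omega> w)\<^sup>2)"
      by (simp add: ennreal_power Lp_norm_2_nonneg)
    then have "r\<^sup>2 \<le> (sqrt (measure lebesgue \<Omega>) * Lp_norm 2 \<Omega> w)\<^sup>2"
      by (subst (asm) ennreal_le_iff) auto
    then have "r \<le> sqrt (measure lebesgue \<Omega>) * Lp_norm 2 \<Omega> w"
      by (rule power2_le_imp_le) (simp add: Lp_norm_2_nonneg)
    with real show ?thesis by (simp add: ennreal_leI)
  next
    case top
    with sq show ?thesis by (simp add: ennreal_power Lp_norm_2_nonneg top_unique)
  qed
  then show i: "integrable (lebesgue_on \<Omega>) w"
    by (intro integrableI_bounded) (auto intro: le_less_trans)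
  have "(\<integral>\<^sup>+x. ennreal (norm (w x)) \<partial>lebesgue_on \<Omega>) = ennreal (\<integral>x. norm (w x) \<partial>lebesgue_on \<Omega>)"
    using i by (intro nn_integral_eq_integral) auto
  with le show "(\<integral>x. norm (w x) \<partial>lebesgue_on \<Omega>) \<le> sqrt (measure lebesgue \<Omega>) * Lp_norm 2 \<Omega> w"
    by (simp add: Lp_norm_2_nonneg)
qed

text \<open>Pairing with a bounded \<Phi> is continuous for the L^2 norm, as L^2 embeds in L^1 here.
  The inner product covers both sides of the weak gradient identity: the scalar derivative of a test
  function and the vector field \<open>\<phi> x *\<^sub>R b\<close>.\<close>

lemma Lp_2_tendsto_integral_inner:
  fixes w :: "'a::euclidean_space \<Rightarrow> 'b::euclidean_space"
  assumes \<Omega>: "open \<Omega>" "bounded \<Omega>" and w: "\<And>n. W n \<in> Lp 2 \<Omega>" "w \<in> Lp 2 \<Omega>"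
    and lim: "(\<lambda>n. Lp_norm 2 \<Omega> (\<lambda>x. W n x - w x)) \<longlonglongrightarrow> 0"
    and \<Phi>: "\<Phi> \<in> borel_measurable borel" "\<And>x. norm (\<Phi> x) \<le> K"
  shows "(\<lambda>n. \<integral>x. W n x \<bullet> \<Phi> x \<partial>lebesgue_on \<Omega>) \<longlonglongrightarrow> (\<integral>x. w x \<bullet> \<Phi> x \<partial>lebesgue_on \<Omega>)"
proof -
  have [measurable]: "\<Phi> \<in> borel_measurable (lebesgue_on \<Omega>)"
    using \<Phi>(1) by (intro measurable_restrict_space1 measurable_completion) simp
  have K: "K \<ge> 0" using \<Phi>(2) norm_ge_zero order_trans by blast
  have bd: "\<bar>v x \<bullet> \<Phi> x\<bar> \<le> K * norm (v x)" for v :: "'a \<Rightarrow> 'b" and x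
    using Cauchy_Schwarz_ineq2[of "v x" "\<Phi> x"] mult_left_mono[OF \<Phi>(2)[of x] norm_ge_zero[of "v x"]]
    by (simp add: mult.commute)
  have int: "integrable (lebesgue_on \<Omega>) (\<lambda>x. v x \<bullet> \<Phi> x)" if "v \<in> Lp 2 \<Omega>" for v :: "'a \<Rightarrow> 'b"
  proof (rule Bochner_Integration.integrable_bound)
    show "integrable (lebesgue_on \<Omega>) (\<lambda>x. K * norm (v x))"
      using Lp_2_integrable(1)[OF \<Omega> that] by auto
    have [measurable]: "v \<in> borel_measurable (lebesgue_on \<Omega>)" using that by (simp add: Lp_2_iff)
    show "(\<lambda>x. v x \<bullet> \<Phi> x) \<in> borel_measurable (lebesgue_on \<Omega>)" by measurable
    show "AE x in lebesgue_on \<Omega>. norm (v x \<bullet> \<Phi> x) \<le> norm (K * norm (v x))"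
      using bd K by (auto simp: abs_mult)
  qed
  have "norm ((\<integral>x. W n x \<bullet> \<Phi> x \<partial>lebesgue_on \<Omega>) - (\<integral>x. w x \<bullet> \<Phi> x \<partial>lebesgue_on \<Omega>)) \<le>
      K * (sqrt (measure lebesgue \<Omega>) * Lp_norm 2 \<Omega> (\<lambda>x. W n x - w x))" for n
  proof -
    have d: "(\<lambda>x. W n x - w x) \<in> Lp 2 \<Omega>" by (intro Lp_2_diff w)
    have "(\<integral>x. W n x \<bullet> \<Phi> x \<partial>lebesgue_on \<Omega>) - (\<integral>x. w x \<bullet> \<Phi> x \<partial>lebesgue_on \<Omega>) =
        (\<integral>x. (W n x - w x) \<bullet> \<Phi> x \<partial>lebesgue_on \<Omega>)"
      by (simp add: inner_diff_left int[OF w(1)] int[OF w(2)])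
    also have "norm \<dots> \<le> (\<integral>x. K * norm (W n x - w x) \<partial>lebesgue_on \<Omega>)"
      using Lp_2_integrable(1)[OF \<Omega> d] bd[of "\<lambda>x. W n x - w x"] int[OF d]
      by (intro Bochner_Integration.integral_norm_bound_integral) auto
    also have "\<dots> \<le> K * (sqrt (measure lebesgue \<Omega>) * Lp_norm 2 \<Omega> (\<lambda>x. W n x - w x))"
      using Lp_2_integrable(2)[OF \<Omega> d] K by (simp add: mult_left_mono)
    finally show ?thesis .
  qed
  moreover have "(\<lambda>n. K * (sqrt (measure lebesgue \<Omega>) * Lp_norm 2 \<Omega> (\<lambda>x. W n x - w x))) \<longlonglongrightarrow> 0"
    using tendsto_mult_right_zero[OF tendsto_mult_right_zero[OF lim]] by blast
  ultimately have "(\<lambda>n. (\<integral>x. W n x \<bullet> \<Phi> x \<partial>lebesgue_on \<Omega>) - (\<integral>x. w x \<bullet> \<Phi> x \<partial>lebesgue_on \<Omega>)) \<longlonglongrightarrow> 0"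
    by (rule_tac Lim_null_comparison[rotated]) auto
  then show ?thesis by (simp add: LIM_zero_iff)
qed

lemma H1_limit:
  fixes f :: "'a::euclidean_space \<Rightarrow> real"
  assumes \<Omega>: "open \<Omega>" "bounded \<Omega>" and f: "f \<in> Lp 2 \<Omega>"
    and v: "\<And>n. v n \<in> Lp 2 \<Omega>" and G: "\<And>n. G n \<in> Lp 2 \<Omega>" and H: "H \<in> Lp 2 \<Omega>"
    and wg: "\<And>n. is_weak_gradient \<Omega> (v n) (G n)"
    and lv: "(\<lambda>n. Lp_norm 2 \<Omega> (\<lambda>x. v n x - f x)) \<longlonglongrightarrow> 0"
    and lG: "(\<lambda>n. Lp_norm 2 \<Omega> (\<lambda>x. G n x - H x)) \<longlonglongrightarrow> 0"
  shows "f \<in> H1 \<Omega>"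
proof -
  have "is_weak_gradient \<Omega> f H"
    unfolding is_weak_gradient_def
  proof (intro allI impI, elim conjE)
    fix \<phi> :: "'a \<Rightarrow> real" and b :: 'a
    assume \<phi>: "test_function \<Omega> \<phi>" and b: "b \<in> Basis"
    have s: "smooth \<phi>" using \<phi> by (auto simp: test_function_def)
    have m: "(\<lambda>x. frechet_derivative \<phi> (at x) b) \<in> borel_measurable borel" "\<phi> \<in> borel_measurable borel"
      using s smooth_frechet_derivative(3) smooth_imp_continuous
      by (auto intro: borel_measurable_continuous_onI)
    obtain C where C: "\<And>x. \<bar>\<phi> x\<bar> \<le> C" "\<And>x. \<bar>frechet_derivative \<phi> (at x) b\<bar> \<le> C"
      using test_function_bounds[OF \<phi>, of b] by metis
    have l1: "(\<lambda>n. \<integral>x. v n x \<bullet> frechet_derivative \<phi> (at x) b \<partial>lebesgue_on \<Omega>) \<longlonglongrightarrow>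
        (\<integral>x. f x \<bullet> frechet_derivative \<phi> (at x) b \<partial>lebesgue_on \<Omega>)"
      using m C by (intro Lp_2_tendsto_integral_inner[OF \<Omega> v f lv]) auto
    have l2: "(\<lambda>n. \<integral>x. G n x \<bullet> (\<phi> x *\<^sub>R b) \<partial>lebesgue_on \<Omega>) \<longlonglongrightarrow>
        (\<integral>x. H x \<bullet> (\<phi> x *\<^sub>R b) \<partial>lebesgue_on \<Omega>)"
      using m C b by (intro Lp_2_tendsto_integral_inner[OF \<Omega> G H lG, where K=C]) auto
    have eq: "(\<integral>x. v n x \<bullet> frechet_derivative \<phi> (at x) b \<partial>lebesgue_on \<Omega>) =
        - (\<integral>x. G n x \<bullet> (\<phi> x *\<^sub>R b) \<partial>lebesgue_on \<Omega>)" for n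
      using wg[of n] \<phi> b unfolding is_weak_gradient_def by (simp add: mult.commute)
    have "(\<integral>x. f x \<bullet> frechet_derivative \<phi> (at x) b \<partial>lebesgue_on \<Omega>) =
        - (\<integral>x. H x \<bullet> (\<phi> x *\<^sub>R b) \<partial>lebesgue_on \<Omega>)"
      using l1 unfolding eq by (rule LIMSEQ_unique) (rule tendsto_minus[OF l2])
    then show "(\<integral>x. f x * frechet_derivative \<phi> (at x) b \<partial>lebesgue_on \<Omega>) =
        - (\<integral>x. (H x \<bullet> b) * \<phi> x \<partial>lebesgue_on \<Omega>)"
      by (simp add: mult.commute)
  qed
  with f H show ?thesis by (auto simp: H1_def)
qed

lemma is_weak_gradient_midpoint:
  fixes u w :: "'a::euclidean_space \<Rightarrow> real"
  assumes \<Omega>: "open \<Omega>" "bounded \<Omega>" and L: "u \<in> Lp 2 \<Omega>" "w \<in> Lp 2 \<Omega>" "G \<in> Lp 2 \<Omega>" "H \<in> Lp 2 \<Omega>"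
    and wg: "is_weak_gradient \<Omega> u G" "is_weak_gradient \<Omega> w H"
  shows "is_weak_gradient \<Omega> (\<lambda>x. (1/2) *\<^sub>R (u x + w x)) (\<lambda>x. (1/2) *\<^sub>R (G x + H x))"
  unfolding is_weak_gradient_def
proof (intro allI impI, elim conjE)
  fix \<phi> :: "'a \<Rightarrow> real" and b :: 'a
  assume \<phi>: "test_function \<Omega> \<phi>" and b: "b \<in> Basis"
  have s: "smooth \<phi>" using \<phi> by (auto simp: test_function_def)
  have "(\<lambda>x. frechet_derivative \<phi> (at x) b) \<in> borel_measurable borel" "\<phi> \<in> borel_measurable borel"
    using s smooth_frechet_derivative(3) smooth_imp_continuous
    by (auto intro: borel_measurable_continuous_onI)
  then have [measurable]: "(\<lambda>x. frechet_derivative \<phi> (at x) b) \<in> borel_measurable (lebesgue_on \<Omega>)"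
      "\<phi> \<in> borel_measurable (lebesgue_on \<Omega>)"
    by (auto intro!: measurable_restrict_space1 measurable_completion)
  obtain C where C: "\<And>x. \<bar>\<phi> x\<bar> \<le> C" "\<And>x. \<bar>frechet_derivative \<phi> (at x) b\<bar> \<le> C"
    using test_function_bounds[OF \<phi>, of b] by metis
  have i1: "integrable (lebesgue_on \<Omega>) (\<lambda>x. v x * frechet_derivative \<phi> (at x) b)" if "v \<in> Lp 2 \<Omega>" for v
    using Lp_2_integrable(1)[OF \<Omega> that] C by (intro integrable_mult_bounded) auto
  have i2: "integrable (lebesgue_on \<Omega>) (\<lambda>x. (F x \<bullet> b) * \<phi> x)" if "F \<in> Lp 2 \<Omega>" for F
    using Lp_2_integrable(1)[OF \<Omega> that] C by (intro integrable_mult_bounded) auto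
  have "(\<integral>x. (1/2) *\<^sub>R (u x + w x) * frechet_derivative \<phi> (at x) b \<partial>lebesgue_on \<Omega>) =
      (\<integral>x. (1/2) * (u x * frechet_derivative \<phi> (at x) b + w x * frechet_derivative \<phi> (at x) b) \<partial>lebesgue_on \<Omega>)"
    by (intro Bochner_Integration.integral_cong) (auto simp: field_simps)
  also have "\<dots> = (1/2) * ((\<integral>x. u x * frechet_derivative \<phi> (at x) b \<partial>lebesgue_on \<Omega>) +
      (\<integral>x. w x * frechet_derivative \<phi> (at x) b \<partial>lebesgue_on \<Omega>))"
    by (simp only: integral_mult_right_zero Bochner_Integration.integral_add[OF i1[OF L(1)] i1[OF L(2)]])
  also have "\<dots> = - ((1/2) * ((\<integral>x. (G x \<bullet> b) * \<phi> x \<partial>lebesgue_on \<Omega>) + (\<integral>x. (H x \<bullet> b) * \<phi> x \<partial>lebesgue_on \<Omega>)))"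
    unfolding wg[unfolded is_weak_gradient_def, rule_format, OF conjI[OF \<phi> b]] by (simp add: field_simps)
  also have "\<dots> = - (\<integral>x. (1/2) * ((G x \<bullet> b) * \<phi> x + (H x \<bullet> b) * \<phi> x) \<partial>lebesgue_on \<Omega>)"
    by (simp only: integral_mult_right_zero Bochner_Integration.integral_add[OF i2[OF L(3)] i2[OF L(4)]])
  also have "(\<integral>x. (1/2) * ((G x \<bullet> b) * \<phi> x + (H x \<bullet> b) * \<phi> x) \<partial>lebesgue_on \<Omega>) =
      (\<integral>x. ((1/2) *\<^sub>R (G x + H x) \<bullet> b) * \<phi> x \<partial>lebesgue_on \<Omega>)"
    by (intro Bochner_Integration.integral_cong) (auto simp: field_simps inner_add_left)
  finally show "(\<integral>x. (1/2) *\<^sub>R (u x + w x) * frechet_derivative \<phi> (at x) b \<partial>lebesgue_on \<Omega>) =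
      - (\<integral>x. ((1/2) *\<^sub>R (G x + H x) \<bullet> b) * \<phi> x \<partial>lebesgue_on \<Omega>)" .
qed

text \<open>The gradients of the \<open>u n\<close> are bounded but need not converge strongly. They
  serve only to bound the infima \<open>d n\<close> by C^2; the convergent gradients are taken from
  other functions \<open>v n\<close> that also approach f.\<close>

lemma H1_closed:
  fixes f :: "'a::euclidean_space \<Rightarrow> real"
  assumes \<Omega>: "open \<Omega>" "bounded \<Omega>" and f: "f \<in> Lp 2 \<Omega>" and u: "\<And>n. u n \<in> H1 \<Omega>"
    and bd: "\<And>n. Lp_norm 2 \<Omega> (weak_grad \<Omega> (u n)) \<le> C"
    and lim: "(\<lambda>n. Lp_norm 2 \<Omega> (\<lambda>x. u n x - f x)) \<longlonglongrightarrow> 0"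
  shows "f \<in> H1 \<Omega>"
proof -
  define h where "h n = 1 / real (Suc n)" for n
  have h0: "h n > 0" for n by (simp add: h_def)
  have hm: "h m \<le> h n" if "n \<le> m" for n m using that by (simp add: h_def frac_le)
  have hl: "h \<longlonglongrightarrow> 0" using LIMSEQ_inverse_real_of_nat by (simp add: h_def[abs_def] inverse_eq_divide)
  \<comment> \<open>These sets are convex and decreasing in \<open>n\<close>, which makes the parallelogram law applicable to
    elements of almost minimal norm.\<close>
  define A where "A n = {G \<in> Lp 2 \<Omega>. \<exists>v\<in>Lp 2 \<Omega>. is_weak_gradient \<Omega> v G \<and> Lp_norm 2 \<Omega> (\<lambda>x. v x - f x) \<le> h n}" for n
  define E where "E G = (Lp_norm 2 \<Omega> G)\<^sup>2" for G :: "'a \<Rightarrow> 'a"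
  define d where "d n = (INF G\<in>A n. E G)" for n
  have bb: "bdd_below (E ` A n)" for n by (intro bdd_belowI[of _ 0]) (auto simp: E_def)
  have Am: "A m \<subseteq> A n" if "n \<le> m" for n m using hm[OF that] by (force simp: A_def)
  have AC: "\<exists>G\<in>A n. E G \<le> C\<^sup>2" for n
  proof -
    have "eventually (\<lambda>k. Lp_norm 2 \<Omega> (\<lambda>x. u k x - f x) < h n) sequentially"
      using order_tendstoD(2)[OF lim h0] .
    then obtain k where k: "Lp_norm 2 \<Omega> (\<lambda>x. u k x - f x) < h n"
      by (auto simp: eventually_sequentially)
    then have "weak_grad \<Omega> (u k) \<in> A n"
      unfolding A_def using weak_grad_works[OF u[of k]] by (auto intro: less_imp_le)
    moreover have "E (weak_grad \<Omega> (u k)) \<le> C\<^sup>2"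
      unfolding E_def by (intro power_mono bd Lp_norm_2_nonneg)
    ultimately show ?thesis by blast
  qed
  then have An: "A n \<noteq> {}" for n by blast
  have dle: "d n \<le> E G" if "G \<in> A n" for n G
    unfolding d_def using that by (intro cINF_lower bb)
  have dC: "d n \<le> C\<^sup>2" for n using AC[of n] dle by force
  have dinc: "incseq d"
    unfolding d_def using Am by (intro monoI cINF_superset_mono An bb) auto
  obtain L where L: "d \<longlonglongrightarrow> L" "\<And>n. d n \<le> L"
    using incseq_convergent[OF dinc] dC by blast
  have "\<exists>G\<in>A n. E G < d n + h n" for n
    using cINF_less_iff[OF An bb, of n "d n + h n"] h0[of n] unfolding d_def by auto
  then obtain G where G: "\<And>n. G n \<in> A n" "\<And>n. E (G n) < d n + h n" by metis
  then have "\<forall>n. \<exists>v. v \<in> Lp 2 \<Omega> \<and> is_weak_gradient \<Omega> v (G n) \<and> Lp_norm 2 \<Omega> (\<lambda>x. v x - f x) \<le> h n"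
    unfolding A_def by blast
  then obtain v where v: "\<And>n. v n \<in> Lp 2 \<Omega>" "\<And>n. is_weak_gradient \<Omega> (v n) (G n)"
    "\<And>n. Lp_norm 2 \<Omega> (\<lambda>x. v n x - f x) \<le> h n" by metis
  have GL: "G n \<in> Lp 2 \<Omega>" for n using G(1) by (auto simp: A_def)
  \<comment> \<open>The parallelogram law gives 2 (d n + h n) + 2 (d m + h m) - 4 d n, since the
    midpoint has energy at least \<open>d n\<close>; then d m \<le> L and h m \<le> h n.\<close>
  define c where "c n = 2 * (L - d n) + 4 * h n" for n
  have cl: "c \<longlonglongrightarrow> 0"
  proof -
    have "c \<longlonglongrightarrow> 2 * (L - L) + 4 * 0"
      unfolding c_def[abs_def] by (intro tendsto_intros L hl)
    then show ?thesis by simp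
  qed
  have Cauchy: "E (\<lambda>x. G n x - G m x) \<le> c n" if nm: "n \<le> m" for n m
  proof -
    \<comment> \<open>The midpoint of the two functions stays within \<open>h n\<close> of f, by the
      parallelogram law for their deviations from f with the difference term dropped.\<close>
    have "(\<lambda>x. (1/2) *\<^sub>R (G n x + G m x)) \<in> A n"
    proof -
      have "(Lp_norm 2 \<Omega> (\<lambda>x. (v n x - f x) - (v m x - f x)))\<^sup>2 +
          4 * (Lp_norm 2 \<Omega> (\<lambda>x. (1/2) *\<^sub>R ((v n x - f x) + (v m x - f x))))\<^sup>2 =
        2 * (Lp_norm 2 \<Omega> (\<lambda>x. v n x - f x))\<^sup>2 + 2 * (Lp_norm 2 \<Omega> (\<lambda>x. v m x - f x))\<^sup>2"
        by (rule Lp_2_parallelogram) (intro Lp_2_diff v f)+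
      moreover have "(Lp_norm 2 \<Omega> (\<lambda>x. v n x - f x))\<^sup>2 \<le> (h n)\<^sup>2"
        by (intro power_mono v Lp_norm_2_nonneg)
      moreover have "(Lp_norm 2 \<Omega> (\<lambda>x. v m x - f x))\<^sup>2 \<le> (h n)\<^sup>2"
        using v(3)[of m] hm[OF nm] by (intro power_mono Lp_norm_2_nonneg) auto
      ultimately have "(Lp_norm 2 \<Omega> (\<lambda>x. (1/2) *\<^sub>R ((v n x - f x) + (v m x - f x))))\<^sup>2 \<le> (h n)\<^sup>2"
        using zero_le_power2[of "Lp_norm 2 \<Omega> (\<lambda>x. (v n x - f x) - (v m x - f x))"] by linarith
      then have "Lp_norm 2 \<Omega> (\<lambda>x. (1/2) *\<^sub>R ((v n x - f x) + (v m x - f x))) \<le> h n"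
        by (rule power2_le_imp_le) (use h0[of n] in simp)
      moreover have "(\<lambda>x. (1/2) *\<^sub>R ((v n x - f x) + (v m x - f x))) = (\<lambda>x. (1/2) *\<^sub>R (v n x + v m x) - f x)"
      proof -
        have "(1/2) * ((a - e) + (b - e)) = (1/2) * (a + b) - e" for a b e :: real
          by (simp add: field_simps)
        then show ?thesis by (simp only: real_scaleR_def)
      qed
      ultimately have "Lp_norm 2 \<Omega> (\<lambda>x. (1/2) *\<^sub>R (v n x + v m x) - f x) \<le> h n" by (simp only:)
      moreover have "is_weak_gradient \<Omega> (\<lambda>x. (1/2) *\<^sub>R (v n x + v m x)) (\<lambda>x. (1/2) *\<^sub>R (G n x + G m x))"
        by (intro is_weak_gradient_midpoint \<Omega> v GL)
      moreover have "(\<lambda>x. (1/2) *\<^sub>R (v n x + v m x)) \<in> Lp 2 \<Omega>" by (intro Lp_2_scaleR Lp_2_add v)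
      moreover have "(\<lambda>x. (1/2) *\<^sub>R (G n x + G m x)) \<in> Lp 2 \<Omega>" by (intro Lp_2_scaleR Lp_2_add GL)
      ultimately show ?thesis unfolding A_def by blast
    qed
    then have "d n \<le> E (\<lambda>x. (1/2) *\<^sub>R (G n x + G m x))" by (rule dle)
    moreover have "E (\<lambda>x. G n x - G m x) + 4 * E (\<lambda>x. (1/2) *\<^sub>R (G n x + G m x)) = 2 * E (G n) + 2 * E (G m)"
      unfolding E_def by (rule Lp_2_parallelogram[OF GL GL])
    ultimately show ?thesis
      using G(2)[of n] G(2)[of m] hm[OF nm] L(2)[of m] unfolding c_def by argo
  qed
  have GM: "\<And>n. G n \<in> borel_measurable (lebesgue_on \<Omega>)" using GL by (simp add: Lp_2_iff)
  have "(\<integral>\<^sup>+x. ennreal ((norm (G n x - G m x))\<^sup>2) \<partial>lebesgue_on \<Omega>) \<le> ennreal (c n)" if "n \<le> m" for n m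
    using Cauchy[OF that] unfolding E_def
    by (subst ennreal_Lp_norm_2_squared[symmetric]) (auto intro: Lp_2_diff GL ennreal_leI)
  from L2_Cauchy_limit[OF GM this cl] obtain H where Hm: "H \<in> borel_measurable (lebesgue_on \<Omega>)"
    and Hc: "\<And>n. (\<integral>\<^sup>+x. ennreal ((norm (G n x - H x))\<^sup>2) \<partial>lebesgue_on \<Omega>) \<le> ennreal (c n)"
    by blast
  have dL: "(\<lambda>x. G n x - H x) \<in> Lp 2 \<Omega>" for n
    unfolding Lp_2_iff using GM[of n] Hm le_less_trans[OF Hc[of n] ennreal_less_top]
    by (auto intro!: integrableI_nonneg)
  have HL: "H \<in> Lp 2 \<Omega>" using Lp_2_diff[OF GL[of 0] dL[of 0]] by simp
  have c0: "c n \<ge> 0" for n using L(2)[of n] h0[of n] by (simp add: c_def)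
  have "(Lp_norm 2 \<Omega> (\<lambda>x. G n x - H x))\<^sup>2 \<le> c n" for n
    using Hc[of n] c0[of n] unfolding ennreal_Lp_norm_2_squared[OF dL, symmetric] by simp
  then have "norm (Lp_norm 2 \<Omega> (\<lambda>x. G n x - H x)) \<le> sqrt (c n)" for n
    using real_le_rsqrt by (auto simp: Lp_norm_2_nonneg)
  moreover have "(\<lambda>n. sqrt (c n)) \<longlonglongrightarrow> 0" using tendsto_real_sqrt[OF cl] by simp
  ultimately have lG: "(\<lambda>n. Lp_norm 2 \<Omega> (\<lambda>x. G n x - H x)) \<longlonglongrightarrow> 0"
    by (rule_tac Lim_null_comparison[of _ "\<lambda>n. sqrt (c n)"]) auto
  have lv: "(\<lambda>n. Lp_norm 2 \<Omega> (\<lambda>x. v n x - f x)) \<longlonglongrightarrow> 0"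
    using v(3) by (rule_tac Lim_null_comparison[OF _ hl]) (auto simp: Lp_norm_2_nonneg)
  show ?thesis
    by (rule H1_limit[OF \<Omega> f v(1) GL HL v(2) lv lG])
qed

text \<open>A property holding almost everywhere on I holds on a dense subset of I: near t, even at
  an endpoint, I contains a nondegenerate open interval, which has positive measure.\<close>

lemma AE_interval_approx:
  fixes I :: "real set"
  assumes I: "(\<exists>a b. a < b \<and> I = {a..b}) \<or> (\<exists>\<tau>. I = {\<tau>..})"
    and AE: "AE t in lebesgue_on I. P t" and t: "t \<in> I"
  obtains s where "\<And>n. s n \<in> I" "\<And>n. P (s n)" "s \<longlonglongrightarrow> t"
proof -
  have Il: "I \<in> sets lebesgue" using I by auto
  have ae: "AE s in lebesgue. s \<in> I \<longrightarrow> P s"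
    using AE Il by (subst (asm) AE_restrict_space_iff) auto
  have "\<exists>s\<in>I. P s \<and> \<bar>s - t\<bar> < e" if e: "e > 0" for e
  proof (rule ccontr)
    assume "\<not> ?thesis"
    then have no: "\<And>s. s \<in> I \<Longrightarrow> \<bar>s - t\<bar> < e \<Longrightarrow> \<not> P s" by blast
    obtain p q where pq: "p < q" "{p<..<q} \<subseteq> I" "\<And>s. s \<in> {p<..<q} \<Longrightarrow> \<bar>s - t\<bar> < e"
    proof -
      from I show ?thesis
      proof (elim disjE exE conjE)
        fix a b assume ab: "a < b" "I = {a..b}"
        show ?thesis using ab t e by (intro that[of "max a (t - e)" "min b (t + e)"]) auto
      next
        fix \<tau> assume "I = {\<tau>..}"
        then show ?thesis using t e by (intro that[of t "t + e"]) auto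
      qed
    qed
    have "AE s in lebesgue. s \<notin> {p<..<q}"
      using ae by eventually_elim (use no pq in blast)
    then have "{p<..<q} \<in> null_sets lebesgue" by (subst AE_iff_null_sets) auto
    then show False using pq(1) by (simp add: null_sets_def)
  qed
  then have "\<exists>s\<in>I. P s \<and> \<bar>s - t\<bar> < 1 / real (Suc n)" for n by simp
  then obtain s where s: "\<And>n. s n \<in> I" "\<And>n. P (s n)" "\<And>n. \<bar>s n - t\<bar> < 1 / real (Suc n)"
    by metis
  have "(\<lambda>n. 1 / real (Suc n)) \<longlonglongrightarrow> 0" using LIMSEQ_inverse_real_of_nat by (simp add: inverse_eq_divide)
  then have "(\<lambda>n. s n - t) \<longlonglongrightarrow> 0"
    using s(3) by (rule_tac Lim_null_comparison[of "\<lambda>n. s n - t" "\<lambda>n. 1 / real (Suc n)"]) (auto intro!: always_eventually less_imp_le)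
  then have "s \<longlonglongrightarrow> t" by (simp add: LIM_zero_iff)
  with s show ?thesis by (intro that) auto
qed

text \<open>At almost every time there is membership in H^1 with one common bound. Such times
  approach t, continuity in L^2 gives convergence of the values, and closedness of H^1 passes
  membership to t.\<close>

lemma Linfty_H1_everywhere:
  fixes f :: "real \<Rightarrow> 'a::euclidean_space \<Rightarrow> real"
  assumes \<Omega>: "open \<Omega>" "bounded \<Omega>"
    and I: "(\<exists>a b. a < b \<and> I = {a..b}) \<or> (\<exists>\<tau>. I = {\<tau>..})"
    and Li: "Linfty_in_time I (H1 \<Omega>) (H1_norm \<Omega>) f"
    and co: "continuous_in_time I (Lp 2 \<Omega>) (Lp_norm 2 \<Omega>) f" and t: "t \<in> I"
  shows "f t \<in> H1 \<Omega>"
proof -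
  obtain C where "AE t in lebesgue_on I. f t \<in> H1 \<Omega>" "AE t in lebesgue_on I. H1_norm \<Omega> (f t) \<le> C"
    using Li by (auto simp: Linfty_in_time_def)
  then have "AE t in lebesgue_on I. f t \<in> H1 \<Omega> \<and> H1_norm \<Omega> (f t) \<le> C" by auto
  from AE_interval_approx[OF I this t] obtain s where
    s: "\<And>n. s n \<in> I" "\<And>n. f (s n) \<in> H1 \<Omega>" "\<And>n. H1_norm \<Omega> (f (s n)) \<le> C" "s \<longlonglongrightarrow> t"
    by metis
  have ft: "f t \<in> Lp 2 \<Omega>" using co t by (simp add: continuous_in_time_def)
  have bd: "Lp_norm 2 \<Omega> (weak_grad \<Omega> (f (s n))) \<le> C" for n
  proof -
    have "Lp_norm 2 \<Omega> (weak_grad \<Omega> (f (s n))) \<le> H1_norm \<Omega> (f (s n))"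
      unfolding H1_norm_def by (rule real_le_rsqrt) simp
    with s(3) show ?thesis by (rule order_trans[rotated])
  qed
  have "((\<lambda>r. Lp_norm 2 \<Omega> (\<lambda>x. f r x - f t x)) \<longlongrightarrow> 0) (at t within I)"
    using co t by (simp add: continuous_in_time_def)
  \<comment> \<open>The value at t agrees with the punctured limit, so the limit becomes continuity
    at t and also covers sequences that take the value t.\<close>
  moreover have "Lp_norm 2 \<Omega> (\<lambda>x. f t x - f t x) = 0" by (simp add: Lp_norm_2)
  ultimately have "continuous (at t within I) (\<lambda>r. Lp_norm 2 \<Omega> (\<lambda>x. f r x - f t x))"
    by (simp add: continuous_within)
  then have "(\<lambda>n. Lp_norm 2 \<Omega> (\<lambda>x. f (s n) x - f t x)) \<longlonglongrightarrow> Lp_norm 2 \<Omega> (\<lambda>x. f t x - f t x)"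
    using s(1,4) by (auto simp: continuous_within_sequentially o_def)
  then have "(\<lambda>n. Lp_norm 2 \<Omega> (\<lambda>x. f (s n) x - f t x)) \<longlonglongrightarrow> 0" by (simp add: Lp_norm_2)
  then show ?thesis by (rule H1_closed[OF \<Omega> ft s(2) bd])
qed

section \<open>Measure of the sublevel sets\<close>

lemma Lp_diff:
  fixes u w :: "'a::euclidean_space \<Rightarrow> real"
  assumes p: "1 \<le> p" and u: "u \<in> Lp p \<Omega>" and w: "w \<in> Lp p \<Omega>"
  shows "(\<lambda>x. u x - w x) \<in> Lp p \<Omega>"
proof -
  have [measurable]: "u \<in> borel_measurable (lebesgue_on \<Omega>)" "w \<in> borel_measurable (lebesgue_on \<Omega>)"
    using u w by (auto simp: Lp_def)
  show ?thesis
  proof (cases "p = \<infinity>")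
    case True
    have "esssup (lebesgue_on \<Omega>) (\<lambda>x. ereal (norm (u x - w x))) \<le>
        esssup (lebesgue_on \<Omega>) (\<lambda>x. ereal (norm (u x)) + ereal (norm (w x)))"
      by (rule esssup_mono) (auto intro: norm_triangle_ineq4[where 'a=real, simplified])
    also have "\<dots> \<le> esssup (lebesgue_on \<Omega>) (\<lambda>x. ereal (norm (u x))) + esssup (lebesgue_on \<Omega>) (\<lambda>x. ereal (norm (w x)))"
      by (rule esssup_add)
    also have "\<dots> < \<infinity>" using u w True by (auto simp: Lp_def)
    finally show ?thesis using True by (simp add: Lp_def)
  next
    case False
    define P where "P = enn2real p"
    have P: "P \<ge> 0" by (simp add: P_def)
    have i: "integrable (lebesgue_on \<Omega>) (\<lambda>x. 2 powr P * (norm (u x) powr P + norm (w x) powr P))"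
      using u w False by (auto simp: Lp_def P_def)
    have "integrable (lebesgue_on \<Omega>) (\<lambda>x. norm (u x - w x) powr P)"
    proof (rule Bochner_Integration.integrable_bound[OF i])
      have "norm (u x - w x) powr P \<le> 2 powr P * (norm (u x) powr P + norm (w x) powr P)" for x
      proof -
        have "norm (u x - w x) powr P \<le> (2 * max (norm (u x)) (norm (w x))) powr P"
          by (intro powr_mono2 P) auto
        also have "\<dots> = 2 powr P * max (norm (u x)) (norm (w x)) powr P"
          by (rule powr_mult)
        also have "\<dots> \<le> 2 powr P * (norm (u x) powr P + norm (w x) powr P)"
          by (intro mult_left_mono) (auto simp: max_def)
        finally show ?thesis .
      qed
      then show "AE x in lebesgue_on \<Omega>. norm (norm (u x - w x) powr P) \<le>
          norm (2 powr P * (norm (u x) powr P + norm (w x) powr P))"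
        by (intro AE_I2) simp
    qed measurable
    then show ?thesis using False by (simp add: Lp_def P_def)
  qed
qed

text \<open>For p = \<infinity> the set is null as soon as the norm is below \<epsilon>; for finite
  p this is Chebyshev's inequality, and \<open>d\<close> is the value at which its bound equals
  \<eta>.\<close>

lemma Lp_norm_small_imp_measure_small:
  fixes \<Omega> :: "'a::euclidean_space set"
  assumes \<Omega>: "\<Omega> \<in> sets lebesgue" and p: "1 \<le> p" and \<epsilon>: "\<epsilon> > 0" and \<eta>: "\<eta> > 0"
  obtains d where "d > 0" "\<And>w :: 'a \<Rightarrow> real. w \<in> Lp p \<Omega> \<Longrightarrow> Lp_norm p \<Omega> w < d \<Longrightarrow>
     emeasure (lebesgue_on \<Omega>) {x\<in>\<Omega>. \<epsilon> \<le> \<bar>w x\<bar>} \<le> ennreal \<eta>"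
proof (cases "p = \<infinity>")
  case True
  show ?thesis
  proof (rule that[of \<epsilon>])
    fix w :: "'a \<Rightarrow> real" assume w: "w \<in> Lp p \<Omega>" and lt: "Lp_norm p \<Omega> w < \<epsilon>"
    have [measurable]: "w \<in> borel_measurable (lebesgue_on \<Omega>)" using w by (auto simp: Lp_def)
    define S where "S = esssup (lebesgue_on \<Omega>) (\<lambda>x. ereal (norm (w x)))"
    have S: "S < \<infinity>" "real_of_ereal S < \<epsilon>" using w lt True by (auto simp: Lp_def Lp_norm_def S_def)
    have "AE x in lebesgue_on \<Omega>. ereal (norm (w x)) \<le> S" unfolding S_def by (rule esssup_AE)
    then have "AE x in lebesgue_on \<Omega>. \<not> (\<epsilon> \<le> \<bar>w x\<bar>)"
    proof eventually_elim
      case (elim x)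
      with S show ?case by (cases S) auto
    qed
    moreover have "{x\<in>space (lebesgue_on \<Omega>). \<epsilon> \<le> \<bar>w x\<bar>} \<in> sets (lebesgue_on \<Omega>)" by measurable
    ultimately have "emeasure (lebesgue_on \<Omega>) {x\<in>space (lebesgue_on \<Omega>). \<epsilon> \<le> \<bar>w x\<bar>} = 0"
      using AE_iff_measurable[of _ "lebesgue_on \<Omega>" "\<lambda>x. \<not> (\<epsilon> \<le> \<bar>w x\<bar>)"] by simp
    then show "emeasure (lebesgue_on \<Omega>) {x\<in>\<Omega>. \<epsilon> \<le> \<bar>w x\<bar>} \<le> ennreal \<eta>"
      by (simp add: space_restrict_space)
  qed (rule \<epsilon>)
next
  case False
  define P where "P = enn2real p"
  have P: "P \<ge> 1"
    using p False enn2real_mono[of 1 p] by (simp add: P_def less_top)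
  define d where "d = (\<eta> * \<epsilon> powr P) powr (1 / P)"
  have e: "\<epsilon> powr P > 0" using \<epsilon> by simp
  show ?thesis
  proof (rule that[of d])
    show "d > 0" using \<eta> e by (simp add: d_def)
    fix w :: "'a \<Rightarrow> real" assume w: "w \<in> Lp p \<Omega>" and lt: "Lp_norm p \<Omega> w < d"
    have [measurable]: "w \<in> borel_measurable (lebesgue_on \<Omega>)"
      and int: "integrable (lebesgue_on \<Omega>) (\<lambda>x. norm (w x) powr P)"
      using w False by (auto simp: Lp_def P_def)
    define J where "J = (\<integral>x. norm (w x) powr P \<partial>lebesgue_on \<Omega>)"
    have J0: "J \<ge> 0" unfolding J_def by (intro integral_nonneg_AE) auto
    have "J powr (1 / P) < d" using lt False by (simp add: Lp_norm_def J_def P_def)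
    then have "(J powr (1 / P)) powr P < d powr P"
      using P by (intro powr_less_mono2) auto
    then have J: "J < \<eta> * \<epsilon> powr P"
      using J0 P \<eta> e by (simp add: d_def powr_powr)
    have "emeasure (lebesgue_on \<Omega>) {x\<in>\<Omega>. \<epsilon> \<le> \<bar>w x\<bar>} \<le>
        emeasure (lebesgue_on \<Omega>) {x\<in>space (lebesgue_on \<Omega>). 1 \<le> ennreal (1 / \<epsilon> powr P) * ennreal (norm (w x) powr P)}"
    proof (rule emeasure_mono)
      have "1 \<le> ennreal (1 / \<epsilon> powr P) * ennreal (norm (w x) powr P)" if "\<epsilon> \<le> \<bar>w x\<bar>" for x
      proof -
        have "\<epsilon> powr P \<le> norm (w x) powr P" using \<epsilon> P that by (intro powr_mono2) auto
        then have "1 \<le> (1 / \<epsilon> powr P) * (norm (w x) powr P)" using e by (simp add: field_simps)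
        then have "ennreal 1 \<le> ennreal ((1 / \<epsilon> powr P) * (norm (w x) powr P))" by (rule ennreal_leI)
        moreover have "ennreal ((1 / \<epsilon> powr P) * (norm (w x) powr P)) = ennreal (1 / \<epsilon> powr P) * ennreal (norm (w x) powr P)"
          by (rule ennreal_mult') simp
        ultimately show ?thesis by (simp only: ennreal_1)
      qed
      then show "{x\<in>\<Omega>. \<epsilon> \<le> \<bar>w x\<bar>} \<subseteq> {x\<in>space (lebesgue_on \<Omega>). 1 \<le> ennreal (1 / \<epsilon> powr P) * ennreal (norm (w x) powr P)}"
        by (auto simp: space_restrict_space)
    qed measurable
    also have "\<dots> \<le> ennreal (1 / \<epsilon> powr P) *
        (\<integral>\<^sup>+x. ennreal (norm (w x) powr P) * indicator (space (lebesgue_on \<Omega>)) x \<partial>lebesgue_on \<Omega>)"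
      by (rule nn_integral_Markov_inequality) measurable
    also have "(\<integral>\<^sup>+x. ennreal (norm (w x) powr P) * indicator (space (lebesgue_on \<Omega>)) x \<partial>lebesgue_on \<Omega>) =
        (\<integral>\<^sup>+x. ennreal (norm (w x) powr P) \<partial>lebesgue_on \<Omega>)"
      by (intro nn_integral_cong) simp
    also have "\<dots> = ennreal J"
      unfolding J_def using int by (intro nn_integral_eq_integral) auto
    also have "ennreal (1 / \<epsilon> powr P) * ennreal J = ennreal (J / \<epsilon> powr P)"
      using J0 by (subst ennreal_mult'[symmetric]) auto
    also have "\<dots> \<le> ennreal \<eta>"
      using J e by (intro ennreal_leI) (simp add: pos_divide_le_eq)
    finally show "emeasure (lebesgue_on \<Omega>) {x\<in>\<Omega>. \<epsilon> \<le> \<bar>w x\<bar>} \<le> ennreal \<eta>" .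
  qed
qed

text \<open>A point with g \<le> a - \<epsilon> satisfies h \<le> a unless h and g differ there by
  at least \<epsilon>. If the exceptional set has at most half the measure of {g \<le> a -
  \<epsilon>}, the other half remains in {h \<le> a}; this is why m is half that measure.\<close>

lemma sublevel_measure_stable:
  fixes \<Omega> :: "'a::euclidean_space set" and g :: "'a \<Rightarrow> real"
  assumes \<Omega>: "open \<Omega>" "bounded \<Omega>" and p: "1 \<le> p" and g: "g \<in> Lp p \<Omega>" and \<epsilon>: "\<epsilon> > 0"
    and pos: "emeasure lebesgue {x\<in>\<Omega>. g x \<le> a - \<epsilon>} > 0"
  obtains m d where "m > 0" "d > 0" "ennreal m \<le> emeasure lebesgue {x\<in>\<Omega>. g x \<le> a}"
    "\<And>h. h \<in> Lp p \<Omega> \<Longrightarrow> Lp_norm p \<Omega> (\<lambda>x. h x - g x) < d \<Longrightarrow> ennreal m \<le> emeasure lebesgue {x\<in>\<Omega>. h x \<le> a}"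
proof -
  have \<Omega>l: "\<Omega> \<in> sets lebesgue" using \<Omega> by auto
  have ms: "{x\<in>\<Omega>. Q x} \<in> sets lebesgue" if "{x\<in>space (lebesgue_on \<Omega>). Q x} \<in> sets (lebesgue_on \<Omega>)" for Q
    using that \<Omega>l by (simp add: sets_restrict_space_iff space_restrict_space)
  have gm[measurable]: "g \<in> borel_measurable (lebesgue_on \<Omega>)" using g by (auto simp: Lp_def)
  define Z where "Z = {x\<in>\<Omega>. g x \<le> a - \<epsilon>}"
  have Zl: "Z \<in> sets lebesgue" unfolding Z_def by (rule ms) measurable
  have "emeasure lebesgue Z \<le> emeasure lebesgue \<Omega>" using \<Omega>l by (intro emeasure_mono) (auto simp: Z_def)
  also have "\<dots> < \<infinity>" using emeasure_lborel_bounded_finite[OF \<Omega>(2)] \<Omega> by simp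
  finally have Zf: "emeasure lebesgue Z < \<infinity>" .
  define m where "m = measure lebesgue Z / 2"
  have eZ: "emeasure lebesgue Z = ennreal (2 * m)"
    unfolding m_def using Zf by (simp add: emeasure_eq_ennreal_measure)
  have m: "m > 0" using pos eZ unfolding Z_def[symmetric] by simp
  obtain d where d: "d > 0" "\<And>w :: 'a \<Rightarrow> real. w \<in> Lp p \<Omega> \<Longrightarrow> Lp_norm p \<Omega> w < d \<Longrightarrow>
     emeasure (lebesgue_on \<Omega>) {x\<in>\<Omega>. \<epsilon> \<le> \<bar>w x\<bar>} \<le> ennreal m"
    using Lp_norm_small_imp_measure_small[OF \<Omega>l p \<epsilon> m] by blast
  show ?thesis
  proof (rule that[OF m d(1)])
    have "ennreal m \<le> emeasure lebesgue Z" unfolding eZ using m by (intro ennreal_leI) simp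
    also have "\<dots> \<le> emeasure lebesgue {x\<in>\<Omega>. g x \<le> a}"
    proof (rule emeasure_mono)
      show "{x\<in>\<Omega>. g x \<le> a} \<in> sets lebesgue" by (rule ms) measurable
    qed (use \<epsilon> in \<open>auto simp: Z_def\<close>)
    finally show "ennreal m \<le> emeasure lebesgue {x\<in>\<Omega>. g x \<le> a}" .
    fix h assume h: "h \<in> Lp p \<Omega>" and lt: "Lp_norm p \<Omega> (\<lambda>x. h x - g x) < d"
    have [measurable]: "h \<in> borel_measurable (lebesgue_on \<Omega>)" using h by (auto simp: Lp_def)
    have Yl: "{x\<in>\<Omega>. \<epsilon> \<le> \<bar>h x - g x\<bar>} \<in> sets lebesgue" by (rule ms) measurable
    have Xl: "{x\<in>\<Omega>. h x \<le> a} \<in> sets lebesgue" by (rule ms) measurable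
    have "emeasure lebesgue {x\<in>\<Omega>. \<epsilon> \<le> \<bar>h x - g x\<bar>} \<le> ennreal m"
      using d(2)[OF Lp_diff[OF p h g] lt] \<Omega>l by (subst (asm) emeasure_restrict_space) auto
    moreover have "emeasure lebesgue Z \<le> emeasure lebesgue ({x\<in>\<Omega>. h x \<le> a} \<union> {x\<in>\<Omega>. \<epsilon> \<le> \<bar>h x - g x\<bar>})"
      using Xl Yl by (intro emeasure_mono) (auto simp: Z_def)
    moreover have "\<dots> \<le> emeasure lebesgue {x\<in>\<Omega>. h x \<le> a} + emeasure lebesgue {x\<in>\<Omega>. \<epsilon> \<le> \<bar>h x - g x\<bar>}"
      using Xl Yl by (rule emeasure_subadditive)
    ultimately have "ennreal (2 * m) \<le> emeasure lebesgue {x\<in>\<Omega>. h x \<le> a} + ennreal m"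
      unfolding eZ[symmetric] by (meson add_left_mono order_trans)
    also have "ennreal (2 * m) = ennreal m + ennreal m" using m by (simp flip: ennreal_plus)
    finally have "ennreal m + ennreal m \<le> ennreal m + emeasure lebesgue {x\<in>\<Omega>. h x \<le> a}"
      unfolding add.commute[of "emeasure lebesgue {x\<in>\<Omega>. h x \<le> a}" "ennreal m"] .
    then show "ennreal m \<le> emeasure lebesgue {x\<in>\<Omega>. h x \<le> a}"
      using ennreal_add_left_cancel_le[of "ennreal m" "ennreal m"] by auto
  qed
qed

text \<open>Around each time there is a relative neighbourhood with its own lower bound, and
  finitely many of these cover J. J is separate from I so that bounded pieces of a half-line are
  covered as well.\<close>

lemma sublevel_measure_bound_compact:
  fixes \<Omega> :: "'a::euclidean_space set"
  assumes \<Omega>: "open \<Omega>" "bounded \<Omega>" and p: "1 \<le> p" and co: "continuous_in_time I (Lp p \<Omega>) (Lp_norm p \<Omega>) g"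
    and \<epsilon>: "\<epsilon> > 0" and pos: "\<And>t. t \<in> I \<Longrightarrow> emeasure lebesgue {x\<in>\<Omega>. g t x \<le> a - \<epsilon>} > 0"
    and J: "compact J" "J \<subseteq> I"
  obtains m where "m > 0" "\<And>t. t \<in> J \<Longrightarrow> ennreal m \<le> emeasure lebesgue {x\<in>\<Omega>. g t x \<le> a}"
proof -
  define E where "E s = emeasure lebesgue {x\<in>\<Omega>. g s x \<le> a}" for s
  have "\<exists>e m. e > 0 \<and> m > 0 \<and> (\<forall>s\<in>I \<inter> ball t e. ennreal m \<le> E s)" if t: "t \<in> I" for t
  proof -
    have gt: "g t \<in> Lp p \<Omega>" using co t by (simp add: continuous_in_time_def)
    obtain m d where md: "m > 0" "d > 0" "ennreal m \<le> E t"
      "\<And>h. h \<in> Lp p \<Omega> \<Longrightarrow> Lp_norm p \<Omega> (\<lambda>x. h x - g t x) < d \<Longrightarrow> ennreal m \<le> emeasure lebesgue {x\<in>\<Omega>. h x \<le> a}"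
      using sublevel_measure_stable[OF \<Omega> p gt \<epsilon> pos[OF t]] unfolding E_def by blast
    have "((\<lambda>s. Lp_norm p \<Omega> (\<lambda>x. g s x - g t x)) \<longlongrightarrow> 0) (at t within I)"
      using co t by (simp add: continuous_in_time_def)
    from order_tendstoD(2)[OF this md(2)] obtain e where e: "e > 0"
      "\<And>s. s \<in> I \<Longrightarrow> s \<noteq> t \<Longrightarrow> dist s t < e \<Longrightarrow> Lp_norm p \<Omega> (\<lambda>x. g s x - g t x) < d"
      unfolding eventually_at by blast
    have "ennreal m \<le> E s" if s: "s \<in> I \<inter> ball t e" for s
    proof (cases "s = t")
      case False
      then have "Lp_norm p \<Omega> (\<lambda>x. g s x - g t x) < d" using e(2)[of s] s by (auto simp: dist_commute)
      then show ?thesis using co s unfolding E_def by (intro md(4)) (auto simp: continuous_in_time_def)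
    qed (use md(3) in simp)
    with e(1) md(1) show ?thesis by blast
  qed
  then obtain e m where em: "\<And>t. t \<in> I \<Longrightarrow> e t > 0" "\<And>t. t \<in> I \<Longrightarrow> m t > 0"
    "\<And>t s. t \<in> I \<Longrightarrow> s \<in> I \<inter> ball t (e t) \<Longrightarrow> ennreal (m t) \<le> E s"
    by metis
  obtain F where F: "F \<subseteq> J" "finite F" "J \<subseteq> (\<Union>t\<in>F. ball t (e t))"
  proof (rule compactE_image[OF J(1), of J "\<lambda>t. ball t (e t)"])
    show "J \<subseteq> (\<Union>t\<in>J. ball t (e t))" using em(1) J(2) by force
  qed auto
  \<comment> \<open>The element 1 keeps the minimum defined when the cover is empty, as happens for
    empty J.\<close>
  define M where "M = Min (insert 1 (m ` F))"
  have M: "M > 0" unfolding M_def using F(1,2) J(2) em(2) by (subst Min_gr_iff) auto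
  show ?thesis
  proof (rule that[OF M])
    fix t assume t: "t \<in> J"
    then obtain s where s: "s \<in> F" "t \<in> ball s (e s)" using F(3) by blast
    have "M \<le> m s" unfolding M_def using F(2) s(1) by (intro Min_le) auto
    then have "ennreal M \<le> ennreal (m s)" by (rule ennreal_leI)
    also have "\<dots> \<le> E t"
      using s t F(1) J(2) by (intro em(3)) auto
    finally show "ennreal M \<le> emeasure lebesgue {x\<in>\<Omega>. g t x \<le> a}" unfolding E_def .
  qed
qed

text \<open>If no bound held near infinity, there would be times tending to infinity with sublevel
  measures tending to 0. Along a subsequence g converges to some g*, and stability of the sublevel
  set of g* contradicts this. The exponent r, the limit and the gap \<epsilon> may all depend on the
  sequence.\<close>

lemma sublevel_measure_bound_at_infinity:
  fixes \<Omega> :: "'a::euclidean_space set" and g :: "real \<Rightarrow> 'a \<Rightarrow> real"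
  assumes \<Omega>: "open \<Omega>" "bounded \<Omega>"
    and seq: "\<And>ts :: nat \<Rightarrow> real. range ts \<subseteq> I \<Longrightarrow> filterlim ts at_top sequentially \<Longrightarrow>
      \<exists>(k :: nat \<Rightarrow> nat) r gs \<epsilon>. strict_mono k \<and> 1 \<le> r \<and> 0 < \<epsilon> \<and>
        tendsto_Lp r \<Omega> (\<lambda>l. g (ts (k l))) gs \<and> emeasure lebesgue {x\<in>\<Omega>. gs x \<le> a - \<epsilon>} > 0"
  obtains R m where "m > 0" "\<And>t. t \<in> I \<Longrightarrow> t \<ge> R \<Longrightarrow> ennreal m \<le> emeasure lebesgue {x\<in>\<Omega>. g t x \<le> a}"
proof (rule ccontr)
  assume neg: "\<not> thesis"
  \<comment> \<open>The negated claim is used with m = 1/(n+1) and R = n.\<close>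
  have "\<exists>t\<in>I. t \<ge> real n \<and> emeasure lebesgue {x\<in>\<Omega>. g t x \<le> a} < ennreal (1 / real (Suc n))" for n
    using neg that[of "1 / real (Suc n)" "real n"] by (force simp: not_le)
  then obtain ts where ts: "\<And>n. ts n \<in> I" "\<And>n. ts n \<ge> real n"
    "\<And>n. emeasure lebesgue {x\<in>\<Omega>. g (ts n) x \<le> a} < ennreal (1 / real (Suc n))" by metis
  have "filterlim ts at_top sequentially"
    using filterlim_at_top_mono[OF filterlim_real_sequentially] ts(2) by (simp add: always_eventually)
  moreover have "range ts \<subseteq> I" using ts(1) by auto
  ultimately obtain k r gs \<epsilon> where k: "strict_mono (k :: nat \<Rightarrow> nat)" and r: "1 \<le> r" and \<epsilon>: "0 < \<epsilon>"
    and T: "tendsto_Lp r \<Omega> (\<lambda>l. g (ts (k l))) gs" and pos: "emeasure lebesgue {x\<in>\<Omega>. gs x \<le> a - \<epsilon>} > 0"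
    using seq by blast
  have gs: "gs \<in> Lp r \<Omega>" and gL: "\<And>l. g (ts (k l)) \<in> Lp r \<Omega>"
    and lim: "(\<lambda>l. Lp_norm r \<Omega> (\<lambda>x. g (ts (k l)) x - gs x)) \<longlonglongrightarrow> 0"
    using T by (auto simp: tendsto_Lp_def)
  obtain m d where md: "m > 0" "d > 0"
    "\<And>h. h \<in> Lp r \<Omega> \<Longrightarrow> Lp_norm r \<Omega> (\<lambda>x. h x - gs x) < d \<Longrightarrow> ennreal m \<le> emeasure lebesgue {x\<in>\<Omega>. h x \<le> a}"
    using sublevel_measure_stable[OF \<Omega> r gs \<epsilon> pos] by blast
  have "(\<lambda>n. 1 / real (Suc n)) \<longlonglongrightarrow> 0" using LIMSEQ_inverse_real_of_nat by (simp add: inverse_eq_divide)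
  from order_tendstoD(2)[OF this md(1)] order_tendstoD(2)[OF lim md(2)]
  have "eventually (\<lambda>l. 1 / real (Suc l) < m \<and> Lp_norm r \<Omega> (\<lambda>x. g (ts (k l)) x - gs x) < d) sequentially"
    by eventually_elim auto
  then obtain l where l: "1 / real (Suc l) < m" "Lp_norm r \<Omega> (\<lambda>x. g (ts (k l)) x - gs x) < d"
    by (auto simp: eventually_sequentially)
  have "ennreal m \<le> emeasure lebesgue {x\<in>\<Omega>. g (ts (k l)) x \<le> a}" by (rule md(3)[OF gL l(2)])
  also have "\<dots> < ennreal (1 / real (Suc (k l)))" by (rule ts(3))
  \<comment> \<open>A strictly increasing index map satisfies k l \<ge> l, so the bound 1/(l+1)
    survives the passage to the subsequence.\<close>
  also have "\<dots> \<le> ennreal (1 / real (Suc l))"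
    using seq_suble[OF k, of l] by (intro ennreal_leI frac_le) auto
  also have "\<dots> \<le> ennreal m" using l(1) by (intro ennreal_leI) simp
  finally show False by simp
qed

section \<open>Uniform lower bound for the vanishing sets and conclusion\<close>

theorem lemma3p1:
  fixes \<Omega> :: "(real^3) set"
    and I \<K> :: "real set"
    and f :: "real \<Rightarrow> real \<Rightarrow> real^3 \<Rightarrow> real"
    and g :: "real \<Rightarrow> real^3 \<Rightarrow> real"
    and q :: ennreal
    and \<delta> \<epsilon> :: real
  assumes "smooth_bounded_domain \<Omega>"
    and "(\<exists>a b. a < b \<and> I = {a..b}) \<or> (\<exists>\<tau>>0. I = {\<tau>..})"
    and "\<forall>\<rho>\<in>\<K>. Linfty_in_time I (H1 \<Omega>) (H1_norm \<Omega>) (f \<rho>)"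
    and "\<forall>\<rho>\<in>\<K>. continuous_in_time I (Lp 2 \<Omega>) (Lp_norm 2 \<Omega>) (f \<rho>)"
    and "1 \<le> q"
    and "continuous_in_time I (Lp q \<Omega>) (Lp_norm q \<Omega>) g"
    and "0 < \<delta>" and "\<delta> < 1/2"
    and "\<forall>\<rho>\<in>\<K>. \<forall>t\<in>I. AE x in lebesgue_on \<Omega>. g t x \<le> 1 - 2*\<delta> \<longrightarrow> f \<rho> t x = 0"
    and "0 < \<epsilon>"
    and "\<forall>t\<in>I. emeasure lebesgue {x\<in>\<Omega>. g t x \<le> 1 - 2*\<delta> - \<epsilon>} > 0"
    and "\<forall>\<tau>>0. I = {\<tau>..} \<longrightarrow>
          (\<forall>ts :: nat \<Rightarrow> real. range ts \<subseteq> I \<and> filterlim ts at_top sequentially \<longrightarrow>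
            (\<exists>(k :: nat \<Rightarrow> nat) (r :: ennreal) gs \<epsilon>'.
               strict_mono k \<and> 1 \<le> r \<and> 0 < \<epsilon>' \<and>
               tendsto_Lp r \<Omega> (\<lambda>l. g (ts (k l))) gs \<and>
               emeasure lebesgue {x\<in>\<Omega>. gs x \<le> 1 - 2*\<delta> - \<epsilon>'} > 0))"
  shows "\<exists>C\<^sub>P>0. \<forall>\<rho>\<in>\<K>. \<forall>t\<in>I.
           f \<rho> t \<in> H1 \<Omega> \<and>
           Lp_norm 2 \<Omega> (f \<rho> t) \<le> C\<^sub>P * Lp_norm 2 \<Omega> (weak_grad \<Omega> (f \<rho> t))"
proof -
  have \<Omega>: "open \<Omega>" "bounded \<Omega>" using assms(1) by (auto simp: smooth_bounded_domain_def)
  have \<Omega>l: "\<Omega> \<in> sets lebesgue" using \<Omega> by auto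
  define a where "a = 1 - 2 * \<delta>"
  have pos: "emeasure lebesgue {x\<in>\<Omega>. g t x \<le> a - \<epsilon>} > 0" if "t \<in> I" for t
    using assms(11) that by (simp add: a_def)
  note bound_compact = sublevel_measure_bound_compact[OF \<Omega> assms(5,6,10) pos]
  have "\<exists>m>0. \<forall>t\<in>I. ennreal m \<le> emeasure lebesgue {x\<in>\<Omega>. g t x \<le> a}"
    using assms(2)
  proof (elim disjE exE conjE)
    fix c d assume "c < d" "I = {c..d}"
    then have "compact I" by simp
    then obtain m where "m > 0" "\<And>t. t \<in> I \<Longrightarrow> ennreal m \<le> emeasure lebesgue {x\<in>\<Omega>. g t x \<le> a}"
      using bound_compact[of I] by blast
    then show ?thesis by blast
  next
    fix \<tau> :: real assume \<tau>: "\<tau> > 0" "I = {\<tau>..}"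
    have seq: "\<exists>(k :: nat \<Rightarrow> nat) r gs \<epsilon>'. strict_mono k \<and> 1 \<le> r \<and> 0 < \<epsilon>' \<and>
        tendsto_Lp r \<Omega> (\<lambda>l. g (ts (k l))) gs \<and> emeasure lebesgue {x\<in>\<Omega>. gs x \<le> a - \<epsilon>'} > 0"
      if "range ts \<subseteq> I" "filterlim ts at_top sequentially" for ts :: "nat \<Rightarrow> real"
      unfolding a_def by (rule assms(12)[rule_format, OF \<tau> conjI[OF that]])
    have "\<exists>R m. m > 0 \<and> (\<forall>t\<in>I. t \<ge> R \<longrightarrow> ennreal m \<le> emeasure lebesgue {x\<in>\<Omega>. g t x \<le> a})"
      by (rule sublevel_measure_bound_at_infinity[OF \<Omega>, of I g a]) (erule (1) seq, blast)
    then obtain R m where R: "m > 0" "\<And>t. t \<in> I \<Longrightarrow> t \<ge> R \<Longrightarrow> ennreal m \<le> emeasure lebesgue {x\<in>\<Omega>. g t x \<le> a}"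
      by blast
    have "{\<tau>..R} \<subseteq> I" using \<tau>(2) by auto
    then obtain m' where m': "m' > 0" "\<And>t. t \<in> {\<tau>..R} \<Longrightarrow> ennreal m' \<le> emeasure lebesgue {x\<in>\<Omega>. g t x \<le> a}"
      using bound_compact[of "{\<tau>..R}"] by blast
    \<comment> \<open>Beyond R the bound at infinity applies, before R the bound on the compact
      piece.\<close>
    have "ennreal (min m m') \<le> emeasure lebesgue {x\<in>\<Omega>. g t x \<le> a}" if t: "t \<in> I" for t
    proof (cases "t \<ge> R")
      case True
      have "ennreal (min m m') \<le> ennreal m" by (rule ennreal_leI) simp
      also have "\<dots> \<le> emeasure lebesgue {x\<in>\<Omega>. g t x \<le> a}" by (rule R(2)[OF t True])
      finally show ?thesis .
    next
      case False
      have "ennreal (min m m') \<le> ennreal m'" by (rule ennreal_leI) simp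
      also have "\<dots> \<le> emeasure lebesgue {x\<in>\<Omega>. g t x \<le> a}"
        using False t \<tau>(2) by (intro m'(2)) auto
      finally show ?thesis .
    qed
    then show ?thesis using R(1) m'(1) by (intro exI[of _ "min m m'"]) auto
  qed
  then obtain m where m: "m > 0" "\<And>t. t \<in> I \<Longrightarrow> ennreal m \<le> emeasure lebesgue {x\<in>\<Omega>. g t x \<le> a}"
    by blast
  obtain C where C: "C > 0" "\<And>u Z. u \<in> H1 \<Omega> \<Longrightarrow> Z \<in> sets lebesgue \<Longrightarrow> Z \<subseteq> \<Omega> \<Longrightarrow>
      ennreal m \<le> emeasure lebesgue Z \<Longrightarrow> AE x in lebesgue_on \<Omega>. x \<in> Z \<longrightarrow> u x = 0 \<Longrightarrow>
      Lp_norm 2 \<Omega> u \<le> C * Lp_norm 2 \<Omega> (weak_grad \<Omega> u)"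
    using poincare_vanishing_H1[OF assms(1) m(1)] by blast
  show ?thesis
  proof (intro exI[of _ C] conjI ballI C(1))
    fix \<rho> t assume \<rho>: "\<rho> \<in> \<K>" and t: "t \<in> I"
    \<comment> \<open>\<open>weak_grad\<close> is a choice and denotes a gradient only for members
      of \<open>H1\<close>; membership therefore comes before the estimate.\<close>
    show H: "f \<rho> t \<in> H1 \<Omega>"
      using assms(2,3,4) \<rho> t by (intro Linfty_H1_everywhere[OF \<Omega>, of I "f \<rho>"]) auto
    have [measurable]: "g t \<in> borel_measurable (lebesgue_on \<Omega>)"
      using assms(6) t by (auto simp: continuous_in_time_def Lp_def)
    have "{x\<in>space (lebesgue_on \<Omega>). g t x \<le> a} \<in> sets (lebesgue_on \<Omega>)" by measurable
    then have "{x\<in>\<Omega>. g t x \<le> a} \<in> sets lebesgue"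
      using \<Omega>l by (simp add: sets_restrict_space_iff space_restrict_space)
    then show "Lp_norm 2 \<Omega> (f \<rho> t) \<le> C * Lp_norm 2 \<Omega> (weak_grad \<Omega> (f \<rho> t))"
      using assms(9) \<rho> t by (intro C(2)[OF H _ _ m(2)[OF t]]) (auto simp: a_def elim!: eventually_mono)
  qed
qed

end
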